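(* Let $(Z_N(i))_{0\le i\le N}$ be the breadth-first walk of a Poisson random hypergraph on $N$ vertices with parameters $(\beta_j)_{j\ge2}$, and suppose there exists $k\ge3$ such that $\beta_j=1/(j(j-1))$ for all $2\le j\le k-1$. Define $\bar Z_N(t)=N^{-\alpha(k)/2}Z_N(\lfloor N^{\alpha(k)}t\rfloor)$. Then $\bar Z_N\xrightarrow{d}W^k$ as $N\to\infty$ in $D[0,\infty)$ (with the topology of uniform convergence on compact time intervals).
   Context: Poisson random hypergraph: vertex set $V=\{1,\dots,N\}$; $(\beta_j)_{j\ge2}$ nonnegative reals, $\beta(t)=\sum_{j\ge2}\beta_jt^j$ with $\beta'(1)<\infty$; for each $A\subseteq V$ with $|A|=j\ge2$, the number of hyperedges on $A$ is Poisson with mean $N\beta_j/\binom{N}{j}$, independently over $A$. A 1-edge is a patch. Deleting (collapsing) a patched vertex $v$ removes $v$ and its patch and replaces each other hyperedge containing $v$ by the hyperedge on its remaining vertices (so 2-edges containing $v$ become patches). Breadth-first ordering and walk: start with no patches. Put a patch on the lowest-labelled vertex and call it $v(1)$. Having defined $v(1),\dots,v(i)$ and processed $v(1),\dots,v(i-1)$, the children of $v(i)$ are the vertices $w$ not yet assigned a number $v(\cdot)$ that are joined to $v(i)$ by a 2-edge in the current collapsed hypergraph (equivalently, some original hyperedge consists of $v(i)$, $w$ and a subset of $\{v(1),\dots,v(i-1)\}$); they receive the next available numbers in the order of their original labels (and carry patches), and then $v(i)$ is deleted with collapse. If after this no numbered-but-undeleted vertex remains, a patch is put on the lowest-labelled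 un-numbered vertex, which becomes the next numbered vertex. Let $c(i)$ be the number of children of $v(i)$; the breadth-first walk is $Z_N(0)=0$, $Z_N(i)=Z_N(i-1)+c(i)-1$ for $1\le i\le N$. Notation: $\alpha(k)=(2k-4)/(2k-3)$, $\mu_k=k(k-1)\beta_k-1$, $W^k(t)=B(t)+\frac{\mu_k}{k-1}t^{k-1}$ with $B$ a standard Brownian motion. *)

theory Defs
  imports "HOL-Probability.Probability"
begin

definition poisson0 :: "real \<Rightarrow> nat pmf" where
  "poisson0 r = (if 0 < r then poisson_pmf r else return_pmf 0)"

text \<open>A hypergraph on {1..N} is a multiplicity function H :: nat set => nat
  (H A = number of hyperedges on the vertex set A).  Poisson random hypergraph law.\<close>
definition poisson_hypergraph :: "(nat \<Rightarrow> real) \<Rightarrow> nat \<Rightarrow> (nat set \<Rightarrow> nat) pmf" where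
  "poisson_hypergraph \<beta> N =
     Pi_pmf {A. A \<subseteq> {1..N} \<and> 2 \<le> card A} 0
       (\<lambda>A. poisson0 (real N * \<beta> (card A) / real (N choose card A)))"

text \<open>Before processing step i+1 (vertex v(i+1) = o ! i, 0-based): if no numbered but
  undeleted vertex remains, put a patch on the lowest-labelled un-numbered vertex.\<close>
definition bfs_restart :: "nat \<Rightarrow> nat list \<Rightarrow> nat \<Rightarrow> nat list" where
  "bfs_restart N ord i =
     (if length ord \<le> i \<and> {1..N} - set ord \<noteq> {} then ord @ [Min ({1..N} - set ord)] else ord)"

text \<open>bfs_order H N i = list of numbered vertices v(1), v(2), ... after v(1..i)
  have been processed (and deleted).  Children of v = o'!i are the un-numbered w
  such that some hyperedge consists of v, w and already deleted vertices.\<close>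
fun bfs_order :: "(nat set \<Rightarrow> nat) \<Rightarrow> nat \<Rightarrow> nat \<Rightarrow> nat list" where
  "bfs_order H N 0 = []"
| "bfs_order H N (Suc i) =
     (let o' = bfs_restart N (bfs_order H N i) i;
          v = o' ! i
      in o' @ sorted_list_of_set
           {w \<in> {1..N} - set o'. \<exists>A. 0 < H A \<and> v \<in> A \<and> w \<in> A \<and> A - {v, w} \<subseteq> set (take i o')})"

text \<open>c(i+1) = number of children of v(i+1).\<close>
definition bfs_children :: "(nat set \<Rightarrow> nat) \<Rightarrow> nat \<Rightarrow> nat \<Rightarrow> nat" where
  "bfs_children H N i =
     length (bfs_order H N (Suc i)) - length (bfs_restart N (bfs_order H N i) i)"

definition bfs_walk :: "(nat set \<Rightarrow> nat) \<Rightarrow> nat \<Rightarrow> nat \<Rightarrow> int" where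
  "bfs_walk H N i = (\<Sum>m<min i N. int (bfs_children H N m) - 1)"

definition alpha :: "nat \<Rightarrow> real" where
  "alpha k = (2 * real k - 4) / (2 * real k - 3)"

definition mu :: "(nat \<Rightarrow> real) \<Rightarrow> nat \<Rightarrow> real" where
  "mu \<beta> k = real k * (real k - 1) * \<beta> k - 1"

definition rescaled_walk :: "nat \<Rightarrow> real \<Rightarrow> (nat set \<Rightarrow> nat) \<Rightarrow> real \<Rightarrow> real" where
  "rescaled_walk N a H t =
     real N powr (- a / 2) * real_of_int (bfs_walk H N (nat \<lfloor>real N powr a * t\<rfloor>))"

definition rescaled_walk_law :: "(nat \<Rightarrow> real) \<Rightarrow> nat \<Rightarrow> nat \<Rightarrow> (real \<Rightarrow> real) pmf" where
  "rescaled_walk_law \<beta> k N = map_pmf (rescaled_walk N (alpha k)) (poisson_hypergraph \<beta> N)"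

definition ucc_continuous :: "((real \<Rightarrow> real) \<Rightarrow> real) \<Rightarrow> bool" where
  "ucc_continuous F \<longleftrightarrow>
     (\<forall>x \<epsilon>. 0 < \<epsilon> \<longrightarrow> (\<exists>T \<delta>. 0 < \<delta> \<and>
        (\<forall>y. (\<forall>t\<in>{0..T}. \<bar>y t - x t\<bar> < \<delta>) \<longrightarrow> \<bar>F y - F x\<bar> < \<epsilon>)))"

definition standard_BM :: "'a measure \<Rightarrow> ('a \<Rightarrow> real \<Rightarrow> real) \<Rightarrow> bool" where
  "standard_BM M B \<longleftrightarrow> prob_space M \<and>
     (\<forall>t. (\<lambda>w. B w t) \<in> borel_measurable M) \<and>
     (\<forall>w\<in>space M. B w 0 = 0 \<and> continuous_on {0..} (B w)) \<and>
     (\<forall>s t. 0 \<le> s \<and> s < t \<longrightarrow>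
        distributed M lborel (\<lambda>w. B w t - B w s) (normal_density 0 (sqrt (t - s)))) \<and>
     (\<forall>n (ts :: nat \<Rightarrow> real). 0 \<le> ts 0 \<and> (\<forall>i<n. ts i < ts (Suc i)) \<longrightarrow>
        prob_space.indep_vars M (\<lambda>_. borel) (\<lambda>i w. B w (ts (Suc i)) - B w (ts i)) {..<n})"

end

theory Submission
  imports Defs "HOL-Probability.Probability"
begin

text \<open>Hyperedges with two vertices outside the processed set have not been inspected, so given the past
  the number of children of \<open>v(i+1)\<close> is binomial. Its parameter is governed by
  \<open>(1 - i/N) * \<beta>''(i/N)\<close>, and criticality of \<open>\<beta>\<close> below \<open>k\<close> turns its mean into
  \<open>1 + \<mu> (i/N)^(k-2)\<close> up to negligible terms; the only dependence on the past is
  through the number of vertices waiting in the queue, which is of order \<open>N^(alpha/2)\<close> and hence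
  too small to matter. Comparing one step at a time with a Gaussian factor gives the characteristic
  functions of the increments of the walk on a grid, and an exponential supermartingale controls the
  oscillation between grid points. Finally \<open>F\<close> is approximated from below by Lipschitz functionals,
  for which grid convergence and the oscillation bound suffice.\<close>

section \<open>Exploration of the hypergraph\<close>

text \<open>The exponent is forced by a balance. Over \<open>N^alpha\<close> steps the fluctuations
  have order \<open>N^(alpha/2)\<close>, while a drift of order \<open>(i/N)^(k-2)\<close> per step
  accumulates to \<open>N^alpha * N^((alpha-1)(k-2))\<close>; the two agree exactly when
  \<open>(1-alpha)(k-2) = alpha/2\<close>. A queued vertex shifts the conditional mean by
  \<open>O(1/N)\<close>, so a queue of order \<open>N^(alpha/2)\<close> over \<open>N^alpha\<close>
  steps shifts the rescaled walk by \<open>O(N^(alpha-1))\<close>, which vanishes. The obstacle is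
  that the queue has no useful deterministic bound: only its second moment is controlled, through an
  upper bound on the mean in which the queue does not occur. Conditional estimates therefore carry
  the queue as an explicit term that is averaged afterwards. The limit is tested on functionals of
  arbitrary real functions, and \<open>F\<close> is known to be measurable only along the limit
  paths; measurability of the Lipschitz approximants comes from finite grids and the continuity of
  those paths.\<close>

text \<open>The number of numbered, undeleted vertices other than the next one to be processed. The truncated
  subtraction is the restart: an empty queue with no new child stays empty.\<close>

definition queue :: "nat list \<Rightarrow> nat" where
  "queue cs = foldl (\<lambda>r c. r + c - 1) 0 cs"

lemma queue_Nil [simp]: "queue [] = 0"
  and queue_snoc [simp]: "queue (cs @ [c]) = queue cs + c - 1"
  by (simp_all add: queue_def)

definition bfs_history :: "(nat set \<Rightarrow> nat) \<Rightarrow> nat \<Rightarrow> nat \<Rightarrow> nat list" where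
  "bfs_history H N n = map (bfs_children H N) [0..<n]"

lemma length_bfs_history [simp]: "length (bfs_history H N n) = n"
  by (simp add: bfs_history_def)

lemma bfs_history_0 [simp]: "bfs_history H N 0 = []"
  and bfs_history_Suc: "bfs_history H N (Suc n) = bfs_history H N n @ [bfs_children H N n]"
  by (simp_all add: bfs_history_def)

definition bfs_started :: "(nat set \<Rightarrow> nat) \<Rightarrow> nat \<Rightarrow> nat \<Rightarrow> nat list" where
  "bfs_started H N i = bfs_restart N (bfs_order H N i) i"

text \<open>The order \<open>os\<close> is an argument instead of being recomputed from
  \<open>H\<close>, so that the children can be studied as a function of the uninspected hyperedges
  with the past frozen.\<close>

definition bfs_new :: "(nat set \<Rightarrow> nat) \<Rightarrow> nat \<Rightarrow> nat \<Rightarrow> nat list \<Rightarrow> nat set" where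
  "bfs_new H N i os =
     {w \<in> {1..N} - set os. \<exists>A. 0 < H A \<and> os ! i \<in> A \<and> w \<in> A \<and> A - {os ! i, w} \<subseteq> set (take i os)}"

lemma finite_bfs_new [simp]: "finite (bfs_new H N i os)"
  by (simp add: bfs_new_def)

lemma bfs_order_Suc_started:
  "bfs_order H N (Suc i) =
     bfs_started H N i @ sorted_list_of_set (bfs_new H N i (bfs_started H N i))"
  by (simp add: bfs_started_def bfs_new_def Let_def)

lemma bfs_children_card: "bfs_children H N i = card (bfs_new H N i (bfs_started H N i))"
  unfolding bfs_children_def bfs_order_Suc_started by (simp add: bfs_started_def)

lemma bfs_restart_valid:
  assumes "distinct os" "set os \<subseteq> {1..N}"
  shows "distinct (bfs_restart N os i)" "set (bfs_restart N os i) \<subseteq> {1..N}"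
proof -
  have "Min ({1..N} - set os) \<in> {1..N} - set os" if "{1..N} - set os \<noteq> {}"
    using that by (intro Min_in) auto
  then show "distinct (bfs_restart N os i)" "set (bfs_restart N os i) \<subseteq> {1..N}"
    using assms unfolding bfs_restart_def by auto
qed

lemma bfs_order_valid: "distinct (bfs_order H N i) \<and> set (bfs_order H N i) \<subseteq> {1..N}"
proof (induction i)
  case (Suc i)
  note v = bfs_restart_valid[of "bfs_order H N i" N i, folded bfs_started_def]
  show ?case using v Suc unfolding bfs_order_Suc_started by (auto simp: bfs_new_def)
qed simp

lemma bfs_started_valid:
  "distinct (bfs_started H N i)" "set (bfs_started H N i) \<subseteq> {1..N}"
  using bfs_restart_valid bfs_order_valid unfolding bfs_started_def by metis+

text \<open>A distinct list of at most \<open>i < N\<close> labels cannot exhaust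
  \<open>{1..N}\<close>, so a restart always finds a vertex.\<close>

lemma length_restart:
  assumes "distinct os" "set os \<subseteq> {1..N}" "i < N"
  shows "length (bfs_restart N os i) = (if length os \<le> i then Suc (length os) else length os)"
proof -
  have "{1..N} - set os \<noteq> {}" if "length os \<le> i"
  proof
    assume "{1..N} - set os = {}"
    then have "card {1..N} \<le> card (set os)" by (intro card_mono) auto
    with assms that show False by (simp add: distinct_card)
  qed
  then show ?thesis by (simp add: bfs_restart_def)
qed

text \<open>Ties the number of numbered vertices to the child counts alone, which gives the counts a
  transition law of their own. When queue and children are both empty, the restart supplies the one
  vertex that the truncated subtraction fails to remove.\<close>

lemma length_bfs_started:
  "i < N \<Longrightarrow> length (bfs_started H N i) = Suc i + queue (bfs_history H N i)"
proof (induction i)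
  case 0
  then show ?case
    by (simp add: bfs_started_def bfs_restart_def)
next
  case (Suc i)
  then have "length (bfs_order H N (Suc i)) = Suc i + queue (bfs_history H N i) + bfs_children H N i"
    by (simp add: bfs_order_Suc_started bfs_children_card del: bfs_order.simps)
  with Suc.prems bfs_order_valid[of H N "Suc i"] show ?case
    by (simp add: bfs_started_def[of _ _ "Suc i"] length_restart bfs_history_Suc del: bfs_order.simps)
qed

lemma length_bfs_order_ge: "i \<le> N \<Longrightarrow> i \<le> length (bfs_order H N i)"
proof (cases i)
  case (Suc j)
  assume "i \<le> N"
  with Suc show ?thesis
    by (simp add: bfs_order_Suc_started length_bfs_started del: bfs_order.simps)
qed simp

lemma take_bfs_started:
  assumes "i \<le> N"
  shows "take i (bfs_started H N i) = take i (bfs_order H N i)"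
  using length_bfs_order_ge[OF assms, of H] by (auto simp: bfs_started_def bfs_restart_def)

lemma set_take_bfs_order_mono:
  assumes "i < N"
  shows "set (take i (bfs_order H N i)) \<subseteq> set (take (Suc i) (bfs_order H N (Suc i)))"
proof -
  have "take i (bfs_order H N i) = take i (bfs_order H N (Suc i))"
    using assms take_bfs_started[of i N H] length_bfs_started[OF assms, of H]
    by (simp add: bfs_order_Suc_started del: bfs_order.simps)
  then show ?thesis
    by (simp add: set_take_subset_set_take del: bfs_order.simps)
qed

text \<open>The first \<open>i\<close> steps inspect only hyperedges with at most one vertex outside \<open>v(1),\<dots>,v(i)\<close>.\<close>

lemma bfs_order_cong:
  assumes "i \<le> N"
    and "\<And>A. finite A \<Longrightarrow> card (A - set (take i (bfs_order H N i))) \<le> 1 \<Longrightarrow> H' A = H A"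
  shows "\<forall>j\<le>i. bfs_order H' N j = bfs_order H N j"
  using assms
proof (induction i)
  case (Suc i)
  let ?os = "bfs_started H N i"
  have i: "i < N" using Suc.prems by simp
  have mono: "set (take i (bfs_order H N i)) \<subseteq> set (take (Suc i) (bfs_order H N (Suc i)))"
    by (rule set_take_bfs_order_mono[OF i])
  have IH: "\<forall>j\<le>i. bfs_order H' N j = bfs_order H N j"
  proof (rule Suc.IH)
    fix A :: "nat set"
    assume "finite A" "card (A - set (take i (bfs_order H N i))) \<le> 1"
    moreover have "card (A - set (take (Suc i) (bfs_order H N (Suc i))))
        \<le> card (A - set (take i (bfs_order H N i)))"
      using \<open>finite A\<close> mono by (intro card_mono) auto
    ultimately show "H' A = H A" using Suc.prems(2)[of A] by linarith
  qed (use i in simp)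
  then have st: "bfs_started H' N i = ?os" by (simp add: bfs_started_def)
  have v: "?os ! i \<in> set (take (Suc i) (bfs_order H N (Suc i)))"
    using length_bfs_started[OF i, of H]
    by (simp add: bfs_order_Suc_started take_Suc_conv_app_nth del: bfs_order.simps)
  have tk: "set (take i ?os) \<subseteq> set (take (Suc i) (bfs_order H N (Suc i)))"
    using take_bfs_started[of i N H] i mono by simp
  \<comment> \<open>Once the current vertex \<open>?os ! i\<close> counts as processed, a hyperedge
    tested for the child \<open>w\<close> has no vertex but \<open>w\<close> outside the processed
    set.\<close>
  have "H' A = H A" if "A - {?os ! i, w} \<subseteq> set (take i ?os)" for A w
  proof (rule Suc.prems(2))
    show "finite A" using finite_subset[OF that] by auto
    have "A - set (take (Suc i) (bfs_order H N (Suc i))) \<subseteq> {w}"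
      using that v tk by blast
    then show "card (A - set (take (Suc i) (bfs_order H N (Suc i)))) \<le> 1"
      using card_mono[of "{w}" "A - set (take (Suc i) (bfs_order H N (Suc i)))"] by simp
  qed
  then have "bfs_new H' N i ?os = bfs_new H N i ?os"
    unfolding bfs_new_def by metis
  then have "bfs_order H' N (Suc i) = bfs_order H N (Suc i)"
    by (simp add: bfs_order_Suc_started st del: bfs_order.simps)
  with IH show ?case by (auto simp: le_Suc_eq simp del: bfs_order.simps)
qed simp

lemma bfs_history_cong:
  assumes "\<forall>j\<le>i. bfs_order H' N j = bfs_order H N j"
  shows "bfs_history H' N i = bfs_history H N i"
  using assms by (auto simp: bfs_history_def bfs_children_def simp del: bfs_order.simps)

section \<open>Conditional law of the children given the past\<close>

text \<open>Functions of disjoint blocks of independent coordinates are independent; the blocks are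
  split off one at a time. That \<open>f w\<close> reads only the block \<open>E w\<close> is
  expressed as a congruence, since its argument is a total function.\<close>

lemma Pi_pmf_blocks:
  assumes W: "finite W" and E: "\<And>w. w \<in> W \<Longrightarrow> finite (E w)" and disj: "disjoint_family_on E W"
    and f: "\<And>w g h. w \<in> W \<Longrightarrow> (\<And>a. a \<in> E w \<Longrightarrow> g a = h a) \<Longrightarrow> f w g = f w h"
  shows "map_pmf (\<lambda>g w. if w \<in> W then f w g else d) (Pi_pmf (\<Union>w\<in>W. E w) e q) =
         Pi_pmf W d (\<lambda>w. map_pmf (f w) (Pi_pmf (E w) e q))"
  using assms
proof (induction W rule: finite_induct)
  case (insert x W)
  let ?U = "\<Union>w\<in>W. E w"
  have xU: "E x \<inter> ?U = {}"
    using insert.prems(2) insert.hyps(2) by (auto simp: disjoint_family_on_def)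
  have IH: "map_pmf (\<lambda>g w. if w \<in> W then f w g else d) (Pi_pmf ?U e q) =
         Pi_pmf W d (\<lambda>w. map_pmf (f w) (Pi_pmf (E w) e q))"
  proof (rule insert.IH)
    show "disjoint_family_on E W"
      using insert.prems(2) by (auto simp: disjoint_family_on_def)
    show "f w g = f w h" if "w \<in> W" "\<And>a. a \<in> E w \<Longrightarrow> g a = h a" for w g h
      using that by (intro insert.prems(3)) auto
  qed (use insert.prems in simp)
  have fx: "f x (\<lambda>a. if a \<in> E x then g a else h a) = f x g" for g h
    by (rule insert.prems(3)) auto
  have fw: "f w (\<lambda>a. if a \<in> E x then g a else h a) = f w h" if "w \<in> W" for g h w
    using that xU by (intro insert.prems(3)) auto
  have "map_pmf (\<lambda>g w. if w \<in> insert x W then f w g else d) (Pi_pmf (\<Union>w\<in>insert x W. E w) e q)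
      = map_pmf (\<lambda>(g,h) w. if w \<in> insert x W then f w (\<lambda>a. if a \<in> E x then g a else h a) else d)
          (pair_pmf (Pi_pmf (E x) e q) (Pi_pmf ?U e q))"
    using insert.prems(1) insert.hyps xU
    by (simp add: Pi_pmf_union pmf.map_comp o_def case_prod_unfold)
  also have "\<dots> = map_pmf (\<lambda>(y,k). k(x := y))
       (pair_pmf (map_pmf (f x) (Pi_pmf (E x) e q))
         (map_pmf (\<lambda>g w. if w \<in> W then f w g else d) (Pi_pmf ?U e q)))"
    unfolding map_pair[symmetric] pmf.map_comp
    by (intro map_pmf_cong refl) (use insert.hyps in \<open>auto simp: fun_eq_iff fx fw\<close>)
  also have "\<dots> = Pi_pmf (insert x W) d (\<lambda>w. map_pmf (f w) (Pi_pmf (E w) e q))"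
    unfolding IH using insert.hyps by (subst Pi_pmf_insert) auto
  finally show ?case .
qed simp

lemma map_pmf_ex_pos_bernoulli:
  fixes q :: "'a \<Rightarrow> nat pmf"
  assumes "finite E"
  shows "map_pmf (\<lambda>g. \<exists>a\<in>E. 0 < g a) (Pi_pmf E 0 q) = bernoulli_pmf (1 - (\<Prod>a\<in>E. pmf (q a) 0))"
proof -
  let ?p = "\<Prod>a\<in>E. pmf (q a) 0"
  have p: "0 \<le> ?p" "?p \<le> 1" by (auto intro!: prod_nonneg prod_le_1 simp: pmf_le_1)
  have "pmf (map_pmf (\<lambda>g. \<exists>a\<in>E. 0 < g a) (Pi_pmf E 0 q)) False
      = measure_pmf.prob (Pi_pmf E 0 q) ((\<lambda>g. \<exists>a\<in>E. 0 < g a) -` {False})"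
    by (rule pmf_map)
  \<comment> \<open>Functions in the support take the default value 0 outside \<open>E\<close>, so
    absence of all edges of \<open>E\<close> leaves only the zero function.\<close>
  also have "\<dots> = measure_pmf.prob (Pi_pmf E 0 q) {\<lambda>_. 0}"
    by (intro measure_prob_cong_0)
       (auto simp: pmf_Pi assms fun_eq_iff, metis neq0_conv)
  also have "\<dots> = ?p"
    by (simp add: measure_pmf_single pmf_Pi assms)
  finally have F: "pmf (map_pmf (\<lambda>g. \<exists>a\<in>E. 0 < g a) (Pi_pmf E 0 q)) False = ?p" .
  show ?thesis
  proof (rule pmf_eqI)
    fix b
    show "pmf (map_pmf (\<lambda>g. \<exists>a\<in>E. 0 < g a) (Pi_pmf E 0 q)) b = pmf (bernoulli_pmf (1 - ?p)) b"
      using F p by (cases b) (auto simp: pmf_True_conv_False)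
  qed
qed

lemma sum_Pow_card:
  fixes f :: "nat \<Rightarrow> real"
  assumes "finite S"
  shows "(\<Sum>A\<in>Pow S. f (card A)) = (\<Sum>l\<le>card S. real (card S choose l) * f l)"
proof -
  have "(\<Sum>A\<in>Pow S. f (card A)) = (\<Sum>l\<in>{..card S}. \<Sum>A\<in>{A \<in> Pow S. card A = l}. f (card A))"
    using assms by (intro sum.group[symmetric]) (auto intro: card_mono)
  also have "\<dots> = (\<Sum>l\<le>card S. real (card S choose l) * f l)"
    by (intro sum.cong refl) (simp add: n_subsets[OF assms])
  finally show ?thesis .
qed

lemma pmf_poisson0_0: "0 \<le> r \<Longrightarrow> pmf (poisson0 r) 0 = exp (- r)"
  by (auto simp: poisson0_def)

text \<open>Expected number of hyperedges made of \<open>v(i+1)\<close>, one fixed unnumbered vertex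
  and a subset of the \<open>i\<close> processed vertices, sorted by the size \<open>l\<close> of
  that subset. Independent Poisson counts all vanish with probability \<open>exp\<close> of minus
  this rate, whence \<open>bfs_prob\<close>.\<close>

definition bfs_rate :: "(nat \<Rightarrow> real) \<Rightarrow> nat \<Rightarrow> nat \<Rightarrow> real" where
  "bfs_rate \<beta> N i = (\<Sum>l\<le>i. real (i choose l) * (real N * \<beta> (l + 2) / real (N choose (l + 2))))"

definition bfs_prob :: "(nat \<Rightarrow> real) \<Rightarrow> nat \<Rightarrow> nat \<Rightarrow> real" where
  "bfs_prob \<beta> N i = 1 - exp (- bfs_rate \<beta> N i)"

lemma bfs_rate_nonneg: "\<forall>j\<ge>2. 0 \<le> \<beta> j \<Longrightarrow> 0 \<le> bfs_rate \<beta> N i"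
  unfolding bfs_rate_def by (intro sum_nonneg mult_nonneg_nonneg divide_nonneg_nonneg) auto

lemma bfs_prob_bounds:
  assumes "\<forall>j\<ge>2. 0 \<le> \<beta> j"
  shows "0 \<le> bfs_prob \<beta> N i" "bfs_prob \<beta> N i \<le> 1"
  using bfs_rate_nonneg[OF assms, of N i] by (simp_all add: bfs_prob_def)

lemma measure_pair_pmf_Times:
  "measure_pmf.prob (pair_pmf p q) (A \<times> B) = measure_pmf.prob p A * measure_pmf.prob q B"
proof -
  have "measure_pmf.prob (pair_pmf p q) (A \<times> B) =
      measure_pmf.prob (pair_pmf p q) ((A \<inter> set_pmf p) \<times> (B \<inter> set_pmf q))"
    by (subst measure_Int_set_pmf[symmetric])
       (auto intro!: arg_cong[where f = "measure_pmf.prob _"])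
  also have "\<dots> = measure_pmf.prob p (A \<inter> set_pmf p) * measure_pmf.prob q (B \<inter> set_pmf q)"
    by (rule measure_pmf_prob_product) (auto intro: countable_subset[OF _ countable_set_pmf])
  finally show ?thesis by (simp add: measure_Int_set_pmf)
qed

text \<open>An edge that makes \<open>w\<close> a child contains \<open>v\<close> and
  \<open>w\<close> and otherwise only processed vertices. Hence the families \<open>E w\<close> are
  disjoint for distinct \<open>w\<close> and consist of uninspected sets, so that being a child is
  independent over the unnumbered vertices with a common probability.\<close>

lemma bfs_new_law:
  fixes \<beta> :: "nat \<Rightarrow> real"
  assumes nonneg: "\<forall>j\<ge>2. 0 \<le> \<beta> j"
    and os: "distinct os" "set os \<subseteq> {1..N}" "i < length os"
    and B: "B = {A. A \<subseteq> {1..N} \<and> 2 \<le> card A \<and> 1 < card (A - set (take i os))}"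
  shows "map_pmf (\<lambda>H. card (bfs_new H N i os))
      (Pi_pmf B 0 (\<lambda>A. poisson0 (real N * \<beta> (card A) / real (N choose card A)))) =
    binomial_pmf (N - length os) (bfs_prob \<beta> N i)"
proof -
  define q where "q = (\<lambda>A::nat set. poisson0 (real N * \<beta> (card A) / real (N choose card A)))"
  define v where "v = os ! i"
  define S where "S = set (take i os)"
  define W where "W = {1..N} - set os"
  define E where "E w = (\<lambda>T. insert v (insert w T)) ` Pow S" for w
  have v: "v \<in> set os" using os by (simp add: v_def)
  have vS: "v \<notin> S"
    using os unfolding v_def S_def by (auto simp: in_set_conv_nth nth_eq_iff_index_eq)
  have SO: "S \<subseteq> set os" by (auto simp: S_def dest: in_set_takeD)
  have finS: "finite S" and finW: "finite W" by (simp_all add: S_def W_def)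
  have cS: "card S = i" using os by (simp add: S_def distinct_card)
  have wS: "w \<notin> S" "w \<noteq> v" if "w \<in> W" for w using that SO v by (auto simp: W_def)
  have finE: "finite (E w)" for w using finS by (simp add: E_def)
  have EI: "A \<in> E w" if "v \<in> A" "w \<in> A" "A - {v, w} \<subseteq> S" for A w
    unfolding E_def using that by (intro image_eqI[of _ _ "A - {v,w}"]) auto
  have ED: "v \<in> A" "w \<in> A" "A - {v, w} \<subseteq> S" if "A \<in> E w" for A w
    using that by (auto simp: E_def)
  have disj: "disjoint_family_on E W"
    unfolding disjoint_family_on_def
  proof (intro ballI impI, rule ccontr)
    fix w w' assume w: "w \<in> W" "w' \<in> W" "w \<noteq> w'" "E w \<inter> E w' \<noteq> {}"
    then obtain A where "A \<in> E w" "A \<in> E w'" by blast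
    then show False using ED[of A w] ED[of A w'] wS w by blast
  qed
  have EB: "(\<Union>w\<in>W. E w) \<subseteq> B"
  proof
    fix A assume "A \<in> (\<Union>w\<in>W. E w)"
    then obtain w where w: "w \<in> W" "A \<in> E w" by blast
    note D = ED[OF w(2)]
    have sub: "A \<subseteq> {1..N}"
      using D(3) SO os(2) v w(1) unfolding W_def by blast
    have fin: "finite A" using finite_subset[OF sub] by simp
    have eq: "A - S = {v, w}" using D wS[OF w(1)] vS by blast
    have "card (A - S) = 2" unfolding eq using wS[OF w(1)] by simp
    moreover have "card (A - S) \<le> card A" using fin by (intro card_mono) auto
    ultimately show "A \<in> B" using sub unfolding B S_def by simp
  qed
  have finB: "finite B" unfolding B by (rule finite_subset[of _ "Pow {1..N}"]) auto
  have new: "bfs_new H N i os = {w\<in>W. \<exists>A\<in>E w. 0 < H A}" for H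
  proof -
    have "(\<exists>A. 0 < H A \<and> v \<in> A \<and> w \<in> A \<and> A - {v, w} \<subseteq> S) \<longleftrightarrow> (\<exists>A\<in>E w. 0 < H A)" for w
      using EI[of _ w] ED[of _ w] by metis
    then show ?thesis
      unfolding bfs_new_def W_def v_def[symmetric] S_def[symmetric] by simp
  qed
  \<comment> \<open>Restricting from \<open>B\<close> to the union of the families replaces all
    other multiplicities by 0, which no test for a child notices.\<close>
  have rest: "(\<exists>A\<in>E w. 0 < (if A \<in> (\<Union>w\<in>W. E w) then H A else 0)) \<longleftrightarrow> (\<exists>A\<in>E w. 0 < H A)"
    if "w \<in> W" for H :: "nat set \<Rightarrow> nat" and w using that by auto
  have prob: "1 - (\<Prod>a\<in>E w. pmf (q a) 0) = bfs_prob \<beta> N i" if w: "w \<in> W" for w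
  proof -
    have r: "0 \<le> real N * \<beta> (card T + 2) / real (N choose (card T + 2))" for T :: "nat set"
      using nonneg by (intro divide_nonneg_nonneg mult_nonneg_nonneg) auto
    have inj: "inj_on (\<lambda>T. insert v (insert w T)) (Pow S)"
      using wS[OF w] vS by (intro inj_on_inverseI[where g = "\<lambda>A. A - {v, w}"]) auto
    have crd: "card (insert v (insert w T)) = card T + 2" if "T \<subseteq> S" for T
    proof -
      have "finite T" using that finS by (rule finite_subset)
      moreover have "v \<notin> T" "w \<notin> T" "v \<noteq> w" using that wS[OF w] vS by auto
      ultimately show ?thesis by simp
    qed
    have "(\<Prod>a\<in>E w. pmf (q a) 0) = (\<Prod>T\<in>Pow S. pmf (q (insert v (insert w T))) 0)"
      unfolding E_def by (simp add: prod.reindex[OF inj])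
    also have "\<dots> = (\<Prod>T\<in>Pow S. exp (- (real N * \<beta> (card T + 2) / real (N choose (card T + 2)))))"
      using r by (intro prod.cong refl) (simp add: q_def crd pmf_poisson0_0 del: binomial_Suc_Suc)
    also have "\<dots> = exp (- (\<Sum>T\<in>Pow S. real N * \<beta> (card T + 2) / real (N choose (card T + 2))))"
      using finS by (simp add: exp_sum[symmetric] sum_negf)
    also have "(\<Sum>T\<in>Pow S. real N * \<beta> (card T + 2) / real (N choose (card T + 2))) = bfs_rate \<beta> N i"
      using sum_Pow_card[OF finS, of "\<lambda>l. real N * \<beta> (l + 2) / real (N choose (l + 2))"]
      by (simp add: cS bfs_rate_def)
    finally show ?thesis by (simp add: bfs_prob_def)
  qed
  have "map_pmf (\<lambda>H. card (bfs_new H N i os)) (Pi_pmf B 0 q) =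
      map_pmf (\<lambda>H. card {w\<in>W. \<exists>A\<in>E w. 0 < H A}) (Pi_pmf (\<Union>w\<in>W. E w) 0 q)"
    unfolding Pi_pmf_subset[OF finB EB] pmf.map_comp
    by (intro map_pmf_cong refl) (simp only: new o_def rest cong: conj_cong)
  also have "\<dots> = map_pmf (\<lambda>f. card {w\<in>W. f w})
      (map_pmf (\<lambda>H w. if w \<in> W then \<exists>A\<in>E w. 0 < H A else False) (Pi_pmf (\<Union>w\<in>W. E w) 0 q))"
    unfolding pmf.map_comp by (intro map_pmf_cong refl) (auto intro!: arg_cong[where f=card])
  also have "\<dots> = map_pmf (\<lambda>f. card {w\<in>W. f w})
      (Pi_pmf W False (\<lambda>w. map_pmf (\<lambda>H. \<exists>A\<in>E w. 0 < H A) (Pi_pmf (E w) 0 q)))"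
    by (subst Pi_pmf_blocks[where f = "\<lambda>w H. \<exists>A\<in>E w. 0 < H A"]) (auto simp: finW finE disj)
  also have "\<dots> = map_pmf (\<lambda>f. card {w\<in>W. f w}) (Pi_pmf W False (\<lambda>w. bernoulli_pmf (bfs_prob \<beta> N i)))"
    by (intro arg_cong[where f = "map_pmf _"] Pi_pmf_cong refl)
       (simp add: map_pmf_ex_pos_bernoulli finE prob)
  also have "\<dots> = binomial_pmf (N - length os) (bfs_prob \<beta> N i)"
  proof (rule binomial_pmf_altdef'[symmetric])
    show "card W = N - length os"
      using os(1,2) unfolding W_def by (simp add: card_Diff_subset distinct_card)
  qed (use bfs_prob_bounds[OF nonneg] finW in auto)
  finally show ?thesis by (simp add: q_def)
qed

text \<open>Which hyperedges have been inspected depends on the past, so independence can be used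
  only after fixing its value \<open>x\<close>. For fixed \<open>x\<close> the processed set
  \<open>S\<close> is deterministic: the event that the past equals \<open>x\<close> reads the
  family \<open>A1\<close>, the children of the next vertex read \<open>A2\<close>, and these are
  independent. The order belongs to the state because it determines \<open>S\<close>; the kernel
  itself sees only the queue.\<close>

lemma bfs_step_law:
  fixes \<beta> :: "nat \<Rightarrow> real"
  assumes nonneg: "\<forall>j\<ge>2. 0 \<le> \<beta> j" and i: "i < N"
  shows "map_pmf (\<lambda>H. ((bfs_order H N i, bfs_history H N i), bfs_children H N i)) (poisson_hypergraph \<beta> N) =
    bind_pmf (map_pmf (\<lambda>H. (bfs_order H N i, bfs_history H N i)) (poisson_hypergraph \<beta> N))
      (\<lambda>x. map_pmf (Pair x) (binomial_pmf (N - Suc i - queue (snd x)) (bfs_prob \<beta> N i)))"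
    (is "map_pmf (\<lambda>H. (?X H, ?c H)) ?P = ?R")
proof (rule pmf_eqI, clarify)
  fix os cs :: "nat list" and c :: nat
  define x where "x = (os, cs)"
  let ?K = "\<lambda>x. binomial_pmf (N - Suc i - queue (snd x)) (bfs_prob \<beta> N i)"
  have rhs: "pmf ?R (x, c) = pmf (map_pmf ?X ?P) x * pmf (?K x) c"
  proof -
    have "pmf (map_pmf (Pair y) (?K y)) (x, c) = indicator {x} y * pmf (?K x) c" for y
      by (auto simp: pmf_map indicator_def vimage_def measure_pmf_single)
    then have "pmf ?R (x, c) = measure_pmf.expectation (map_pmf ?X ?P) (\<lambda>y. indicator {x} y * pmf (?K x) c)"
      by (simp add: pmf_bind)
    also have "\<dots> = measure_pmf.prob (map_pmf ?X ?P) {x} * pmf (?K x) c"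
      by simp
    finally show ?thesis by (simp only: measure_pmf_single)
  qed
  have lhs: "pmf (map_pmf (\<lambda>H. (?X H, ?c H)) ?P) (x, c) = measure_pmf.prob ?P {H. ?X H = x \<and> ?c H = c}"
    by (auto simp: pmf_map intro!: arg_cong[where f = "measure_pmf.prob _"])
  have X: "pmf (map_pmf ?X ?P) x = measure_pmf.prob ?P {H. ?X H = x}"
    by (auto simp: pmf_map intro!: arg_cong[where f = "measure_pmf.prob _"])
  show "pmf (map_pmf (\<lambda>H. (?X H, ?c H)) ?P) ((os, cs), c) = pmf ?R ((os, cs), c)"
  proof (cases "\<exists>H. ?X H = x")
    case False
    then have "{H. ?X H = x \<and> ?c H = c} = {}" "{H. ?X H = x} = {}" by auto
    with rhs lhs X show ?thesis by (simp only: x_def) simp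
  next
    case True
    \<comment> \<open>A hypergraph realising \<open>x\<close> supplies the length and the
      distinctness of the order. Values of \<open>x\<close> that no hypergraph realises have
      probability 0 on both sides.\<close>
    then obtain H0 where H0: "?X H0 = x" ..
    define os' where "os' = bfs_restart N os i"
    have os': "os' = bfs_started H0 N i" using H0 by (simp add: os'_def x_def bfs_started_def)
    have len: "length os' = Suc i + queue cs"
      using length_bfs_started[OF i, of H0] H0 by (simp add: os' x_def)
    define S where "S = set (take i os')"
    have S: "set (take i (bfs_order H N i)) = S" if "?X H = x" for H
      using that i take_bfs_started[of i N H] by (simp add: S_def os'_def x_def bfs_started_def)
    let ?AA = "{A. A \<subseteq> {1..N} \<and> 2 \<le> card A}"
    define q where "q = (\<lambda>A::nat set. poisson0 (real N * \<beta> (card A) / real (N choose card A)))"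
    define A1 where "A1 = {A. A \<subseteq> {1..N} \<and> 2 \<le> card A \<and> card (A - S) \<le> 1}"
    define A2 where "A2 = {A. A \<subseteq> {1..N} \<and> 2 \<le> card A \<and> 1 < card (A - S)}"
    have fin: "finite A1" "finite A2"
      unfolding A1_def A2_def by (auto intro: finite_subset[of _ "Pow {1..N}"])
    have un: "?AA = A1 \<union> A2" "A1 \<inter> A2 = {}" by (auto simp: A1_def A2_def)
    let ?m = "\<lambda>f g A. if A \<in> A1 then f A else g A"
    have P: "?P = map_pmf (\<lambda>(f, g). ?m f g) (pair_pmf (Pi_pmf A1 0 q) (Pi_pmf A2 0 q))"
      unfolding poisson_hypergraph_def un(1) q_def[symmetric]
      by (rule Pi_pmf_union[OF fin un(2)])
    have supp: "f A = 0" if "f \<in> set_pmf (Pi_pmf A1 0 q)" "A \<notin> A1" for f A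
      using subsetD[OF set_Pi_pmf_subset[OF fin(1)] that(1)] that(2) by simp
    have supp2: "g A = 0" if "g \<in> set_pmf (Pi_pmf A2 0 q)" "A \<notin> A2" for g A
      using subsetD[OF set_Pi_pmf_subset[OF fin(2)] that(1)] that(2) by simp
    have cong: "?X H' = x" if "?X H = x" "\<And>A. card (A - S) \<le> 1 \<Longrightarrow> H' A = H A" for H H'
    proof -
      have "\<forall>j\<le>i. bfs_order H' N j = bfs_order H N j"
        using i that(2) S[OF that(1)] by (intro bfs_order_cong) simp_all
      then show ?thesis using bfs_history_cong[of i H' N H] that(1) by simp
    qed
    have Xm: "?X (?m f g) = x \<longleftrightarrow> ?X f = x"
      if "f \<in> set_pmf (Pi_pmf A1 0 q)" "g \<in> set_pmf (Pi_pmf A2 0 q)" for f g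
    proof -
      \<comment> \<open>The condition also admits sets that are no edges at all, such as infinite
        ones, where \<open>card\<close> is 0. They lie in neither family, and there both
        multiplicities are the default 0.\<close>
      have "?m f g A = f A" if "card (A - S) \<le> 1" for A
      proof (cases "A \<in> A1")
        case False
        with that have "A \<notin> A2" by (auto simp: A2_def)
        then show ?thesis using False supp[OF \<open>f \<in> _\<close>, of A] supp2[OF \<open>g \<in> _\<close>, of A] by simp
      qed simp
      then show ?thesis using cong[of "?m f g" f] cong[of f "?m f g"] by auto
    qed
    have Cm: "?c (?m f g) = card (bfs_new g N i os')" if "?X (?m f g) = x" for f g
    proof -
      have "bfs_started (?m f g) N i = os'"
        using that by (simp add: bfs_started_def os'_def x_def)
      moreover have "bfs_new (?m f g) N i os' = bfs_new g N i os'"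
      proof -
        \<comment> \<open>Both \<open>os' ! i\<close> and \<open>w\<close> lie outside
          \<open>S\<close>, so an edge tested for a child is never in \<open>A1\<close>, and
          \<open>g\<close> alone decides.\<close>
        have "?m f g A = g A" if w: "w \<in> {1..N} - set os'" and "os' ! i \<in> A" "w \<in> A" for A w
        proof -
          have "os' ! i \<notin> S"
            using len bfs_started_valid(1)[of H0 N i] unfolding os'[symmetric] S_def
            by (auto simp: in_set_conv_nth nth_eq_iff_index_eq)
          moreover have "w \<notin> S" using w by (auto simp: S_def dest: in_set_takeD)
          moreover have "w \<noteq> os' ! i" using w len by auto
          ultimately have sub: "{w, os' ! i} \<subseteq> A - S" and c2: "card {w, os' ! i} = 2"
            using that by auto
          have "A \<notin> A1"
          proof
            assume "A \<in> A1"
            then have "finite A" "card (A - S) \<le> 1" by (auto simp: A1_def intro: finite_subset)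
            then show False using card_mono[of "A - S", OF _ sub] c2 by simp
          qed
          then show ?thesis by simp
        qed
        then have "(\<exists>A. 0 < ?m f g A \<and> os' ! i \<in> A \<and> w \<in> A \<and> A - {os' ! i, w} \<subseteq> set (take i os')) \<longleftrightarrow>
            (\<exists>A. 0 < g A \<and> os' ! i \<in> A \<and> w \<in> A \<and> A - {os' ! i, w} \<subseteq> set (take i os'))"
          if "w \<in> {1..N} - set os'" for w using that by (intro ex_cong1) metis
        then show ?thesis unfolding bfs_new_def by blast
      qed
      ultimately show ?thesis by (simp add: bfs_children_card)
    qed
    have law: "map_pmf (\<lambda>g. card (bfs_new g N i os')) (Pi_pmf A2 0 q) = ?K x"
      unfolding q_def
      by (subst bfs_new_law[OF nonneg])
         (use len bfs_started_valid[of H0 N i] in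
           \<open>auto simp: os'[symmetric] A2_def S_def x_def\<close>)
    have m1: "measure_pmf.prob ?P {H. ?X H = x \<and> ?c H = c} =
        measure_pmf.prob (pair_pmf (Pi_pmf A1 0 q) (Pi_pmf A2 0 q))
          ({f. ?X f = x} \<times> {g. card (bfs_new g N i os') = c})"
      unfolding P measure_map_pmf
      by (intro measure_prob_cong_0) (use Xm Cm in \<open>auto simp: pmf_eq_0_set_pmf\<close>)
    have m2: "measure_pmf.prob ?P {H. ?X H = x} =
        measure_pmf.prob (pair_pmf (Pi_pmf A1 0 q) (Pi_pmf A2 0 q)) ({f. ?X f = x} \<times> UNIV)"
      unfolding P measure_map_pmf
      by (intro measure_prob_cong_0) (use Xm in \<open>auto simp: pmf_eq_0_set_pmf\<close>)
    have "measure_pmf.prob (Pi_pmf A2 0 q) {g. card (bfs_new g N i os') = c} = pmf (?K x) c"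
      unfolding law[symmetric] pmf_map by (simp add: vimage_def)
    then show ?thesis
      using rhs lhs X m1 m2 unfolding x_def measure_pair_pmf_Times by simp
  qed
qed

section \<open>The child counts as a chain with memory\<close>

fun history_pmf :: "('a list \<Rightarrow> 'a pmf) \<Rightarrow> nat \<Rightarrow> 'a list pmf" where
  "history_pmf K 0 = return_pmf []"
| "history_pmf K (Suc n) = bind_pmf (history_pmf K n) (\<lambda>cs. map_pmf (\<lambda>c. cs @ [c]) (K cs))"

text \<open>The number of trials counts the vertices still without a number: all but the processed
  ones, the current one and the waiting ones.\<close>

definition bfs_kernel :: "(nat \<Rightarrow> real) \<Rightarrow> nat \<Rightarrow> nat list \<Rightarrow> nat pmf" where
  "bfs_kernel \<beta> N cs = binomial_pmf (N - Suc (length cs) - queue cs) (bfs_prob \<beta> N (length cs))"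

lemma length_history_pmf: "cs \<in> set_pmf (history_pmf K n) \<Longrightarrow> length cs = n"
  by (induction n arbitrary: cs) auto

text \<open>The transition law depends on the order only through the queue, which is a function of
  the counts, so the order can be projected away.\<close>

theorem bfs_history_law:
  fixes \<beta> :: "nat \<Rightarrow> real"
  assumes nonneg: "\<forall>j\<ge>2. 0 \<le> \<beta> j"
  shows "n \<le> N \<Longrightarrow> map_pmf (\<lambda>H. bfs_history H N n) (poisson_hypergraph \<beta> N)
           = history_pmf (bfs_kernel \<beta> N) n"
proof (induction n)
  case (Suc n)
  let ?P = "poisson_hypergraph \<beta> N"
  have "map_pmf (\<lambda>H. bfs_history H N (Suc n)) ?P =
      map_pmf (\<lambda>((os, cs), c). cs @ [c])
        (map_pmf (\<lambda>H. ((bfs_order H N n, bfs_history H N n), bfs_children H N n)) ?P)"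
    by (simp add: pmf.map_comp o_def bfs_history_Suc)
  also have "\<dots> = bind_pmf (map_pmf (\<lambda>H. bfs_history H N n) ?P)
      (\<lambda>cs. map_pmf (\<lambda>c. cs @ [c]) (binomial_pmf (N - Suc n - queue cs) (bfs_prob \<beta> N n)))"
    using Suc.prems
    by (subst bfs_step_law[OF nonneg])
       (simp_all add: map_bind_pmf bind_map_pmf pmf.map_comp o_def)
  also have "map_pmf (\<lambda>H. bfs_history H N n) ?P = history_pmf (bfs_kernel \<beta> N) n"
    using Suc by simp
  also have "bind_pmf \<dots> (\<lambda>cs. map_pmf (\<lambda>c. cs @ [c]) (binomial_pmf (N - Suc n - queue cs) (bfs_prob \<beta> N n)))
      = history_pmf (bfs_kernel \<beta> N) (Suc n)"
    unfolding history_pmf.simps bfs_kernel_def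
    by (intro bind_pmf_cong refl) (simp add: length_history_pmf)
  finally show ?case .
qed simp

lemma bfs_walk_history:
  assumes "j \<le> n" "n \<le> N"
  shows "bfs_walk H N j = (\<Sum>m<j. int (bfs_history H N n ! m) - 1)"
  using assms unfolding bfs_walk_def
  by (intro sum.cong) (auto simp: bfs_history_def)

section \<open>Connection probabilities\<close>

text \<open>This identity makes the rate equal to \<open>1 / (N - 1 - i)\<close> when all \<open>\<beta>\<close>'s are critical, so that
  only the terms from \<open>k\<close> on need to be estimated.\<close>

lemma sum_binomial_ratio:
  "i \<le> n \<Longrightarrow> (\<Sum>l\<le>i. real (i choose l) / real (n choose l)) = (real n + 1) / (real n + 1 - real i)"
proof (induction i arbitrary: n)
  case (Suc i)
  then obtain m where n: "n = Suc m" and im: "i \<le> m" by (cases n) auto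
  \<comment> \<open>Absorption, \<open>(l+1) * C(i+1,l+1) = (i+1) * C(i,l)\<close>, in numerator and
    denominator reduces the terms of positive index to the sum for \<open>i\<close> and
    \<open>m\<close>.\<close>
  have ratio: "real (Suc i choose Suc l) / real (Suc m choose Suc l)
      = (real (Suc i) / real (Suc m)) * (real (i choose l) / real (m choose l))" for l
  proof -
    have "real (Suc l) * real (Suc i choose Suc l) = real (Suc i) * real (i choose l)"
      "real (Suc l) * real (Suc m choose Suc l) = real (Suc m) * real (m choose l)"
      unfolding of_nat_mult[symmetric] by (simp_all only: Suc_times_binomial)
    then have "real (Suc i choose Suc l) = real (Suc i) * real (i choose l) / real (Suc l)"
      "real (Suc m choose Suc l) = real (Suc m) * real (m choose l) / real (Suc l)"
      by (simp_all add: field_simps del: of_nat_Suc binomial_Suc_Suc)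
    moreover have "(A * a / s) / (B * b / s) = (A / B) * (a / b)" if "s \<noteq> 0" for A B a b s :: real
      using that by simp
    ultimately show ?thesis by (simp only:)
  qed
  have "(\<Sum>l\<le>Suc i. real (Suc i choose l) / real (n choose l))
      = 1 + (\<Sum>l\<le>i. real (Suc i choose Suc l) / real (Suc m choose Suc l))"
    unfolding n by (subst sum.atMost_Suc_shift) simp
  also have "\<dots> = 1 + (real (Suc i) / real (Suc m)) * ((real m + 1) / (real m + 1 - real i))"
    unfolding ratio by (simp only: sum_distrib_left[symmetric] Suc.IH[OF im])
  also have "\<dots> = (real n + 1) / (real n + 1 - real (Suc i))"
  proof -
    have "(real (Suc i) / real (Suc m)) * ((real m + 1) / (real m + 1 - real i)) = (real i + 1) / (real m + 1 - real i)"
      by (simp add: add.commute)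
    moreover have "0 < real m + 1 - real i" using im by simp
    ultimately show ?thesis unfolding n by (simp add: divide_simps) (simp add: algebra_simps)
  qed
  finally show ?case .
qed simp

text \<open>The ratio is a product of \<open>l\<close> factors \<open>(i-t)/(n-t)\<close>, none of
  which exceeds \<open>i/n\<close>.\<close>

lemma binomial_ratio_le_power:
  assumes "i \<le> n" "0 < n"
  shows "real (i choose l) / real (n choose l) \<le> (real i / real n) ^ l"
proof (cases "l \<le> i")
  case True
  have eq: "real (i choose l) / real (n choose l) = (\<Prod>t<l. (real i - real t) / (real n - real t))"
    by (simp add: binomial_gbinomial gbinomial_prod_rev prod_dividef lessThan_atLeast0)
  have "\<dots> \<le> (\<Prod>t<l. real i / real n)"
  proof (intro prod_mono conjI)
    fix t assume "t \<in> {..<l}"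
    with True assms have t: "t < i" "t < n" by auto
    then show "0 \<le> (real i - real t) / (real n - real t)" by simp
    have "real t * real i \<le> real t * real n" using assms by (intro mult_left_mono) auto
    then show "(real i - real t) / (real n - real t) \<le> real i / real n"
      using t by (simp add: divide_simps algebra_simps)
  qed
  with eq show ?thesis by simp
qed (simp add: binomial_eq_0)

text \<open>The same product is compared factor by factor with the power, all factors having modulus
  at most 1. The condition \<open>2 * l \<le> n\<close> keeps the denominators above
  \<open>n/2\<close>; the base is \<open>i/(n+2)\<close> because \<open>n\<close> stands for
  \<open>N - 2\<close>.\<close>

lemma binomial_ratio_approx:
  assumes "i \<le> n" "2 * l \<le> n"
  shows "\<bar>real (i choose l) / real (n choose l) - (real i / real (n + 2)) ^ l\<bar>
    \<le> 2 * (real l + 2) ^ 2 / real n"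
proof (cases "n = 0")
  case False
  have eq: "real (i choose l) / real (n choose l) = (\<Prod>t<l. (real i - real t) / (real n - real t))"
    by (simp add: binomial_gbinomial gbinomial_prod_rev prod_dividef lessThan_atLeast0)
  have "norm ((\<Prod>t<l. (real i - real t) / (real n - real t)) - (\<Prod>t<l. real i / real (n + 2)))
      \<le> (\<Sum>t<l. norm ((real i - real t) / (real n - real t) - real i / real (n + 2)))"
  proof (rule norm_prod_diff)
    fix t assume "t \<in> {..<l}"
    then show "norm ((real i - real t) / (real n - real t)) \<le> 1"
      using assms by (simp add: abs_le_iff divide_simps)
    show "norm (real i / real (n + 2)) \<le> 1" using assms by (simp add: divide_simps)
  qed
  also have "\<dots> \<le> (\<Sum>t<l. 2 * (real l + 2) / real n)"
  proof (rule sum_mono)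
    fix t assume "t \<in> {..<l}"
    then have t: "t < l" by simp
    then have nt: "real n / 2 \<le> real n - real t" "0 < real n" using assms False by auto
    have "(real i - real t) / (real n - real t) - real i / real (n + 2)
        = (2 * real i - real t * (real n + 2 - real i)) / ((real n - real t) * (real n + 2))"
      using nt by (simp add: divide_simps) (simp add: algebra_simps)
    moreover have "\<bar>2 * real i - real t * (real n + 2 - real i)\<bar> \<le> (real l + 2) * (real n + 2)"
    proof -
      have "real t * (real n + 2 - real i) \<le> real l * (real n + 2)"
        using t assms by (intro mult_mono) auto
      moreover have "0 \<le> real t * (real n + 2 - real i)" using assms by simp
      moreover have "0 \<le> real l * (real n + 2)" by simp
      ultimately show ?thesis using assms by (simp add: abs_le_iff algebra_simps)
    qed
    ultimately have "norm ((real i - real t) / (real n - real t) - real i / real (n + 2))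
        \<le> (real l + 2) * (real n + 2) / \<bar>(real n - real t) * (real n + 2)\<bar>"
      unfolding real_norm_def of_nat_add of_nat_numeral
      by (simp only: abs_divide) (rule divide_right_mono, simp_all)
    also have "\<dots> = (real l + 2) * (real n + 2) / ((real n - real t) * (real n + 2))"
      using nt by (simp add: abs_mult)
    also have "\<dots> = (real l + 2) / (real n - real t)" by simp
    also have "\<dots> \<le> (real l + 2) / (real n / 2)"
      using nt by (intro divide_left_mono mult_pos_pos) auto
    finally show "norm ((real i - real t) / (real n - real t) - real i / real (n + 2)) \<le> 2 * (real l + 2) / real n"
      by (simp add: mult.commute)
  qed
  also have "\<dots> = (real l * (2 * (real l + 2))) / real n" by simp
  also have "\<dots> \<le> 2 * (real l + 2) ^ 2 / real n"
    by (intro divide_right_mono) (simp_all add: power2_eq_square algebra_simps)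
  finally show ?thesis by (simp add: eq)
qed (use assms in simp)

section \<open>Expansion of the connection probability\<close>

text \<open>Absorption applied twice turns \<open>C(n+2,l+2)\<close> into \<open>C(n,l)\<close> and
  brings out the factor \<open>(l+2)(l+1)\<close>, whose product with \<open>\<beta> (l+2)\<close>
  is 1 at criticality; what remains are the ratios summed in
  \<open>sum_binomial_ratio\<close>.\<close>

lemma bfs_rate_eq:
  assumes "i \<le> n"
  shows "(real n + 1) * bfs_rate \<beta> (n + 2) i =
    (\<Sum>l\<le>i. (real l + 2) * (real l + 1) * \<beta> (l + 2) * (real (i choose l) / real (n choose l)))"
  unfolding bfs_rate_def sum_distrib_left
proof (rule sum.cong[OF refl])
  fix l assume "l \<in> {..i}"
  then have l: "l \<le> n" using assms by simp
  have e: "real (Suc (Suc l)) * real (Suc (Suc n) choose Suc (Suc l)) = real (Suc (Suc n)) * real (Suc n choose Suc l)"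
    "real (Suc l) * real (Suc n choose Suc l) = real (Suc n) * real (n choose l)"
    unfolding of_nat_mult[symmetric] by (simp_all only: Suc_times_binomial)
  then have eq: "(real l + 2) * (real l + 1) * real (n + 2 choose (l + 2)) = (real n + 2) * (real n + 1) * real (n choose l)"
  proof -
    have gen: "(L + 2) * (L + 1) * a = (m + 2) * (m + 1) * c"
      if "(L + 2) * a = (m + 2) * b" "(L + 1) * b = (m + 1) * c" for L m a b c :: real
      using that by algebra
    have "(real l + 2) * real (Suc (Suc n) choose Suc (Suc l)) = (real n + 2) * real (Suc n choose Suc l)"
      "(real l + 1) * real (Suc n choose Suc l) = (real n + 1) * real (n choose l)"
      using e by (simp_all add: add.commute del: binomial_Suc_Suc)
    from gen[OF this] show ?thesis by (simp del: binomial_Suc_Suc)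
  qed
  have pos: "0 < real (n + 2 choose (l + 2))" "0 < real (n choose l)"
    using l by (simp_all del: binomial_Suc_Suc add: zero_less_binomial)
  define X where "X = real (n + 2 choose (l + 2))"
  define Y where "Y = real (n choose l)"
  define P where "P = (real l + 2) * (real l + 1)"
  have "P * X = (real n + 2) * (real n + 1) * Y" using eq by (simp add: P_def X_def Y_def)
  then have XY: "(real n + 1) * (real n + 2) / X = P / Y"
    using pos unfolding X_def[symmetric] Y_def[symmetric] by (simp add: field_simps)
  have gen: "a * (c * (a' * b / X')) = P' * b * (c / Y')"
    if "a * a' / X' = P' / Y'" for a a' b c X' P' Y' :: real
  proof -
    have "a * (c * (a' * b / X')) = (a * a' / X') * (b * c)" by simp
    then show ?thesis unfolding that by simp
  qed
  show "(real n + 1) * (real (i choose l) * (real (n + 2) * \<beta> (l + 2) / real (n + 2 choose (l + 2)))) =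
    (real l + 2) * (real l + 1) * \<beta> (l + 2) * (real (i choose l) / real (n choose l))"
    unfolding X_def[symmetric] Y_def[symmetric] P_def[symmetric]
    using gen[OF XY] by (simp only: of_nat_add of_nat_numeral)
qed

text \<open>Subtracting the all-critical rate leaves weights \<open>g l - 1\<close>, which vanish
  for \<open>l < k - 2\<close> and equal \<open>mu \<beta> k\<close> at \<open>l = k - 2\<close>;
  the later terms are of order \<open>x^(k-1)\<close> with \<open>x = i/n\<close>. Their weights
  grow like \<open>l^2 * \<beta> (l+2)\<close>, but \<open>x \<le> 1/2\<close> supplies a geometric
  factor that absorbs one power of \<open>l\<close>, so a finite first derivative at 1
  suffices.\<close>

lemma bfs_rate_expansion:
  fixes \<beta> :: "nat \<Rightarrow> real"
  assumes nonneg: "\<forall>j\<ge>2. 0 \<le> \<beta> j"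
    and deriv_finite: "summable (\<lambda>j. real j * \<beta> j)"
    and k3: "3 \<le> k"
    and crit: "\<forall>j. 2 \<le> j \<and> j \<le> k - 1 \<longrightarrow> \<beta> j = 1 / (real j * (real j - 1))"
  obtains C where "0 < C"
    "\<And>n i. 2 * k \<le> n \<Longrightarrow> 2 * i \<le> n \<Longrightarrow>
      \<bar>(real n + 1 - real i) * bfs_rate \<beta> (n + 2) i - 1 - mu \<beta> k * (real i / real (n + 2)) ^ (k - 2)\<bar>
        \<le> C * (1 / real n + (real i / real n) ^ (k - 1))"
proof -
  define D where "D = (\<Sum>j. real (j + 2) * \<beta> (j + 2))"
  \<comment> \<open>\<open>D\<close> bounds the contribution of \<open>g l\<close>, the 2 is the
    geometric series for the subtracted 1, and \<open>2^(k-1)\<close> arises when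
    \<open>(1/2)^(l-(k-1))\<close> is written as a multiple of \<open>(1/2)^l\<close>.\<close>
  define C0 where "C0 = 2 ^ (k - 1) * (D + 2)"
  define m where "m = mu \<beta> k"
  have sumD: "summable (\<lambda>j. real (j + 2) * \<beta> (j + 2))"
    using summable_ignore_initial_segment[OF deriv_finite, of 2] by simp
  have D0: "0 \<le> D" unfolding D_def using nonneg by (intro suminf_nonneg sumD) auto
  have C0: "0 < C0" using D0 by (simp add: C0_def)
  define C where "C = C0 + \<bar>m\<bar> + 2 * real k ^ 2 * \<bar>m\<bar> + 1"
  have bound: "\<bar>(real n + 1 - real i) * bfs_rate \<beta> (n + 2) i - 1 - m * (real i / real (n + 2)) ^ (k - 2)\<bar>
        \<le> C * (1 / real n + (real i / real n) ^ (k - 1))"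
    if n: "2 * k \<le> n" and i: "2 * i \<le> n" for n i
  proof -
    have npos: "0 < n" and iN: "i \<le> n" using n k3 i by auto
    define x where "x = real i / real n"
    define y where "y = real i / real (n + 2)"
    define r where "r l = real (i choose l) / real (n choose l)" for l
    define g where "g l = (real l + 2) * (real l + 1) * \<beta> (l + 2)" for l
    define h where "h l = (g l - 1) * r l" for l
    have x: "0 \<le> x" "x \<le> 1 / 2" using i npos by (simp_all add: x_def divide_simps)
    have r: "0 \<le> r l" "r l \<le> x ^ l" for l
      using binomial_ratio_le_power[OF iN npos] by (simp_all add: r_def x_def)
    have g0: "0 \<le> g l" for l using nonneg by (simp add: g_def)
    have g1: "g l = 1" if "l < k - 2" for l
    proof -
      have "\<beta> (l + 2) = 1 / (real (l + 2) * (real (l + 2) - 1))" using that by (intro crit[rule_format]) auto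
      then have e: "\<beta> (l + 2) = 1 / ((real l + 2) * (real l + 1))" by (simp add: add.commute)
      show ?thesis unfolding g_def e by simp
    qed
    have gk: "g (k - 2) - 1 = m"
    proof -
      have e: "real (k - 2) = real k - 2" "k - 2 + 2 = k" using k3 by auto
      show ?thesis unfolding g_def m_def mu_def e by simp
    qed
    have split: "h l = (if l = k - 2 then m * r (k - 2) else 0) + (if k - 1 \<le> l then h l else 0)" for l
      using k3 gk g1[of l] by (auto simp: h_def)
    have "(\<Sum>l\<le>i. h l) = m * r (k - 2) + (\<Sum>l\<le>i. if k - 1 \<le> l then h l else 0)"
    proof -
      have "(\<Sum>l\<le>i. if l = k - 2 then m * r (k - 2) else 0) = m * r (k - 2)"
        by (simp add: r_def binomial_eq_0)
      then show ?thesis by (subst split) (simp only: sum.distrib)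
    qed
    moreover have "\<bar>\<Sum>l\<le>i. if k - 1 \<le> l then h l else 0\<bar> \<le> C0 * x ^ (k - 1)"
    proof -
      have "\<bar>\<Sum>l\<le>i. if k - 1 \<le> l then h l else 0\<bar>
          \<le> (\<Sum>l\<le>i. x ^ (k - 1) * 2 ^ (k - 1) * (real (l + 2) * \<beta> (l + 2) + (1/2) ^ l))"
      proof (intro order.trans[OF sum_abs] sum_mono)
        fix l
        have b: "0 \<le> \<beta> (l + 2)" using nonneg by simp
        show "\<bar>if k - 1 \<le> l then h l else 0\<bar>
            \<le> x ^ (k - 1) * 2 ^ (k - 1) * (real (l + 2) * \<beta> (l + 2) + (1/2) ^ l)"
        proof (cases "k - 1 \<le> l")
          case True
          have "x ^ l = x ^ (k - 1) * x ^ (l - (k - 1))"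
            using True by (simp add: power_add[symmetric])
          also have "\<dots> \<le> x ^ (k - 1) * (1/2) ^ (l - (k - 1))"
            using x by (intro mult_left_mono power_mono) auto
          also have "\<dots> = x ^ (k - 1) * 2 ^ (k - 1) * (1/2) ^ l"
            using True by (simp add: power_diff power_one_over field_simps)
          finally have xl: "x ^ l \<le> x ^ (k - 1) * 2 ^ (k - 1) * (1/2) ^ l" .
          have "\<bar>h l\<bar> \<le> (g l + 1) * x ^ l"
            unfolding h_def abs_mult using r[of l] g0[of l] by (intro mult_mono) auto
          also have "\<dots> \<le> (g l + 1) * (x ^ (k - 1) * 2 ^ (k - 1) * (1/2) ^ l)"
            using g0[of l] xl by (intro mult_left_mono) auto
          also have "\<dots> = x ^ (k - 1) * 2 ^ (k - 1) * (g l * (1/2) ^ l + (1/2) ^ l)"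
            by (simp add: algebra_simps)
          also have "\<dots> \<le> x ^ (k - 1) * 2 ^ (k - 1) * (real (l + 2) * \<beta> (l + 2) + (1/2) ^ l)"
          proof (intro mult_left_mono add_right_mono)
            have "real l + 1 \<le> 2 ^ l"
              using less_exp[of l] by (metis Suc_leI of_nat_Suc of_nat_le_iff of_nat_numeral of_nat_power add.commute)
            then have "(real l + 1) * (1/2) ^ l \<le> 1" by (simp add: power_one_over field_simps)
            then have "((real l + 2) * \<beta> (l + 2)) * ((real l + 1) * (1/2) ^ l) \<le> ((real l + 2) * \<beta> (l + 2)) * 1"
              using b by (intro mult_left_mono) auto
            then show "g l * (1/2) ^ l \<le> real (l + 2) * \<beta> (l + 2)"
              by (simp add: g_def algebra_simps)
          qed (use x in auto)
          finally show ?thesis using True by simp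
        qed (use x b in auto)
      qed
      also have "\<dots> = x ^ (k - 1) * 2 ^ (k - 1) * ((\<Sum>l\<le>i. real (l + 2) * \<beta> (l + 2)) + (\<Sum>l\<le>i. (1/2) ^ l))"
        by (simp only: sum_distrib_left[symmetric] sum.distrib)
      also have "\<dots> \<le> x ^ (k - 1) * 2 ^ (k - 1) * (D + 2)"
      proof (intro mult_left_mono add_mono)
        show "(\<Sum>l\<le>i. real (l + 2) * \<beta> (l + 2)) \<le> D"
          unfolding D_def using nonneg by (intro sum_le_suminf sumD) auto
        have "(\<Sum>l\<le>i. (1/2::real) ^ l) \<le> (\<Sum>l. (1/2) ^ l)"
          by (intro sum_le_suminf summable_geometric) auto
        then show "(\<Sum>l\<le>i. (1/2::real) ^ l) \<le> 2" by (simp add: suminf_geometric)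
      qed (use x in auto)
      finally show ?thesis by (simp add: C0_def algebra_simps)
    qed
    ultimately have H: "\<bar>(\<Sum>l\<le>i. h l) - m * r (k - 2)\<bar> \<le> C0 * x ^ (k - 1)" by simp
    \<comment> \<open>Passing from the factor \<open>n+1\<close> in \<open>bfs_rate_eq\<close> to
      \<open>n+1-i\<close> multiplies the correction by \<open>w\<close>. Since
      \<open>1 - w \<le> x\<close>, the effect on the main term is again of order
      \<open>x^(k-1)\<close>.\<close>
    define w where "w = (real n + 1 - real i) / (real n + 1)"
    have w: "0 \<le> w" "w \<le> 1" "1 - w \<le> x"
    proof -
      have "1 - w = real i / (real n + 1)" by (simp add: w_def field_simps)
      also have "\<dots> \<le> x" unfolding x_def using npos by (intro divide_left_mono) auto
      finally show "1 - w \<le> x" .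
    qed (use iN in \<open>simp_all add: w_def\<close>)
    have "(real n + 1) * bfs_rate \<beta> (n + 2) i = (\<Sum>l\<le>i. r l) + (\<Sum>l\<le>i. h l)"
      unfolding bfs_rate_eq[OF iN] sum.distrib[symmetric]
      by (intro sum.cong refl) (simp add: h_def g_def r_def algebra_simps)
    also have "(\<Sum>l\<le>i. r l) = (real n + 1) / (real n + 1 - real i)"
      unfolding r_def by (rule sum_binomial_ratio[OF iN])
    finally have "(real n + 1 - real i) * bfs_rate \<beta> (n + 2) i = 1 + w * (\<Sum>l\<le>i. h l)"
      using iN by (simp add: w_def field_simps)
    then have "(real n + 1 - real i) * bfs_rate \<beta> (n + 2) i - 1 - m * y ^ (k - 2)
       = w * ((\<Sum>l\<le>i. h l) - m * r (k - 2)) - (1 - w) * (m * r (k - 2)) + m * (r (k - 2) - y ^ (k - 2))"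
      by (simp add: algebra_simps)
    moreover have "\<bar>w * ((\<Sum>l\<le>i. h l) - m * r (k - 2))\<bar> \<le> 1 * (C0 * x ^ (k - 1))"
      unfolding abs_mult using H w by (intro mult_mono) auto
    moreover have "\<bar>(1 - w) * (m * r (k - 2))\<bar> \<le> x * (\<bar>m\<bar> * x ^ (k - 2))"
      unfolding abs_mult using r[of "k - 2"] w x by (intro mult_mono) auto
    moreover have "x * (\<bar>m\<bar> * x ^ (k - 2)) = \<bar>m\<bar> * x ^ (k - 1)"
    proof -
      have "k - 1 = Suc (k - 2)" using k3 by simp
      then show ?thesis by (simp only: power_Suc) simp
    qed
    moreover have "\<bar>m * (r (k - 2) - y ^ (k - 2))\<bar> \<le> \<bar>m\<bar> * (2 * real k ^ 2 / real n)"
    proof -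
      have "real (k - 2) + 2 = real k" using k3 by simp
      then show ?thesis
        unfolding abs_mult using binomial_ratio_approx[OF iN, of "k - 2"] n
        by (intro mult_left_mono) (simp_all add: r_def y_def)
    qed
    ultimately have "\<bar>(real n + 1 - real i) * bfs_rate \<beta> (n + 2) i - 1 - m * y ^ (k - 2)\<bar>
        \<le> (C0 + \<bar>m\<bar>) * x ^ (k - 1) + 2 * real k ^ 2 * \<bar>m\<bar> * (1 / real n)"
      by (simp add: algebra_simps abs_le_iff)
    also have "\<dots> \<le> C * x ^ (k - 1) + C * (1 / real n)"
    proof -
      have "0 \<le> real k ^ 2 * \<bar>m\<bar>" by simp
      then have "C0 + \<bar>m\<bar> \<le> C" "2 * real k ^ 2 * \<bar>m\<bar> \<le> C" using C0 unfolding C_def by linarith+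
      then show ?thesis using x by (intro add_mono mult_right_mono) auto
    qed
    finally show ?thesis by (simp add: y_def x_def algebra_simps)
  qed
  have "0 < C" using C0 unfolding C_def by (smt (verit) mult_nonneg_nonneg zero_le_power2)
  with bound show ?thesis using that by (simp add: m_def)
qed

lemma exp_minus_quadratic:
  fixes z :: real
  assumes "0 \<le> z"
  shows "1 - exp (- z) \<le> z" "z - z ^ 2 \<le> 1 - exp (- z)"
proof -
  show "1 - exp (- z) \<le> z" using exp_ge_add_one_self[of "- z"] by simp
  have "exp (- z) \<le> 1 / (1 + z)"
    using assms exp_ge_add_one_self[of z] by (simp add: exp_minus divide_simps)
  also have "\<dots> \<le> 1 - z + z ^ 2"
  proof -
    have "1 \<le> (1 - z + z ^ 2) * (1 + z)"
      using assms by (simp add: algebra_simps power2_eq_square)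
    then show ?thesis using assms by (simp add: divide_simps)
  qed
  finally show "z - z ^ 2 \<le> 1 - exp (- z)" by simp
qed

text \<open>\<open>N - 1 - i\<close> vertices are available when nobody is queued, so the first
  bound describes the mean for an empty queue and the second the influence of one queued vertex.
  Replacing a rate \<open>l\<close> by \<open>1 - exp (- l)\<close> costs at most
  \<open>l^2\<close>, which is of order \<open>1/N\<close> after multiplication by
  \<open>N\<close>.\<close>

lemma bfs_prob_expansion:
  fixes \<beta> :: "nat \<Rightarrow> real"
  assumes nonneg: "\<forall>j\<ge>2. 0 \<le> \<beta> j"
    and deriv_finite: "summable (\<lambda>j. real j * \<beta> j)"
    and k3: "3 \<le> k"
    and crit: "\<forall>j. 2 \<le> j \<and> j \<le> k - 1 \<longrightarrow> \<beta> j = 1 / (real j * (real j - 1))"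
  obtains C where "0 < C"
    "\<And>N i. 2 * k + 2 \<le> N \<Longrightarrow> 2 * i + 2 \<le> N \<Longrightarrow>
      \<bar>(real N - 1 - real i) * bfs_prob \<beta> N i - 1 - mu \<beta> k * (real i / real N) ^ (k - 2)\<bar>
        \<le> C * (1 / real N + (real i / real N) ^ (k - 1))"
    "\<And>N i. 2 * k + 2 \<le> N \<Longrightarrow> 2 * i + 2 \<le> N \<Longrightarrow> bfs_prob \<beta> N i \<le> C / real N"
proof -
  from bfs_rate_expansion[OF assms] obtain C where C: "0 < C" and
    bd: "\<And>n i. 2 * k \<le> n \<Longrightarrow> 2 * i \<le> n \<Longrightarrow>
      \<bar>(real n + 1 - real i) * bfs_rate \<beta> (n + 2) i - 1 - mu \<beta> k * (real i / real (n + 2)) ^ (k - 2)\<bar>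
        \<le> C * (1 / real n + (real i / real n) ^ (k - 1))" by blast
  define m where "m = mu \<beta> k"
  \<comment> \<open>\<open>C3 / 2\<close> bounds \<open>q * l\<close>, and \<open>q\<close> is at
    least \<open>N/2\<close>; together they give \<open>l \<le> C3 / N\<close>.\<close>
  define C3 where "C3 = 2 * (1 + \<bar>m\<bar> + 2 * C)"
  \<comment> \<open>The summands pay for passing from \<open>n\<close> to \<open>N\<close> in the
    error, for the quadratic term of the exponential, and for the bound on the probability
    itself.\<close>
  define C4 where "C4 = 2 ^ (k - 1) * C + C3 ^ 2 + C3"
  have C3: "0 < C3" unfolding C3_def using C by auto
  have C4: "0 < C4" "C3 \<le> C4" unfolding C4_def using C C3 by (auto intro!: add_nonneg_pos)
  have main: "\<bar>(real N - 1 - real i) * bfs_prob \<beta> N i - 1 - m * (real i / real N) ^ (k - 2)\<bar>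
        \<le> C4 * (1 / real N + (real i / real N) ^ (k - 1)) \<and> bfs_prob \<beta> N i \<le> C4 / real N"
    if N: "2 * k + 2 \<le> N" and i: "2 * i + 2 \<le> N" for N i
  proof -
    define n where "n = N - 2"
    have Nn: "N = n + 2" and n: "2 * k \<le> n" "2 * i \<le> n" using N i by (auto simp: n_def)
    have n6: "6 \<le> n" using n k3 by simp
    define l where "l = bfs_rate \<beta> N i"
    define q where "q = real N - 1 - real i"
    define y where "y = real i / real N"
    define e where "e = 1 / real N + y ^ (k - 1)"
    have l0: "0 \<le> l" using bfs_rate_nonneg[OF nonneg] by (simp add: l_def)
    have q: "real N / 2 \<le> q" "q \<le> real N" using i by (auto simp: q_def)
    have y: "0 \<le> y" "y \<le> 1" using i by (auto simp: y_def divide_simps)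
    have xy: "real i / real n \<le> 2 * y"
    proof -
      have "real i / real n = 2 * (real i / (2 * real n))" by simp
      also have "\<dots> \<le> 2 * (real i / real N)"
        using n6 unfolding Nn by (intro mult_left_mono divide_left_mono) auto
      finally show ?thesis by (simp add: y_def)
    qed
    have e: "0 < e" unfolding e_def using y n6 Nn by (intro add_pos_nonneg) auto
    have q_eq: "q = real n + 1 - real i" by (simp add: q_def Nn)
    have bd': "\<bar>q * l - 1 - m * y ^ (k - 2)\<bar> \<le> C * (1 / real n + (real i / real n) ^ (k - 1))"
      using bd[OF n] unfolding q_eq l_def y_def Nn m_def .
    have "1 / real n + (real i / real n) ^ (k - 1) \<le> 2 ^ (k - 1) * e"
    proof -
      have "1 / real n \<le> 2 * (1 / real N)" using n6 by (simp add: Nn divide_simps)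
      also have "\<dots> \<le> 2 ^ (k - 1) * (1 / real N)"
        using power_increasing[of 1 "k - 1" "2::real"] k3 by (intro mult_right_mono) auto
      finally have "1 / real n \<le> 2 ^ (k - 1) * (1 / real N)" .
      moreover have "(real i / real n) ^ (k - 1) \<le> (2 * y) ^ (k - 1)"
        using xy by (intro power_mono) auto
      ultimately show ?thesis by (simp add: e_def power_mult_distrib algebra_simps)
    qed
    then have ql: "\<bar>q * l - 1 - m * y ^ (k - 2)\<bar> \<le> C * (2 ^ (k - 1) * e)"
      using bd' C mult_left_mono[of "1 / real n + (real i / real n) ^ (k - 1)" "2 ^ (k - 1) * e" C]
      by linarith
    have "q * l \<le> C3 / 2"
    proof -
      have "1 / real n + (real i / real n) ^ (k - 1) \<le> 1 + 1"
        using n n6 by (intro add_mono power_le_one) (auto simp: divide_simps)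
      then have "C * (1 / real n + (real i / real n) ^ (k - 1)) \<le> C * 2"
        using C by (intro mult_left_mono) auto
      moreover have "\<bar>m * y ^ (k - 2)\<bar> \<le> \<bar>m\<bar>"
        unfolding abs_mult using y by (intro mult_left_le) (auto simp: power_le_one)
      ultimately have "q * l - 1 - m * y ^ (k - 2) \<le> C * 2" "m * y ^ (k - 2) \<le> \<bar>m\<bar>"
        using bd' by (simp_all add: abs_le_iff)
      then show ?thesis unfolding C3_def by simp
    qed
    moreover have "real N / 2 * l \<le> q * l" using q l0 by (intro mult_right_mono) auto
    ultimately have "real N * l \<le> C3" by simp
    then have l: "l \<le> C3 / real N" using n6 Nn by (simp add: field_simps)
    have p: "bfs_prob \<beta> N i \<le> l" "l - l ^ 2 \<le> bfs_prob \<beta> N i"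
      using exp_minus_quadratic[OF l0] by (simp_all add: bfs_prob_def l_def)
    have "\<bar>q * bfs_prob \<beta> N i - q * l\<bar> = q * (l - bfs_prob \<beta> N i)"
    proof -
      have "0 \<le> q * (l - bfs_prob \<beta> N i)" using p q by (intro mult_nonneg_nonneg) auto
      then show ?thesis by (simp add: right_diff_distrib)
    qed
    also have "\<dots> \<le> real N * (C3 / real N) ^ 2"
    proof (rule mult_mono)
      have "l - bfs_prob \<beta> N i \<le> l ^ 2" using p by simp
      also have "\<dots> \<le> (C3 / real N) ^ 2" using l l0 by (intro power_mono) auto
      finally show "l - bfs_prob \<beta> N i \<le> (C3 / real N) ^ 2" .
    qed (use p q in auto)
    also have "\<dots> = C3 ^ 2 * (1 / real N)" by (simp add: power2_eq_square)
    also have "\<dots> \<le> C3 ^ 2 * e" using y by (intro mult_left_mono) (auto simp: e_def)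
    finally have "\<bar>q * bfs_prob \<beta> N i - 1 - m * y ^ (k - 2)\<bar> \<le> C * (2 ^ (k - 1) * e) + C3 ^ 2 * e"
      using ql by linarith
    also have "\<dots> \<le> C4 * e" using e C3 by (simp add: C4_def algebra_simps)
    finally show ?thesis
      using p(1) l C4 divide_right_mono[OF C4(2), of "real N"] by (simp add: q_def y_def e_def)
  qed
  show ?thesis using that[OF C4(1)] main unfolding m_def by blast
qed

section \<open>Near-critical chains\<close>

text \<open>The field is general because \<open>z\<close> is taken both as \<open>exp x\<close> and
  as \<open>iexp x\<close>.\<close>

lemma binomial_expectation_power:
  fixes z :: "'a :: {real_normed_field, banach, second_countable_topology}"
  assumes "p \<in> {0..1}"
  shows "measure_pmf.expectation (binomial_pmf n p) (\<lambda>c. z ^ c) = (1 + of_real p * (z - 1)) ^ n"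
proof -
  have "measure_pmf.expectation (binomial_pmf n p) (\<lambda>c. z ^ c)
      = (\<Sum>k\<le>n. of_nat (n choose k) * (of_real p * z) ^ k * (of_real (1 - p)) ^ (n - k))"
    by (simp add: expectation_binomial_pmf'[OF assms] scaleR_conv_of_real power_mult_distrib mult_ac)
  also have "\<dots> = (of_real p * z + of_real (1 - p)) ^ n"
    by (simp add: binomial_ring)
  finally show ?thesis by (simp add: algebra_simps)
qed

lemma binomial_expectation_real:
  assumes "p \<in> {0..1}"
  shows "measure_pmf.expectation (binomial_pmf n p) real = real n * p"
proof -
  have "measure_pmf.expectation (binomial_pmf n p) real = (\<Sum>k\<le>n. real k * Bernstein n k p)"
    by (simp add: expectation_binomial_pmf'[OF assms] Bernstein_def mult_ac)
  then show ?thesis by (simp add: sum_k_Bernstein)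
qed

lemma binomial_expectation_square:
  assumes "p \<in> {0..1}"
  shows "measure_pmf.expectation (binomial_pmf n p) (\<lambda>c. (real c) ^ 2)
    = real n * p * (1 - p) + (real n * p) ^ 2"
proof -
  have "measure_pmf.expectation (binomial_pmf n p) (\<lambda>c. (real c) ^ 2)
      = (\<Sum>k\<le>n. real k * (real k - 1) * Bernstein n k p + real k * Bernstein n k p)"
    by (simp add: expectation_binomial_pmf'[OF assms] Bernstein_def power2_eq_square algebra_simps)
  also have "\<dots> = real n * (real n - 1) * p ^ 2 + real n * p"
    by (simp add: sum.distrib sum_k_Bernstein sum_kk_Bernstein)
  finally show ?thesis by (simp add: algebra_simps power2_eq_square)
qed

text \<open>The generating function is dominated by the Poisson one through
  \<open>1 + y \<le> exp y\<close>, and \<open>exp x - 1 \<le> x + x^2\<close> on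
  \<open>[-1,1]\<close>. The exponent has the shape needed for a supermartingale: drift plus a
  quadratic compensator.\<close>

lemma binomial_exp_moment:
  fixes x p :: real
  assumes p: "p \<in> {0..1}" and x: "\<bar>x\<bar> \<le> 1"
  shows "measure_pmf.expectation (binomial_pmf n p) (\<lambda>c. exp (x * (real c - 1)))
    \<le> exp ((real n * p - 1) * x + real n * p * x ^ 2)"
proof -
  have "measure_pmf.expectation (binomial_pmf n p) (\<lambda>c. exp (x * (real c - 1)))
      = exp (- x) * measure_pmf.expectation (binomial_pmf n p) (\<lambda>c. (exp x) ^ c)"
    by (simp add: exp_of_nat_mult[symmetric] algebra_simps exp_diff exp_minus divide_inverse)
  also have "\<dots> = exp (- x) * (1 + p * (exp x - 1)) ^ n"
    by (simp add: binomial_expectation_power[OF p])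
  also have "\<dots> \<le> exp (- x) * (exp (p * (exp x - 1))) ^ n"
  proof (intro mult_left_mono power_mono)
    have "p * (exp x - 1) \<ge> - 1"
    proof -
      have "p * (1 - exp x) \<le> 1 * 1"
      proof (cases "exp x \<le> 1")
        case False
        then have "p * (1 - exp x) \<le> 0" using p by (simp add: mult_nonneg_nonpos)
        then show ?thesis by simp
      next
        case True
        then show ?thesis using p mult_mono[of p 1 "1 - exp x" 1] by simp
      qed
      then show ?thesis by (simp add: algebra_simps)
    qed
    then show "0 \<le> 1 + p * (exp x - 1)" by simp
  qed (simp_all add: exp_ge_add_one_self)
  also have "\<dots> = exp (- x + real n * p * (exp x - 1))"
    by (simp add: exp_of_nat_mult[symmetric] exp_add[symmetric] mult.assoc)
  also have "\<dots> \<le> exp (- x + real n * p * (x + x ^ 2))"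
  proof -
    have "exp x - 1 \<le> x + x ^ 2"
    proof (cases "0 \<le> x")
      case True
      then show ?thesis using exp_bound[of x] x by auto
    next
      case False
      then show ?thesis using exp_minus_quadratic(2)[of "- x"] by simp
    qed
    then show ?thesis using p by (auto intro!: mult_left_mono)
  qed
  finally show ?thesis by (simp add: algebra_simps)
qed

text \<open>On the left half-plane, which is convex, the derivative of \<open>exp\<close> has
  modulus at most 1.\<close>

lemma norm_exp_diff_le:
  fixes a b :: complex
  assumes "Re a \<le> 0" "Re b \<le> 0"
  shows "norm (exp a - exp b) \<le> norm (a - b)"
proof -
  have "norm (exp a - exp b) \<le> 1 * norm (a - b)"
  proof (rule field_differentiable_bound[where S = "{z. Re z \<le> 0}" and f' = exp])
    show "convex {z. Re z \<le> 0}" by (simp add: convex_halfspace_Re_le)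
  qed (use assms in \<open>auto intro!: derivative_eq_intros\<close>)
  then show ?thesis by simp
qed

text \<open>The derivative \<open>exp w - 1\<close> has modulus at most \<open>norm w\<close>, hence
  at most \<open>norm z\<close> on the half-plane cut with the disc of radius \<open>norm z\<close>,
  a convex set containing both 0 and \<open>z\<close>.\<close>

lemma norm_exp_minus_linear_le:
  fixes z :: complex
  assumes "Re z \<le> 0"
  shows "norm (exp z - 1 - z) \<le> norm z ^ 2"
proof -
  let ?S = "{w. Re w \<le> 0} \<inter> cball 0 (norm z)"
  have "norm ((exp z - z) - (exp 0 - 0)) \<le> norm z * norm (z - 0)"
  proof (rule field_differentiable_bound[where S = ?S and f' = "\<lambda>w. exp w - 1"])
    show "convex ?S" by (intro convex_Int convex_cball convex_halfspace_Re_le)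
    show "norm (exp w - 1) \<le> norm z" if "w \<in> ?S" for w
      using norm_exp_diff_le[of w 0] that by simp
  qed (use assms in \<open>auto intro!: derivative_eq_intros\<close>)
  then show ?thesis by (simp add: power2_eq_square algebra_simps)
qed

lemma iexp_expansion:
  "cmod (iexp x - 1) \<le> \<bar>x\<bar>"
  "cmod (iexp x - 1 - \<i> * x + of_real (x ^ 2 / 2)) \<le> \<bar>x\<bar> ^ 3"
proof -
  show "cmod (iexp x - 1) \<le> \<bar>x\<bar>" using iexp_approx1[of x 0] by simp
  have "cmod (iexp x - (1 + \<i> * x + (\<i> * x) ^ 2 / 2)) \<le> \<bar>x\<bar> ^ 3 / 6"
    using iexp_approx1[of x 2] by (simp add: eval_nat_numeral)
  also have "\<dots> \<le> \<bar>x\<bar> ^ 3" by simp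
  finally show "cmod (iexp x - 1 - \<i> * x + of_real (x ^ 2 / 2)) \<le> \<bar>x\<bar> ^ 3"
    by (simp add: power_mult_distrib algebra_simps)
qed

text \<open>The binomial generating function is replaced by the Poisson one, at cost
  \<open>n p^2 x^2\<close>, and the Poisson exponent by the Gaussian one; the other three terms are
  the mismatches of order 1, 2 and 3 in \<open>x\<close>. The target variance 1 is that of a Poisson
  variable of mean 1, whence \<open>n p - 1\<close> in the quadratic term. Exponents have
  nonpositive real part, so exponentials differ by no more than their exponents.\<close>

lemma binomial_char_approx:
  fixes x p D :: real
  assumes p: "p \<in> {0..1}"
  shows "cmod (measure_pmf.expectation (binomial_pmf n p) (\<lambda>c. iexp (x * (real c - 1)))
      - exp (of_real (- (x ^ 2) / 2) + \<i> * of_real (x * D)))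
    \<le> \<bar>x\<bar> * \<bar>real n * p - 1 - D\<bar> + x ^ 2 * \<bar>real n * p - 1\<bar> + real n * p * \<bar>x\<bar> ^ 3 + real n * p ^ 2 * x ^ 2"
proof -
  define z where "z = iexp x - 1"
  define m where "m = real n * p"
  have Rez: "Re z \<le> 0" by (simp add: z_def exp_eq_polar)
  have eq: "measure_pmf.expectation (binomial_pmf n p) (\<lambda>c. iexp (x * (real c - 1)))
      = iexp (- x) * (1 + of_real p * z) ^ n"
  proof -
    have "iexp (x * (real c - 1)) = iexp (- x) * (iexp x) ^ c" for c
      by (simp add: exp_of_nat_mult[symmetric] exp_add[symmetric] algebra_simps)
    then show ?thesis by (simp add: binomial_expectation_power[OF p] z_def)
  qed
  have n1: "cmod (1 + of_real p * z) \<le> 1"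
  proof -
    have "1 + of_real p * z = of_real (1 - p) + of_real p * iexp x" by (simp add: z_def algebra_simps)
    also have "cmod \<dots> \<le> \<bar>1 - p\<bar> + \<bar>p\<bar> * 1"
      by (rule order.trans[OF norm_triangle_ineq]) (simp add: norm_mult del: of_real_diff)
    finally show ?thesis using p by simp
  qed
  have n2: "cmod (exp (of_real p * z)) \<le> 1"
    using Rez p by (simp add: mult_nonneg_nonpos)
  have "cmod ((1 + of_real p * z) ^ n - (exp (of_real p * z)) ^ n)
      \<le> real n * cmod ((1 + of_real p * z) - exp (of_real p * z))"
    using norm_power_diff[OF n1 n2, of n] by simp
  also have "\<dots> \<le> real n * (p ^ 2 * x ^ 2)"
  proof (rule mult_left_mono)
    have "cmod (exp (of_real p * z) - 1 - of_real p * z) \<le> (cmod (of_real p * z)) ^ 2"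
      using Rez p by (intro norm_exp_minus_linear_le) (simp add: mult_nonneg_nonpos)
    also have "\<dots> \<le> (p * \<bar>x\<bar>) ^ 2"
      using iexp_expansion(1)[of x] p by (intro power_mono) (auto simp: norm_mult z_def intro!: mult_left_mono)
    finally show "cmod ((1 + of_real p * z) - exp (of_real p * z)) \<le> p ^ 2 * x ^ 2"
      by (simp add: norm_minus_commute power_mult_distrib algebra_simps)
  qed simp
  finally have s1: "cmod ((1 + of_real p * z) ^ n - exp (of_real m * z)) \<le> real n * p ^ 2 * x ^ 2"
    by (simp add: m_def exp_of_nat_mult[symmetric] mult_ac)
  have s2: "cmod (exp (- \<i> * x + of_real m * z) - exp (of_real (- (x ^ 2) / 2) + \<i> * of_real (x * D)))
     \<le> cmod ((- \<i> * x + of_real m * z) - (of_real (- (x ^ 2) / 2) + \<i> * of_real (x * D)))"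
    using Rez p by (intro norm_exp_diff_le) (auto simp: m_def mult_nonneg_nonpos)
  have "(- \<i> * x + of_real m * z) - (of_real (- (x ^ 2) / 2) + \<i> * of_real (x * D))
      = \<i> * of_real (x * (m - 1 - D)) - of_real (x ^ 2 / 2 * (m - 1))
        + of_real m * (iexp x - 1 - \<i> * x + of_real (x ^ 2 / 2))"
    by (simp add: z_def algebra_simps add_divide_distrib diff_divide_distrib)
  also have "cmod \<dots> \<le> \<bar>x * (m - 1 - D)\<bar> + \<bar>x ^ 2 / 2 * (m - 1)\<bar> + m * \<bar>x\<bar> ^ 3"
  proof (intro order.trans[OF norm_triangle_ineq] add_mono order.trans[OF norm_triangle_ineq4])
    show "cmod (of_real m * (iexp x - 1 - \<i> * x + of_real (x ^ 2 / 2))) \<le> m * \<bar>x\<bar> ^ 3"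
      using iexp_expansion(2)[of x] p unfolding norm_mult by (intro mult_mono) (auto simp: m_def norm_mult)
  qed (simp_all add: norm_mult del: of_real_mult of_real_diff of_real_divide)
  also have "\<dots> \<le> \<bar>x\<bar> * \<bar>m - 1 - D\<bar> + x ^ 2 * \<bar>m - 1\<bar> + m * \<bar>x\<bar> ^ 3"
    by (simp add: abs_mult)
  finally have s3: "cmod ((- \<i> * x + of_real m * z) - (of_real (- (x ^ 2) / 2) + \<i> * of_real (x * D)))
      \<le> \<bar>x\<bar> * \<bar>m - 1 - D\<bar> + x ^ 2 * \<bar>m - 1\<bar> + m * \<bar>x\<bar> ^ 3" .
  have e: "iexp (- x) * exp (of_real m * z) = exp (- \<i> * x + of_real m * z)"
    by (simp add: exp_add[symmetric])
  have s4: "cmod (iexp (- x) * (1 + of_real p * z) ^ n - exp (- \<i> * x + of_real m * z)) \<le> real n * p ^ 2 * x ^ 2"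
    using s1 unfolding e[symmetric] right_diff_distrib[symmetric] norm_mult by simp
  note norm_diff_triangle_le[OF s4 order.trans[OF s2 s3]]
  then show ?thesis unfolding eq by (simp add: m_def algebra_simps)
qed

section \<open>Expectations along a chain with memory\<close>

lemma finite_set_history_pmf:
  assumes "\<And>cs. finite (set_pmf (K cs))"
  shows "finite (set_pmf (history_pmf K n))"
  using assms by (induction n) auto

lemma history_expectation_Suc:
  fixes f :: "'a list \<Rightarrow> 'b :: {banach, second_countable_topology}"
  assumes "\<And>cs. finite (set_pmf (K cs))"
  shows "measure_pmf.expectation (history_pmf K (Suc n)) f =
    measure_pmf.expectation (history_pmf K n) (\<lambda>cs. measure_pmf.expectation (K cs) (\<lambda>c. f (cs @ [c])))"
proof -
  have fin: "finite (set_pmf (history_pmf K n))" by (rule finite_set_history_pmf[OF assms])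
  have "measure_pmf.expectation (history_pmf K (Suc n)) f =
      (\<Sum>cs\<in>set_pmf (history_pmf K n). pmf (history_pmf K n) cs *\<^sub>R
         measure_pmf.expectation (map_pmf (\<lambda>c. cs @ [c]) (K cs)) f)"
    unfolding history_pmf.simps by (rule pmf_expectation_bind) (use fin assms in auto)
  also have "\<dots> = measure_pmf.expectation (history_pmf K n) (\<lambda>cs. measure_pmf.expectation (K cs) (\<lambda>c. f (cs @ [c])))"
    by (subst integral_measure_pmf[OF fin]) (auto simp: set_pmf_eq)
  finally show ?thesis .
qed

lemma history_integrable:
  fixes f :: "'a list \<Rightarrow> 'b :: {banach, second_countable_topology}"
  assumes "\<And>cs. finite (set_pmf (K cs))"
  shows "integrable (measure_pmf (history_pmf K n)) f"
  by (rule integrable_measure_pmf_finite[OF finite_set_history_pmf[OF assms]])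

lemma take_history_pmf:
  assumes "m \<le> n"
  shows "map_pmf (take m) (history_pmf K n) = history_pmf K m"
  using assms
proof (induction n)
  case (Suc n)
  show ?case
  proof (cases "m = Suc n")
    case True
    have "map_pmf (take m) (history_pmf K (Suc n)) = map_pmf id (history_pmf K (Suc n))"
      by (intro map_pmf_cong refl) (use True length_history_pmf[of _ K "Suc n"] in \<open>simp del: history_pmf.simps\<close>)
    then show ?thesis using True by (simp del: history_pmf.simps)
  next
    case False
    with Suc.prems have "m \<le> n" by simp
    then have "map_pmf (take m) (history_pmf K (Suc n)) = bind_pmf (history_pmf K n) (\<lambda>cs. return_pmf (take m cs))"
      unfolding history_pmf.simps map_bind_pmf pmf.map_comp
      by (intro bind_pmf_cong refl) (use length_history_pmf in \<open>fastforce simp: o_def\<close>)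
    also have "\<dots> = map_pmf (take m) (history_pmf K n)" by (simp add: map_pmf_def)
    finally show ?thesis using Suc.IH \<open>m \<le> n\<close> by simp
  qed
qed simp

text \<open>Maximal inequality for nonnegative supermartingales. Freezing the process at
  \<open>a\<close> once \<open>V\<close> has reached \<open>a\<close> can only lower it, so its
  expectation does not increase, and at time \<open>n\<close> it dominates \<open>a\<close> times
  the indicator of the event. The starting time \<open>m\<close> is free because excursions will be
  measured from the beginning of a block.\<close>

lemma history_maximal:
  fixes V :: "'a list \<Rightarrow> real"
  assumes fin: "\<And>cs. finite (set_pmf (K cs))" and V: "\<And>cs. 0 \<le> V cs" and "m \<le> n"
    and super: "\<And>cs. m \<le> length cs \<Longrightarrow> length cs < n \<Longrightarrow>
       measure_pmf.expectation (K cs) (\<lambda>c. V (cs @ [c])) \<le> V cs"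
  shows "a * measure_pmf.prob (history_pmf K n) {cs. \<exists>i\<in>{m..n}. a \<le> V (take i cs)}
     \<le> measure_pmf.expectation (history_pmf K m) V"
proof -
  define hit where "hit l cs \<longleftrightarrow> (\<exists>i\<in>{m..l}. a \<le> V (take i cs))" for l cs
  have K: "integrable (measure_pmf (K cs)) f" for cs and f :: "'a \<Rightarrow> real"
    by (rule integrable_measure_pmf_finite[OF fin])
  have claim: "measure_pmf.expectation (history_pmf K l) (\<lambda>cs. if hit l cs then a else V cs)
     \<le> measure_pmf.expectation (history_pmf K m) V" if "m \<le> l" "l \<le> n" for l
    using that
  proof (induction l rule: dec_induct)
    case base
    have "(if hit m cs then a else V cs) \<le> V cs" if "cs \<in> set_pmf (history_pmf K m)" for cs
      using length_history_pmf[OF that] by (auto simp: hit_def)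
    then show ?case
      by (intro integral_mono_AE history_integrable fin) (auto simp: AE_measure_pmf_iff)
  next
    case (step l)
    have "measure_pmf.expectation (history_pmf K (Suc l)) (\<lambda>cs. if hit (Suc l) cs then a else V cs)
      = measure_pmf.expectation (history_pmf K l)
         (\<lambda>cs. measure_pmf.expectation (K cs) (\<lambda>c. if hit (Suc l) (cs @ [c]) then a else V (cs @ [c])))"
      by (rule history_expectation_Suc[OF fin])
    also have "\<dots> \<le> measure_pmf.expectation (history_pmf K l) (\<lambda>cs. if hit l cs then a else V cs)"
    proof (intro integral_mono_AE history_integrable fin, unfold AE_measure_pmf_iff, rule ballI)
      fix cs assume "cs \<in> set_pmf (history_pmf K l)"
      then have len: "length cs = l" by (rule length_history_pmf)
      have h: "hit (Suc l) (cs @ [c]) \<longleftrightarrow> hit l cs \<or> a \<le> V (cs @ [c])" for c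
        using len step.hyps by (auto simp: hit_def atLeastAtMostSuc_conv)
      show "measure_pmf.expectation (K cs) (\<lambda>c. if hit (Suc l) (cs @ [c]) then a else V (cs @ [c]))
          \<le> (if hit l cs then a else V cs)"
      proof (cases "hit l cs")
        case False
        have "measure_pmf.expectation (K cs) (\<lambda>c. if hit (Suc l) (cs @ [c]) then a else V (cs @ [c]))
            \<le> measure_pmf.expectation (K cs) (\<lambda>c. V (cs @ [c]))"
          using False by (intro integral_mono K) (auto simp: h)
        also have "\<dots> \<le> V cs" using super[of cs] len step by simp
        finally show ?thesis using False by simp
      qed (simp add: h)
    qed
    also have "\<dots> \<le> measure_pmf.expectation (history_pmf K m) V" using step by simp
    finally show ?case .
  qed
  have "a * measure_pmf.prob (history_pmf K n) {cs. hit n cs}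
      = measure_pmf.expectation (history_pmf K n) (\<lambda>cs. a * indicator {cs. hit n cs} cs)"
    by simp
  also have "\<dots> \<le> measure_pmf.expectation (history_pmf K n) (\<lambda>cs. if hit n cs then a else V cs)"
    by (intro integral_mono history_integrable fin) (use V in \<open>auto simp: indicator_def\<close>)
  also have "\<dots> \<le> measure_pmf.expectation (history_pmf K m) V" by (rule claim) (use assms in auto)
  finally show ?thesis by (simp add: hit_def)
qed

definition walk :: "nat list \<Rightarrow> nat \<Rightarrow> real" where
  "walk cs i = (\<Sum>m<i. real (cs ! m) - 1)"

lemma walk_append: "i \<le> length cs \<Longrightarrow> walk (cs @ ds) i = walk cs i"
  by (auto simp: walk_def nth_append intro!: sum.cong)

lemma walk_snoc: "walk (cs @ [c]) (Suc (length cs)) = walk cs (length cs) + (real c - 1)"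
  using walk_append[of "length cs" cs "[c]"] by (simp add: walk_def)

lemma walk_take: "j \<le> i \<Longrightarrow> walk (take i cs) j = walk cs j"
  by (auto simp: walk_def intro!: sum.cong)

text \<open>Here \<open>s = N powr (- alpha / 2)\<close> is the scaling factor, \<open>s * d i\<close> the intended drift of step \<open>i\<close>,
  \<open>e * s\<close> the deterministic error and \<open>r = C / N\<close> the influence of a queued vertex on the mean.\<close>

locale near_critical_chain =
  fixes K :: "nat list \<Rightarrow> nat pmf" and U :: "nat list \<Rightarrow> nat" and p d :: "nat \<Rightarrow> real"
    and n :: nat and s r e D T :: real
  assumes K: "K cs = binomial_pmf (U cs) (p (length cs))"
    and p: "0 \<le> p i" "p i \<le> 1"
    and p_le: "i < n \<Longrightarrow> p i \<le> r"
    and s: "0 < s" "s \<le> 1" and r: "0 \<le> r" and e: "0 \<le> e" "e \<le> 1"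
    and D: "0 \<le> D" "i < n \<Longrightarrow> \<bar>d i\<bar> \<le> D"
    and mean: "length cs < n \<Longrightarrow>
      \<bar>real (U cs) * p (length cs) - 1 - s * d (length cs)\<bar> \<le> e * s + r * real (queue cs)"
    and mean_le: "length cs < n \<Longrightarrow> real (U cs) * p (length cs) \<le> 1 + (D + 1) * s"
    and T: "real n * s ^ 2 \<le> T"
begin

abbreviation "expect l f \<equiv> measure_pmf.expectation (history_pmf K l) f"
abbreviation "prob l A \<equiv> measure_pmf.prob (history_pmf K l) A"

lemma p01: "p i \<in> {0..1}" using p by simp

lemma fin: "finite (set_pmf (K cs))"
  unfolding K using p01 by (rule finite_set_pmf_binomial_pmf)

lemma integrable_hist: "integrable (measure_pmf (history_pmf K l)) (f :: _ \<Rightarrow> _::{banach, second_countable_topology})"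
  by (rule history_integrable[OF fin])

lemma integrable_step: "integrable (measure_pmf (K cs)) (f :: _ \<Rightarrow> _::{banach, second_countable_topology})"
  by (rule integrable_measure_pmf_finite[OF fin])

lemma expect_mono:
  fixes f g :: "nat list \<Rightarrow> real"
  assumes "\<And>cs. length cs = l \<Longrightarrow> f cs \<le> g cs"
  shows "expect l f \<le> expect l g"
  by (intro integral_mono_AE integrable_hist) (use assms in \<open>auto simp: AE_measure_pmf_iff dest: length_history_pmf\<close>)

lemma expect_Suc:
  fixes f :: "nat list \<Rightarrow> 'b :: {banach, second_countable_topology}"
  shows "expect (Suc l) f = expect l (\<lambda>cs. measure_pmf.expectation (K cs) (\<lambda>c. f (cs @ [c])))"
  by (rule history_expectation_Suc[OF fin])

lemma expect_add:
  fixes f g :: "nat list \<Rightarrow> 'b :: {banach, second_countable_topology}"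
  shows "expect l (\<lambda>cs. f cs + g cs) = expect l f + expect l g"
  by (rule Bochner_Integration.integral_add[OF integrable_hist integrable_hist])

lemma expect_diff:
  fixes f g :: "nat list \<Rightarrow> 'b :: {banach, second_countable_topology}"
  shows "expect l (\<lambda>cs. f cs - g cs) = expect l f - expect l g"
  by (rule Bochner_Integration.integral_diff[OF integrable_hist integrable_hist])

lemma T_nonneg: "0 \<le> T" using T s by (smt (verit) mult_nonneg_nonneg of_nat_0_le_iff zero_le_power)

text \<open>One-step growth of the second moment of the queue: it dominates
  \<open>(D+1)^2 + (D+2)^2 + (D+2)\<close> in \<open>queue_step\<close>.\<close>

definition "Q = 3 * (D + 2) ^ 2"
text \<open>\<open>G / s\<close> is the bound on the mean queue in
  \<open>queue_mean\<close>.\<close>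

definition "G = (Q * T * exp T + 1) / 2"

lemma Q_pos: "0 < Q" using D by (simp add: Q_def)

lemma G_pos: "0 < G" using Q_pos T_nonneg by (simp add: G_def add_nonneg_pos)

lemma mean_bounds:
  assumes "length cs < n"
  shows "0 \<le> real (U cs) * p (length cs)" "real (U cs) * p (length cs) \<le> D + 2"
proof -
  have "(D + 1) * s \<le> (D + 1) * 1" using D s by (intro mult_left_mono) auto
  then show "real (U cs) * p (length cs) \<le> D + 2" using mean_le[OF assms] by simp
qed (use p in simp)

text \<open>The cross term \<open>2 * R * (m - 1)\<close> is controlled by \<open>mean_le\<close>,
  in which the queue does not occur, and split by the arithmetic-geometric inequality so that
  \<open>R^2\<close> returns with factor \<open>s^2\<close> only. Over \<open>T / s^2\<close> steps
  such a growth factor stays bounded.\<close>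

lemma queue_step:
  assumes "length cs < n"
  shows "measure_pmf.expectation (K cs) (\<lambda>c. (real (queue (cs @ [c]))) ^ 2)
     \<le> (1 + s ^ 2) * (real (queue cs)) ^ 2 + Q"
proof -
  define R where "R = real (queue cs)"
  define m where "m = real (U cs) * p (length cs)"
  have m: "0 \<le> m" "m \<le> D + 2" "m \<le> 1 + (D + 1) * s"
    using mean_bounds[OF assms] mean_le[OF assms] by (simp_all add: m_def)
  have R: "0 \<le> R" by (simp add: R_def)
  have I: "integrable (measure_pmf (binomial_pmf (U cs) (p (length cs)))) f" for f :: "nat \<Rightarrow> real"
    by (rule integrable_binomial_pmf[OF p01])
  have "measure_pmf.expectation (K cs) (\<lambda>c. (real (queue (cs @ [c]))) ^ 2)
      \<le> measure_pmf.expectation (K cs) (\<lambda>c. (R - 1) ^ 2 + 2 * (R - 1) * real c + real c ^ 2)"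
  proof (intro integral_mono integrable_step)
    fix c
    \<comment> \<open>The truncation matters only when queue and children are both empty; the left
      side is then 0 and the right side 1.\<close>
    have "(real (queue cs + c - 1)) ^ 2 \<le> (R + real c - 1) ^ 2"
      by (cases "queue cs + c") (auto simp: R_def simp flip: of_nat_add)
    also have "\<dots> = (R - 1) ^ 2 + 2 * (R - 1) * real c + real c ^ 2"
      by (simp add: power2_eq_square algebra_simps)
    finally show "(real (queue (cs @ [c]))) ^ 2 \<le> (R - 1) ^ 2 + 2 * (R - 1) * real c + real c ^ 2" by simp
  qed
  also have "\<dots> = (R - 1) ^ 2 + 2 * (R - 1) * m + (m * (1 - p (length cs)) + m ^ 2)"
    unfolding K using I
    by (simp add: binomial_expectation_real[OF p01] binomial_expectation_square[OF p01] m_def)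
  also have "\<dots> = R ^ 2 + 2 * R * (m - 1) + (m - 1) ^ 2 + m * (1 - p (length cs))"
    by (simp add: power2_eq_square algebra_simps)
  also have "\<dots> \<le> R ^ 2 + (s ^ 2 * R ^ 2 + (D + 1) ^ 2) + (D + 2) ^ 2 + (D + 2)"
  proof (intro add_mono order.refl)
    have "2 * R * (m - 1) \<le> 2 * R * ((D + 1) * s)" using R m by (intro mult_left_mono) auto
    also have "\<dots> \<le> s ^ 2 * R ^ 2 + (D + 1) ^ 2"
      using zero_le_power2[of "s * R - (D + 1)"] by (simp add: power2_eq_square algebra_simps)
    finally show "2 * R * (m - 1) \<le> s ^ 2 * R ^ 2 + (D + 1) ^ 2" .
    show "(m - 1) ^ 2 \<le> (D + 2) ^ 2" using m D by (intro power2_le_iff_abs_le[THEN iffD2]) auto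
    show "m * (1 - p (length cs)) \<le> D + 2"
      using m p[of "length cs"] mult_left_le[of "1 - p (length cs)" m] by simp
  qed
  also have "\<dots> \<le> (1 + s ^ 2) * R ^ 2 + Q"
    using D by (simp add: Q_def power2_eq_square algebra_simps)
  finally show ?thesis by (simp add: R_def)
qed

text \<open>Discrete Gronwall inequality, using \<open>1 + s^2 \<le> exp (s^2)\<close>.\<close>

lemma queue_square: "i \<le> n \<Longrightarrow> expect i (\<lambda>cs. (real (queue cs)) ^ 2) \<le> Q * real i * exp (s ^ 2 * real i)"
proof (induction i)
  case (Suc i)
  have "expect (Suc i) (\<lambda>cs. (real (queue cs)) ^ 2)
      \<le> expect i (\<lambda>cs. (1 + s ^ 2) * (real (queue cs)) ^ 2 + Q)"
    unfolding expect_Suc using Suc.prems by (intro expect_mono queue_step) simp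
  also have "\<dots> = (1 + s ^ 2) * expect i (\<lambda>cs. (real (queue cs)) ^ 2) + Q"
    by (simp add: expect_add)
  also have "\<dots> \<le> exp (s ^ 2) * (Q * real i * exp (s ^ 2 * real i)) + Q * exp (s ^ 2 * real (Suc i))"
  proof (intro add_mono mult_mono)
    show "Q \<le> Q * exp (s ^ 2 * real (Suc i))" using Q_pos by simp
  qed (use Suc Q_pos in \<open>auto simp: exp_ge_add_one_self\<close>)
  also have "\<dots> = Q * real (Suc i) * exp (s ^ 2 * real (Suc i))"
    by (simp add: algebra_simps exp_add)
  finally show ?case .
qed simp

text \<open>Completing the square, \<open>R \<le> s * R^2 / 2 + 1 / (2 * s)\<close>, turns a second
  moment of order \<open>1 / s^2\<close> into a mean of order \<open>1 / s\<close>.\<close>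

lemma queue_mean:
  assumes "i \<le> n"
  shows "expect i (\<lambda>cs. real (queue cs)) \<le> G / s"
proof -
  have iT: "s ^ 2 * real i \<le> T"
    using T mult_left_mono[of "real i" "real n" "s ^ 2"] assms by (simp add: mult.commute)
  have "expect i (\<lambda>cs. real (queue cs)) \<le> expect i (\<lambda>cs. s / 2 * (real (queue cs)) ^ 2 + 1 / (2 * s))"
  proof (rule expect_mono)
    fix cs
    have "s / 2 * (real (queue cs)) ^ 2 + 1 / (2 * s) - real (queue cs) = (s * real (queue cs) - 1) ^ 2 / (2 * s)"
      using s by (simp add: field_simps power2_eq_square)
    also have "\<dots> \<ge> 0" using s by simp
    finally show "real (queue cs) \<le> s / 2 * (real (queue cs)) ^ 2 + 1 / (2 * s)" by simp
  qed
  also have "\<dots> = s / 2 * expect i (\<lambda>cs. (real (queue cs)) ^ 2) + 1 / (2 * s)"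
    by (simp add: expect_add)
  also have "\<dots> \<le> s / 2 * (Q * real i * exp (s ^ 2 * real i)) + 1 / (2 * s)"
    using queue_square[OF assms] s by (intro add_right_mono mult_left_mono) auto
  also have "\<dots> = (Q * (s ^ 2 * real i) * exp (s ^ 2 * real i) + 1) / (2 * s)"
    using s by (simp add: field_simps power2_eq_square)
  also have "\<dots> \<le> (Q * T * exp T + 1) / (2 * s)"
    using iT Q_pos s T_nonneg by (intro divide_right_mono add_right_mono mult_mono) auto
  finally show ?thesis by (simp add: G_def)
qed

section \<open>Comparison with Gaussian factors\<close>

text \<open>With about \<open>T / s^2\<close> steps, an error must be \<open>s^2\<close> times
  something small. The terms in \<open>e\<close>, \<open>s\<close> and \<open>r\<close> are of this
  kind; the queue enters as \<open>s * r * queue\<close>, which becomes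
  \<open>s^2 * (r / s^2)\<close> up to a constant once the mean queue of order \<open>1 / s\<close>
  is inserted.\<close>

lemma step_char:
  assumes len: "length cs < n" and th: "\<bar>\<theta>\<bar> \<le> \<Theta>" and Th: "1 \<le> \<Theta>"
  shows "cmod (measure_pmf.expectation (K cs) (\<lambda>c. iexp (\<theta> * s * (real c - 1)))
      - exp (of_real (- ((\<theta> * s) ^ 2) / 2) + \<i> * of_real (\<theta> * s * (s * d (length cs)))))
    \<le> \<Theta> ^ 3 * s ^ 2 * (2 * D + 3) * (e + s + r) + 2 * \<Theta> ^ 2 * s * r * real (queue cs)"
proof -
  define x where "x = \<theta> * s"
  define R where "R = real (queue cs)"
  define m where "m = real (U cs) * p (length cs)"
  define M where "M = real (U cs) * p (length cs) ^ 2"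
  have m: "0 \<le> m" "m \<le> D + 2" using mean_bounds[OF len] by (simp_all add: m_def)
  have R: "0 \<le> R" "0 \<le> r * R" using r by (simp_all add: R_def)
  have x: "\<bar>x\<bar> \<le> \<Theta> * s" using th s by (simp add: x_def abs_mult mult_right_mono)
  have x2: "x ^ 2 \<le> \<Theta> ^ 2 * s ^ 2"
    using power_mono[OF x, of 2] by (simp add: power_mult_distrib)
  have x3: "\<bar>x\<bar> ^ 3 \<le> \<Theta> ^ 3 * s ^ 3"
    using power_mono[OF x, of 3] by (simp add: power_mult_distrib)
  have Ths: "0 \<le> \<Theta> * s" using Th s by simp
  have me: "\<bar>m - 1 - s * d (length cs)\<bar> \<le> e * s + r * R" using mean[OF len] by (simp add: m_def R_def)
  have "\<bar>s * d (length cs)\<bar> \<le> s * D" unfolding abs_mult using D(2)[OF len] s by (intro mult_mono) auto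
  with me have m1: "\<bar>m - 1\<bar> \<le> s * (1 + D) + r * R"
  proof -
    have "e * s \<le> s" using mult_right_mono[OF e(2), of s] s by simp
    moreover have "s * (1 + D) = s + s * D" by (simp add: algebra_simps)
    ultimately show ?thesis using me \<open>\<bar>s * d (length cs)\<bar> \<le> s * D\<close> by linarith
  qed
  have M: "0 \<le> M" "M \<le> (D + 2) * r"
  proof -
    have "M = m * p (length cs)" by (simp add: M_def m_def power2_eq_square)
    also have "\<dots> \<le> (D + 2) * r" using m p_le[OF len] p D by (intro mult_mono) auto
    finally show "M \<le> (D + 2) * r" .
  qed (simp add: M_def)
  have "cmod (measure_pmf.expectation (K cs) (\<lambda>c. iexp (x * (real c - 1)))
      - exp (of_real (- (x ^ 2) / 2) + \<i> * of_real (x * (s * d (length cs)))))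
    \<le> \<bar>x\<bar> * \<bar>m - 1 - s * d (length cs)\<bar> + x ^ 2 * \<bar>m - 1\<bar> + m * \<bar>x\<bar> ^ 3 + M * x ^ 2"
    unfolding K m_def M_def by (rule binomial_char_approx[OF p01])
  also have "\<dots> \<le> (\<Theta> * s) * (e * s + r * R) + (\<Theta> ^ 2 * s ^ 2) * (s * (1 + D) + r * R)
      + (D + 2) * (\<Theta> ^ 3 * s ^ 3) + ((D + 2) * r) * (\<Theta> ^ 2 * s ^ 2)"
    using x x2 x3 me m1 m M Ths R e s r D by (intro add_mono mult_mono) auto
  also have "\<dots> = \<Theta> * s ^ 2 * e + \<Theta> ^ 2 * s ^ 2 * (s * (1 + D)) + \<Theta> ^ 3 * s ^ 2 * (s * (D + 2))
      + \<Theta> ^ 2 * s ^ 2 * ((D + 2) * r) + (\<Theta> * s * (r * R) + \<Theta> ^ 2 * s ^ 2 * (r * R))"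
    by (simp add: algebra_simps power2_eq_square power3_eq_cube)
  \<comment> \<open>As \<open>\<Theta> \<ge> 1\<close>, its powers can be raised to common ones, and
    \<open>s^2 \<le> s\<close> merges the two queue terms.\<close>
  also have "\<dots> \<le> \<Theta> ^ 3 * s ^ 2 * e + \<Theta> ^ 3 * s ^ 2 * (s * (1 + D)) + \<Theta> ^ 3 * s ^ 2 * (s * (D + 2))
      + \<Theta> ^ 3 * s ^ 2 * ((D + 2) * r) + (\<Theta> ^ 2 * s * (r * R) + \<Theta> ^ 2 * s * (r * R))"
  proof -
    have "\<Theta> \<le> \<Theta> ^ 2" "\<Theta> \<le> \<Theta> ^ 3" "\<Theta> ^ 2 \<le> \<Theta> ^ 3"
      using power_increasing[OF _ Th, of 1 2] power_increasing[OF _ Th, of 1 3] power_increasing[OF _ Th, of 2 3]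
      by simp_all
    moreover have "s ^ 2 \<le> s" using s by (simp add: power2_eq_square mult_left_le)
    ultimately show ?thesis using s e r D R Th
      by (intro add_mono mult_right_mono mult_mono[of "\<Theta> ^ 2" "\<Theta> ^ 2"]) auto
  qed
  also have "\<dots> = \<Theta> ^ 3 * s ^ 2 * (e + (2 * D + 3) * s + (D + 2) * r) + 2 * \<Theta> ^ 2 * s * (r * R)"
    by (simp add: algebra_simps)
  also have "\<dots> \<le> \<Theta> ^ 3 * s ^ 2 * ((2 * D + 3) * (e + s + r)) + 2 * \<Theta> ^ 2 * s * (r * R)"
  proof (intro add_right_mono mult_left_mono)
    have "1 * e \<le> (2 * D + 3) * e" "(D + 2) * r \<le> (2 * D + 3) * r"
      using D e r by (intro mult_right_mono; simp)+
    then show "e + (2 * D + 3) * s + (D + 2) * r \<le> (2 * D + 3) * (e + s + r)" by (simp add: algebra_simps)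
  qed (use Th in auto)
  finally show ?thesis by (simp add: x_def R_def mult_ac)
qed

text \<open>Characteristic function at \<open>\<theta>\<close> of the normal law with mean
  \<open>s^2 * d i\<close> and variance \<open>s^2\<close>.\<close>

definition "psi \<theta> i = exp (of_real (- ((\<theta> * s) ^ 2) / 2) + \<i> * of_real (\<theta> * s * (s * d i)))"

lemma norm_psi: "cmod (psi \<theta> i) \<le> 1"
  by (simp add: psi_def)

text \<open>Each further step adds the error of one exchange: given the past, the last factor is
  replaced by \<open>psi\<close>, and since \<open>phi\<close> and \<open>psi\<close> have modulus
  at most 1, earlier errors are not amplified. The weights \<open>\<theta> i\<close> vary with the
  step so that increments over several blocks are treated jointly.\<close>

lemma chain_char:
  assumes th: "\<And>i. i < n \<Longrightarrow> \<bar>\<theta> i\<bar> \<le> \<Theta>" and Th: "1 \<le> \<Theta>"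
  shows "cmod (expect n (\<lambda>cs. iexp (\<Sum>i<n. \<theta> i * s * (real (cs ! i) - 1))) - (\<Prod>i<n. psi (\<theta> i) i))
     \<le> \<Theta> ^ 3 * T * ((2 * D + 3) * (e + s + r) + 2 * G * r / s ^ 2)"
proof -
  define err where "err = \<Theta> ^ 3 * s ^ 2 * (2 * D + 3) * (e + s + r) + 2 * \<Theta> ^ 2 * s * r * (G / s)"
  have err: "0 \<le> err" unfolding err_def using Th s r e D G_pos by (intro add_nonneg_nonneg mult_nonneg_nonneg) auto
  define phi where "phi l cs = iexp (\<Sum>i<l. \<theta> i * s * (real (cs ! i) - 1))" for l and cs :: "nat list"
  have claim: "cmod (expect l (phi l) - (\<Prod>i<l. psi (\<theta> i) i)) \<le> real l * err" if "l \<le> n" for l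
    using that
  proof (induction l)
    case 0
    then show ?case by (simp add: phi_def)
  next
    case (Suc l)
    then have l: "l < n" by simp
    let ?P = "\<Prod>i<l. psi (\<theta> i) i"
    define chi where "chi cs = measure_pmf.expectation (K cs) (\<lambda>c. iexp (\<theta> l * s * (real c - 1)))" for cs
    have "expect (Suc l) (phi (Suc l)) = expect l (\<lambda>cs. phi l cs * chi cs)"
      unfolding expect_Suc
    proof (intro integral_cong_AE, unfold AE_measure_pmf_iff, safe)
      fix cs assume "cs \<in> set_pmf (history_pmf K l)"
      then have len: "length cs = l" by (rule length_history_pmf)
      have "phi (Suc l) (cs @ [c]) = phi l cs * iexp (\<theta> l * s * (real c - 1))" for c
        using len by (simp add: phi_def nth_append exp_add[symmetric] algebra_simps)
      then show "measure_pmf.expectation (K cs) (\<lambda>c. phi (Suc l) (cs @ [c])) = phi l cs * chi cs"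
        by (simp add: chi_def)
    qed simp_all
    then have "expect (Suc l) (phi (Suc l)) - (\<Prod>i<Suc l. psi (\<theta> i) i)
       = expect l (\<lambda>cs. phi l cs * (chi cs - psi (\<theta> l) l)) + (expect l (phi l) - ?P) * psi (\<theta> l) l"
      by (simp add: right_diff_distrib left_diff_distrib expect_diff)
    also have "cmod \<dots> \<le> err + (real l * err) * 1"
    proof (intro order.trans[OF norm_triangle_ineq] add_mono)
      have "cmod (expect l (\<lambda>cs. phi l cs * (chi cs - psi (\<theta> l) l)))
          \<le> expect l (\<lambda>cs. cmod (phi l cs * (chi cs - psi (\<theta> l) l)))"
        by (rule integral_norm_bound)
      also have "\<dots> \<le> expect l (\<lambda>cs. \<Theta> ^ 3 * s ^ 2 * (2 * D + 3) * (e + s + r) + 2 * \<Theta> ^ 2 * s * r * real (queue cs))"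
      proof (rule expect_mono)
        fix cs :: "nat list" assume len: "length cs = l"
        have "cmod (phi l cs) = 1" by (simp add: phi_def)
        then show "cmod (phi l cs * (chi cs - psi (\<theta> l) l))
           \<le> \<Theta> ^ 3 * s ^ 2 * (2 * D + 3) * (e + s + r) + 2 * \<Theta> ^ 2 * s * r * real (queue cs)"
          using step_char[of cs "\<theta> l" \<Theta>] th[OF l] Th l len by (simp add: norm_mult chi_def psi_def)
      qed
      also have "\<dots> = \<Theta> ^ 3 * s ^ 2 * (2 * D + 3) * (e + s + r) + 2 * \<Theta> ^ 2 * s * r * expect l (\<lambda>cs. real (queue cs))"
        by (simp add: expect_add)
      also have "\<dots> \<le> err"
        unfolding err_def using queue_mean[of l] l s r Th by (intro add_left_mono mult_left_mono) auto
      finally show "cmod (expect l (\<lambda>cs. phi l cs * (chi cs - psi (\<theta> l) l))) \<le> err" .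
      show "cmod ((expect l (phi l) - ?P) * psi (\<theta> l) l) \<le> (real l * err) * 1"
        unfolding norm_mult using Suc.IH l norm_psi err by (intro mult_mono) auto
    qed
    finally show ?case by (simp add: algebra_simps)
  qed
  have "real n * err = \<Theta> ^ 3 * (real n * s ^ 2) * ((2 * D + 3) * (e + s + r)) + 2 * \<Theta> ^ 2 * G * (r / s ^ 2) * (real n * s ^ 2)"
    using s by (simp add: err_def field_simps power2_eq_square)
  also have "\<dots> \<le> \<Theta> ^ 3 * T * ((2 * D + 3) * (e + s + r)) + 2 * \<Theta> ^ 3 * G * (r / s ^ 2) * T"
    using T s r e D Th G_pos T_nonneg power_increasing[OF _ Th, of 2 3]
    by (intro add_mono mult_mono mult_nonneg_nonneg) auto
  also have "\<dots> = \<Theta> ^ 3 * T * ((2 * D + 3) * (e + s + r) + 2 * G * r / s ^ 2)"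
    by (simp add: algebra_simps)
  finally show ?thesis using claim[of n] unfolding phi_def by simp
qed

text \<open>Subtracting \<open>r\<close> times the accumulated queue length makes the exponentials of both \<open>walk\<close> and
  \<open>- walk\<close> supermartingales, although the mean has no lower bound uniform in the queue.\<close>

lemma excursion_signed:
  assumes ml: "m \<le> l" "l \<le> n" and u: "0 < u" "u * s \<le> 1" and \<sigma>: "\<sigma> = 1 \<or> \<sigma> = - 1"
  shows "prob l {cs. \<exists>i\<in>{m..l}. \<delta> \<le> s * (\<sigma> * (walk cs i - walk cs m) - (\<Sum>j=m..<i. r * real (queue (take j cs))))}
     \<le> exp (- u * \<delta> + real (l - m) * s ^ 2 * (u * (D + 1) + (D + 2) * u ^ 2))" (is "prob l ?A \<le> _")
proof -
  \<comment> \<open>Compensator per step in units of \<open>s^2\<close>: \<open>u * (D + 1)\<close>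
    for the drift and \<open>(D + 2) * u^2\<close> for the quadratic term of the exponential
    moment.\<close>
  define \<kappa> where "\<kappa> = u * (D + 1) + (D + 2) * u ^ 2"
  have \<kappa>: "0 \<le> \<kappa>" using D u by (simp add: \<kappa>_def)
  define ex where "ex cs i = u * (s * (\<sigma> * (walk cs i - walk cs m) - (\<Sum>j=m..<i. r * real (queue (take j cs)))))
       - real (i - m) * (s ^ 2 * \<kappa>)" for cs i
  define V where "V cs = exp (ex cs (length cs))" for cs
  define a where "a = exp (u * \<delta> - real (l - m) * (s ^ 2 * \<kappa>))"
  have ex_take: "ex (take i cs) i = ex cs i" if "m \<le> i" for cs i
    using that by (simp add: ex_def walk_take min_absorb1 cong: sum.cong_simp)
  have ex_snoc: "ex (cs @ [c]) (Suc (length cs)) = ex cs (length cs)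
      + (\<sigma> * u * s) * (real c - 1) + (- u * s * r * real (queue cs) - s ^ 2 * \<kappa>)" if "m \<le> length cs" for cs c
    using that unfolding ex_def
    by (simp add: walk_snoc walk_append Suc_diff_le sum.atLeastLessThan_Suc algebra_simps cong: sum.cong_simp)
  have "a * prob l {cs. \<exists>i\<in>{m..l}. a \<le> V (take i cs)} \<le> expect m V"
  proof (rule history_maximal[OF fin])
    fix cs :: "nat list" assume len: "m \<le> length cs" "length cs < l"
    then have ln: "length cs < n" using ml by simp
    define M where "M = real (U cs) * p (length cs)"
    define R where "R = real (queue cs)"
    define x where "x = \<sigma> * u * s"
    have ax: "\<bar>x\<bar> = u * s" using \<sigma> u s by (auto simp: x_def abs_mult)
    have x2: "x ^ 2 = u ^ 2 * s ^ 2" using \<sigma> by (auto simp: x_def power_mult_distrib)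
    have M: "0 \<le> M" "M \<le> D + 2" using mean_bounds[OF ln] by (simp_all add: M_def)
    \<comment> \<open>Upwards \<open>mean_le\<close> suffices. Downwards the mean may drop by
      \<open>r\<close> for each queued vertex, and this is the term that the accumulated queue in
      \<open>ex\<close> cancels.\<close>
    have "(M - 1) * x \<le> (u * s) * (s * (D + 1) + r * R)"
    proof (cases "\<sigma> = 1")
      case True
      have "0 \<le> r * R" using r by (simp add: R_def)
      then have "M - 1 \<le> s * (D + 1) + r * R"
        using mean_le[OF ln] by (simp add: M_def mult.commute)
      then have "(M - 1) * (u * s) \<le> (s * (D + 1) + r * R) * (u * s)"
        using u s by (intro mult_right_mono) auto
      then show ?thesis using True by (simp add: x_def mult_ac)
    next
      case False
      have "\<bar>s * d (length cs)\<bar> \<le> s * D" unfolding abs_mult using D(2)[OF ln] s by (intro mult_mono) auto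
      moreover have "e * s \<le> s" using mult_right_mono[OF e(2), of s] s by simp
      moreover have "s * (D + 1) = s + s * D" by (simp add: algebra_simps)
      moreover have "\<bar>M - 1 - s * d (length cs)\<bar> \<le> e * s + r * R" using mean[OF ln] by (simp add: M_def R_def)
      ultimately have "1 - M \<le> s * (D + 1) + r * R" by linarith
      then have "(1 - M) * (u * s) \<le> (s * (D + 1) + r * R) * (u * s)"
        using u s by (intro mult_right_mono) auto
      then show ?thesis using False \<sigma> by (simp add: x_def algebra_simps)
    qed
    moreover have "M * x ^ 2 \<le> (D + 2) * (u ^ 2 * s ^ 2)"
      unfolding x2 using M by (intro mult_right_mono) auto
    ultimately have b: "(M - 1) * x + M * x ^ 2 + (- u * s * r * R - s ^ 2 * \<kappa>) \<le> 0"
      by (simp add: \<kappa>_def algebra_simps power2_eq_square)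
    have "measure_pmf.expectation (K cs) (\<lambda>c. V (cs @ [c]))
       = V cs * exp (- u * s * r * R - s ^ 2 * \<kappa>) * measure_pmf.expectation (K cs) (\<lambda>c. exp (x * (real c - 1)))"
      by (simp add: V_def ex_snoc[OF len(1)] exp_add x_def R_def mult_ac del: mult_minus_left)
    also have "\<dots> \<le> V cs * exp (- u * s * r * R - s ^ 2 * \<kappa>) * exp ((M - 1) * x + M * x ^ 2)"
      unfolding K M_def using u ax by (intro mult_left_mono binomial_exp_moment[OF p01]) (auto simp: V_def)
    also have "\<dots> = V cs * exp ((M - 1) * x + M * x ^ 2 + (- u * s * r * R - s ^ 2 * \<kappa>))"
      by (simp add: exp_add[symmetric] mult.assoc add.commute)
    also have "\<dots> \<le> V cs * 1" using b by (intro mult_left_mono) (auto simp: V_def)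
    finally show "measure_pmf.expectation (K cs) (\<lambda>c. V (cs @ [c])) \<le> V cs" by simp
  qed (use ml in \<open>auto simp: V_def\<close>)
  also have "expect m V = expect m (\<lambda>_. 1)"
    by (intro integral_cong_AE) (auto simp: AE_measure_pmf_iff V_def ex_def dest: length_history_pmf)
  finally have main: "a * prob l {cs. \<exists>i\<in>{m..l}. a \<le> V (take i cs)} \<le> 1" by simp
  have "prob l ?A \<le> prob l {cs. \<exists>i\<in>{m..l}. a \<le> V (take i cs)}"
  proof (rule measure_pmf.finite_measure_mono_AE)
    show "AE cs in measure_pmf (history_pmf K l). cs \<in> ?A \<longrightarrow> cs \<in> {cs. \<exists>i\<in>{m..l}. a \<le> V (take i cs)}"
    proof (unfold AE_measure_pmf_iff, intro ballI impI)
      fix cs assume "cs \<in> set_pmf (history_pmf K l)" and A: "cs \<in> ?A"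
      then have len: "length cs = l" by (simp add: length_history_pmf)
      from A obtain i where i: "i \<in> {m..l}"
        and h: "\<delta> \<le> s * (\<sigma> * (walk cs i - walk cs m) - (\<Sum>j=m..<i. r * real (queue (take j cs))))" by blast
      have "real (i - m) * (s ^ 2 * \<kappa>) \<le> real (l - m) * (s ^ 2 * \<kappa>)"
        using i \<kappa> by (intro mult_right_mono) auto
      moreover have "u * \<delta> \<le> u * (s * (\<sigma> * (walk cs i - walk cs m) - (\<Sum>j=m..<i. r * real (queue (take j cs)))))"
        using h u by (intro mult_left_mono) auto
      ultimately have "u * \<delta> - real (l - m) * (s ^ 2 * \<kappa>) \<le> ex cs i"
        unfolding ex_def by linarith
      then have "a \<le> V (take i cs)"
        using i len ex_take[of i cs] by (simp add: a_def V_def)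
      then show "cs \<in> {cs. \<exists>i\<in>{m..l}. a \<le> V (take i cs)}" using i by blast
    qed
  qed simp
  also have "\<dots> \<le> 1 / a" using main by (simp add: a_def field_simps)
  also have "1 / a = exp (- u * \<delta> + real (l - m) * s ^ 2 * \<kappa>)"
    by (simp add: a_def exp_minus[symmetric] divide_inverse mult.assoc)
  finally show ?thesis by (simp add: \<kappa>_def)
qed

text \<open>Markov's inequality with \<open>queue_mean\<close>; it disposes of the compensator
  subtracted in \<open>excursion_signed\<close>.\<close>

lemma queue_total:
  assumes "l \<le> n" "0 < \<delta>"
  shows "prob l {cs. \<delta> \<le> s * (\<Sum>j<l. r * real (queue (take j cs)))} \<le> T * G * r / (\<delta> * s ^ 2)"
proof -
  have q: "expect l (\<lambda>cs. real (queue (take j cs))) \<le> G / s" if "j < l" for j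
  proof -
    have "expect l (\<lambda>cs. real (queue (take j cs)))
        = measure_pmf.expectation (map_pmf (take j) (history_pmf K l)) (\<lambda>cs. real (queue cs))" by simp
    also have "\<dots> = expect j (\<lambda>cs. real (queue cs))"
      using that by (subst take_history_pmf) auto
    also have "\<dots> \<le> G / s" using that assms by (intro queue_mean) auto
    finally show ?thesis .
  qed
  have nn: "0 \<le> s * (\<Sum>j<l. r * real (queue (take j cs)))" for cs
    using s r by (intro mult_nonneg_nonneg sum_nonneg) auto
  have "prob l {cs. \<delta> \<le> s * (\<Sum>j<l. r * real (queue (take j cs)))}
      \<le> expect l (\<lambda>cs. s * (\<Sum>j<l. r * real (queue (take j cs)))) / \<delta>"
    using integral_Markov_inequality_measure[OF integrable_hist, of "{}" l "\<lambda>cs. s * (\<Sum>j<l. r * real (queue (take j cs)))" \<delta>]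
      assms(2) nn by simp
  also have "expect l (\<lambda>cs. s * (\<Sum>j<l. r * real (queue (take j cs))))
      = s * (\<Sum>j<l. r * expect l (\<lambda>cs. real (queue (take j cs))))"
    by (simp add: Bochner_Integration.integral_sum[OF integrable_hist])
  also have "\<dots> \<le> s * (\<Sum>j<l. r * (G / s))"
    using q s r by (intro mult_left_mono sum_mono) auto
  also have "\<dots> = real l * s ^ 2 * (G * r / s ^ 2)" using s by (simp add: field_simps power2_eq_square)
  also have "\<dots> \<le> T * (G * r / s ^ 2)"
  proof (rule mult_right_mono)
    have "real l * s ^ 2 \<le> real n * s ^ 2" using assms by (intro mult_right_mono) auto
    then show "real l * s ^ 2 \<le> T" using T by simp
  qed (use G_pos r in simp)
  finally show ?thesis using assms by (simp add: field_simps divide_right_mono)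
qed

text \<open>Of the threshold \<open>2 * \<delta>\<close>, one \<open>\<delta>\<close> is left to the
  compensated walk in either direction and the other to the accumulated queue.\<close>

lemma excursion:
  assumes ml: "m \<le> l" "l \<le> n" and u: "0 < u" "u * s \<le> 1" and \<delta>: "0 < \<delta>"
  shows "prob l {cs. \<exists>i\<in>{m..l}. 2 * \<delta> \<le> s * \<bar>walk cs i - walk cs m\<bar>}
     \<le> 2 * exp (- u * \<delta> + real (l - m) * s ^ 2 * (u * (D + 1) + (D + 2) * u ^ 2)) + T * G * r / (\<delta> * s ^ 2)"
proof -
  let ?A = "\<lambda>\<sigma>::real. {cs. \<exists>i\<in>{m..l}. \<delta> \<le> s * (\<sigma> * (walk cs i - walk cs m) - (\<Sum>j=m..<i. r * real (queue (take j cs))))}"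
  let ?B = "{cs. \<delta> \<le> s * (\<Sum>j<l. r * real (queue (take j cs)))}"
  let ?X = "exp (- u * \<delta> + real (l - m) * s ^ 2 * (u * (D + 1) + (D + 2) * u ^ 2))"
  have "{cs. \<exists>i\<in>{m..l}. 2 * \<delta> \<le> s * \<bar>walk cs i - walk cs m\<bar>} \<subseteq> (?A 1 \<union> ?A (- 1)) \<union> ?B"
  proof
    fix cs assume "cs \<in> {cs. \<exists>i\<in>{m..l}. 2 * \<delta> \<le> s * \<bar>walk cs i - walk cs m\<bar>}"
    then obtain i where i: "i \<in> {m..l}" and h: "2 * \<delta> \<le> s * \<bar>walk cs i - walk cs m\<bar>" by blast
    show "cs \<in> (?A 1 \<union> ?A (- 1)) \<union> ?B"
    proof (cases "cs \<in> ?B")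
      case False
      have "(\<Sum>j=m..<i. r * real (queue (take j cs))) \<le> (\<Sum>j<l. r * real (queue (take j cs)))"
        using i r by (intro sum_mono2) auto
      then have "s * (\<Sum>j=m..<i. r * real (queue (take j cs))) \<le> s * (\<Sum>j<l. r * real (queue (take j cs)))"
        using s by (intro mult_left_mono) auto
      with False have c: "s * (\<Sum>j=m..<i. r * real (queue (take j cs))) < \<delta>" by simp
      have "\<delta> \<le> s * (1 * (walk cs i - walk cs m) - (\<Sum>j=m..<i. r * real (queue (take j cs))))
          \<or> \<delta> \<le> s * (- 1 * (walk cs i - walk cs m) - (\<Sum>j=m..<i. r * real (queue (take j cs))))"
      proof (cases "0 \<le> walk cs i - walk cs m")
        case True
        with h c show ?thesis by (simp add: right_diff_distrib)
      next
        case False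
        with h c show ?thesis by (simp add: right_diff_distrib)
      qed
      then show ?thesis using i by blast
    qed simp
  qed
  then have "prob l {cs. \<exists>i\<in>{m..l}. 2 * \<delta> \<le> s * \<bar>walk cs i - walk cs m\<bar>} \<le> prob l ((?A 1 \<union> ?A (- 1)) \<union> ?B)"
    by (intro measure_pmf.finite_measure_mono) auto
  also have "\<dots> \<le> prob l (?A 1 \<union> ?A (- 1)) + prob l ?B"
    by (rule measure_Un_le) auto
  also have "prob l (?A 1 \<union> ?A (- 1)) \<le> prob l (?A 1) + prob l (?A (- 1))"
    by (rule measure_Un_le) auto
  also have "prob l (?A 1) \<le> ?X" by (rule excursion_signed[OF ml u]) simp
  also have "prob l (?A (- 1)) \<le> ?X" by (rule excursion_signed[OF ml u]) simp
  also have "prob l ?B \<le> T * G * r / (\<delta> * s ^ 2)" by (rule queue_total[OF ml(2) \<delta>])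
  finally show ?thesis by simp
qed

end

section \<open>Convergence of Lipschitz functionals\<close>

text \<open>Complex span of the characters, the functions whose expectations are read off from
  characteristic functions. Vectors are sequences of which the first \<open>n\<close> entries
  matter, so one type with its product topology serves all grids.\<close>

inductive_set trig_poly :: "nat \<Rightarrow> ((nat \<Rightarrow> real) \<Rightarrow> complex) set" for n where
  monomial: "(\<lambda>x. c * iexp (\<Sum>j<n. \<theta> j * x j)) \<in> trig_poly n"
| add: "f \<in> trig_poly n \<Longrightarrow> g \<in> trig_poly n \<Longrightarrow> (\<lambda>x. f x + g x) \<in> trig_poly n"

lemma trig_poly_const: "(\<lambda>_. c) \<in> trig_poly n"
  using trig_poly.monomial[of c "\<lambda>_. 0" n] by simp

lemma trig_poly_mult:
  assumes "f \<in> trig_poly n" "g \<in> trig_poly n"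
  shows "(\<lambda>x. f x * g x) \<in> trig_poly n"
  using assms(1)
proof induction
  case (monomial c \<theta>)
  show ?case using assms(2)
  proof induction
    case (monomial c' \<theta>')
    have "(\<lambda>x. c * iexp (\<Sum>j<n. \<theta> j * x j) * (c' * iexp (\<Sum>j<n. \<theta>' j * x j)))
        = (\<lambda>x. (c * c') * iexp (\<Sum>j<n. (\<theta> j + \<theta>' j) * x j))"
      by (simp add: fun_eq_iff exp_add[symmetric] sum.distrib algebra_simps)
    then show ?case by (simp only: trig_poly.monomial)
  next
    case (add f g)
    show ?case unfolding distrib_left by (rule trig_poly.add[OF add.IH])
  qed
next
  case (add f h)
  show ?case unfolding distrib_right by (rule trig_poly.add[OF add.IH])
qed

lemma trig_poly_cnj: "f \<in> trig_poly n \<Longrightarrow> (\<lambda>x. cnj (f x)) \<in> trig_poly n"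
proof (induction rule: trig_poly.induct)
  case (monomial c \<theta>)
  have "(\<lambda>x. cnj (c * iexp (\<Sum>j<n. \<theta> j * x j))) = (\<lambda>x. cnj c * iexp (\<Sum>j<n. (- \<theta> j) * x j))"
    by (simp add: fun_eq_iff exp_cnj sum_negf)
  then show ?case by (simp only: trig_poly.monomial)
next
  case (add f g)
  show ?case unfolding complex_cnj_add by (rule trig_poly.add[OF add.IH])
qed

lemma trig_poly_continuous: "f \<in> trig_poly n \<Longrightarrow> continuous_on UNIV f"
  by (induction rule: trig_poly.induct) (auto intro!: continuous_intros)

lemma trig_poly_cong: "f \<in> trig_poly n \<Longrightarrow> (\<And>j. j < n \<Longrightarrow> x j = y j) \<Longrightarrow> f x = f y"
  by (induction rule: trig_poly.induct) auto

lemma trig_poly_bounded: "f \<in> trig_poly n \<Longrightarrow> \<exists>C. \<forall>x. cmod (f x) \<le> C"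
proof (induction rule: trig_poly.induct)
  case (monomial c \<theta>)
  show ?case by (intro exI[of _ "cmod c"]) (simp add: norm_mult)
next
  case (add f g)
  then show ?case by (meson add_mono norm_triangle_ineq order.trans)
qed

definition real_trig_poly :: "nat \<Rightarrow> ((nat \<Rightarrow> real) \<Rightarrow> real) set" where
  "real_trig_poly n = (\<lambda>f x. Re (f x)) ` trig_poly n"

lemma real_trig_poly_add:
  assumes "f \<in> real_trig_poly n" "g \<in> real_trig_poly n"
  shows "(\<lambda>x. f x + g x) \<in> real_trig_poly n"
proof -
  obtain F G where "F \<in> trig_poly n" "G \<in> trig_poly n" "f = (\<lambda>x. Re (F x))" "g = (\<lambda>x. Re (G x))"
    using assms by (auto simp: real_trig_poly_def)
  then show ?thesis
    unfolding real_trig_poly_def by (intro image_eqI[of _ _ "\<lambda>x. F x + G x"]) (auto intro: trig_poly.add)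
qed

lemma real_trig_poly_mult:
  assumes "f \<in> real_trig_poly n" "g \<in> real_trig_poly n"
  shows "(\<lambda>x. f x * g x) \<in> real_trig_poly n"
proof -
  obtain F G where F: "F \<in> trig_poly n" "f = (\<lambda>x. Re (F x))" and G: "G \<in> trig_poly n" "g = (\<lambda>x. Re (G x))"
    using assms by (auto simp: real_trig_poly_def)
  \<comment> \<open>\<open>Re F * Re G = Re (F * G + F * cnj G) / 2\<close>, hence the closure of
    \<open>trig_poly\<close> under conjugation.\<close>
  let ?H = "\<lambda>x. (1/2) * (F x * G x + F x * cnj (G x))"
  have "?H \<in> trig_poly n"
    by (intro trig_poly_mult trig_poly_const trig_poly.add trig_poly_cnj F G)
  moreover have "(\<lambda>x. f x * g x) = (\<lambda>x. Re (?H x))"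
    by (simp add: F G fun_eq_iff field_simps)
  ultimately show ?thesis unfolding real_trig_poly_def by (intro image_eqI[of _ _ ?H])
qed

lemma real_trig_poly_const: "(\<lambda>_. c) \<in> real_trig_poly n"
  unfolding real_trig_poly_def by (intro image_eqI[of _ _ "\<lambda>_. complex_of_real c"] trig_poly_const) simp

lemma real_trig_poly_sin: "i < n \<Longrightarrow> (\<lambda>x. sin (a * x i)) \<in> real_trig_poly n"
proof -
  assume i: "i < n"
  have "(\<Sum>j<n. (if j = i then a else 0) * x j) = a * x i" for x :: "nat \<Rightarrow> real"
    using i by (simp add: if_distrib[of "\<lambda>t. t * _"] cong: if_cong)
  then have "(\<lambda>x. (- \<i>) * iexp (a * x i)) \<in> trig_poly n"
    using trig_poly.monomial[of "- \<i>" "\<lambda>j. if j = i then a else 0" n] by simp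
  then show ?thesis
    unfolding real_trig_poly_def by (rule rev_image_eqI) (simp add: fun_eq_iff Im_exp)
qed

lemma real_trig_poly_polynomial:
  assumes "real_polynomial_function (q :: real \<Rightarrow> real)" "f \<in> real_trig_poly n"
  shows "(\<lambda>x. q (f x)) \<in> real_trig_poly n"
  using assms(1)
proof induction
  case (linear q)
  then interpret bounded_linear q .
  have "q (f x) = f x * q 1" for x using scaleR[of "f x" 1] by simp
  then show ?case using real_trig_poly_mult[OF assms(2) real_trig_poly_const[of "q 1"]] by simp
qed (auto intro: real_trig_poly_const real_trig_poly_add real_trig_poly_mult)

lemma real_trig_poly_continuous: "f \<in> real_trig_poly n \<Longrightarrow> continuous_on UNIV f"
  by (auto simp: real_trig_poly_def intro!: continuous_intros trig_poly_continuous)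

lemma real_trig_poly_bounded: "f \<in> real_trig_poly n \<Longrightarrow> \<exists>C. \<forall>x. \<bar>f x\<bar> \<le> C"
proof -
  assume "f \<in> real_trig_poly n"
  then obtain F where F: "F \<in> trig_poly n" "f = (\<lambda>x. Re (F x))" by (auto simp: real_trig_poly_def)
  obtain C where "\<And>x. cmod (F x) \<le> C" using trig_poly_bounded[OF F(1)] by blast
  then show ?thesis unfolding F(2) using abs_Re_le_cmod order.trans by (intro exI[of _ C]) blast
qed

lemma real_trig_poly_cong: "f \<in> real_trig_poly n \<Longrightarrow> (\<And>j. j < n \<Longrightarrow> x j = y j) \<Longrightarrow> f x = f y"
proof -
  assume "f \<in> real_trig_poly n" and eq: "\<And>j. j < n \<Longrightarrow> x j = y j"
  then obtain F where F: "F \<in> trig_poly n" "f = (\<lambda>x. Re (F x))" by (auto simp: real_trig_poly_def)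
  show ?thesis unfolding F(2) using trig_poly_cong[OF F(1) eq] by simp
qed

text \<open>Pinning the entries from \<open>n\<close> on to 0 makes the box compact by Tychonoff and
  leaves any two of its points distinguishable by one of the first \<open>n\<close> entries.\<close>

lemma compact_box_fun:
  "compact {x :: nat \<Rightarrow> real. \<forall>j. x j \<in> (if j < n then {-L..L} else {0})}"
proof -
  have "compactin (product_topology (\<lambda>_. euclidean) UNIV) (PiE (UNIV :: nat set) (\<lambda>j. if j < n then {-L..L} else {0::real}))"
    unfolding compactin_PiE by auto
  then have "compact (PiE (UNIV :: nat set) (\<lambda>j. if j < n then {-L..L} else {0::real}))"
    by (simp add: euclidean_product_topology)
  also have "PiE (UNIV :: nat set) (\<lambda>j. if j < n then {-L..L} else {0::real})
     = {x. \<forall>j. x j \<in> (if j < n then {-L..L} else {0})}" by (simp add: PiE_def Pi_def)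
  finally show ?thesis .
qed

text \<open>Stone--Weierstrass bounds the approximant on the box only; composing it with a polynomial close to a
  truncation stays inside the algebra and bounds it everywhere.\<close>

lemma real_trig_poly_approx:
  fixes G :: "(nat \<Rightarrow> real) \<Rightarrow> real"
  assumes cont: "continuous_on UNIV G" and bd: "\<And>x. \<bar>G x\<bar> \<le> B"
    and cong: "\<And>x y. (\<And>j. j < n \<Longrightarrow> x j = y j) \<Longrightarrow> G x = G y" and L: "0 < L" and \<epsilon>: "0 < \<epsilon>"
  obtains h where "h \<in> real_trig_poly n" "\<And>x. \<bar>h x\<bar> \<le> B + \<epsilon>"
    "\<And>x. (\<And>j. j < n \<Longrightarrow> \<bar>x j\<bar> \<le> L) \<Longrightarrow> \<bar>h x - G x\<bar> \<le> 2 * \<epsilon>"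
proof -
  have B: "0 \<le> B" using bd[of undefined] by linarith
  define S where "S = {x :: nat \<Rightarrow> real. \<forall>j. x j \<in> (if j < n then {-L..L} else {0})}"
  interpret PR: function_ring_on "real_trig_poly n" S
  proof
    show "compact S" unfolding S_def by (rule compact_box_fun)
    show "continuous_on S f" if "f \<in> real_trig_poly n" for f
      using real_trig_poly_continuous[OF that] continuous_on_subset by blast
    fix x y assume xy: "x \<in> S" "y \<in> S" "x \<noteq> y"
    then obtain j where j: "x j \<noteq> y j" by auto
    have jn: "j < n"
    proof (rule ccontr)
      assume "\<not> j < n"
      then have "x j = 0" "y j = 0" using xy(1,2) by (auto simp: S_def dest: spec[of _ j])
      with j show False by simp
    qed
    have "\<bar>x j\<bar> \<le> L" "\<bar>y j\<bar> \<le> L" using xy(1,2) jn by (auto simp: S_def abs_le_iff split: if_splits dest!: spec[of _ j])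
    \<comment> \<open>After division by \<open>L\<close> the entries lie in \<open>[-1,1]\<close>,
      where the sine is injective and so separates points.\<close>
    then have "\<bar>x j / L\<bar> \<le> 1" "\<bar>y j / L\<bar> \<le> 1" using L by (auto simp: divide_simps abs_le_iff)
    moreover have "1 \<le> pi / 2" using pi_ge_two by simp
    ultimately have "- (pi / 2) \<le> x j / L" "x j / L \<le> pi / 2" "- (pi / 2) \<le> y j / L" "y j / L \<le> pi / 2"
      by linarith+
    then have "sin (x j / L) \<noteq> sin (y j / L)"
      using sin_inj_pi[of "x j / L" "y j / L"] j L by auto
    then have "sin (1 / L * x j) \<noteq> sin (1 / L * y j)" by simp
    then show "\<exists>f\<in>real_trig_poly n. f x \<noteq> f y"
      by (rule bexI[OF _ real_trig_poly_sin[OF jn, of "1 / L"]])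
  next
    fix f g assume fg: "f \<in> real_trig_poly n" "g \<in> real_trig_poly n"
    show "(\<lambda>x. f x + g x) \<in> real_trig_poly n" by (rule real_trig_poly_add[OF fg])
    show "(\<lambda>x. f x * g x) \<in> real_trig_poly n" by (rule real_trig_poly_mult[OF fg])
  next
    show "(\<lambda>_. c) \<in> real_trig_poly n" for c by (rule real_trig_poly_const)
  qed
  obtain g where g: "g \<in> real_trig_poly n" "\<And>x. x \<in> S \<Longrightarrow> \<bar>G x - g x\<bar> < \<epsilon>"
    using PR.Stone_Weierstrass_basic[OF continuous_on_subset[OF cont] \<epsilon>] by blast
  obtain C where C: "\<And>x. \<bar>g x\<bar> \<le> C" using real_trig_poly_bounded[OF g(1)] by blast
  define clip where "clip y = max (- B) (min B y)" for y :: real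
  have "continuous_on {-C..C} clip" unfolding clip_def by (intro continuous_intros)
  then obtain q where q: "real_polynomial_function q" "\<And>y. y \<in> {-C..C} \<Longrightarrow> \<bar>clip y - q y\<bar> < \<epsilon>"
    using Stone_Weierstrass_real_polynomial_function[of "{-C..C}" clip \<epsilon>] \<epsilon> by blast
  have qg: "\<bar>clip (g x) - q (g x)\<bar> < \<epsilon>" for x using C[of x] by (intro q(2)) (auto simp: abs_le_iff)
  have h: "(\<lambda>x. q (g x)) \<in> real_trig_poly n" by (rule real_trig_poly_polynomial[OF q(1) g(1)])
  show ?thesis
  proof (rule that[OF h])
    fix x
    have "\<bar>clip (g x)\<bar> \<le> B" using B by (auto simp: clip_def)
    then show "\<bar>q (g x)\<bar> \<le> B + \<epsilon>" using qg[of x] by linarith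
  next
    fix x :: "nat \<Rightarrow> real" assume x: "\<And>j. j < n \<Longrightarrow> \<bar>x j\<bar> \<le> L"
    \<comment> \<open>Neither \<open>G\<close> nor the approximant reads entries from
      \<open>n\<close> on, so these may be set to 0 to land in the compact box.\<close>
    define y where "y j = (if j < n then x j else 0)" for j
    have "y \<in> S" using x by (auto simp: S_def y_def abs_le_iff minus_le_iff)
    from g(2)[OF this] bd[of y] have "\<bar>clip (g y) - G y\<bar> < \<epsilon>" by (auto simp: clip_def)
    then have "\<bar>q (g y) - G y\<bar> \<le> 2 * \<epsilon>" using qg[of y] by linarith
    moreover have "q (g x) = q (g y)" using real_trig_poly_cong[OF h, of x y] by (simp add: y_def)
    moreover have "G x = G y" by (rule cong) (simp add: y_def)
    ultimately show "\<bar>q (g x) - G x\<bar> \<le> 2 * \<epsilon>" by simp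
  qed
qed

section \<open>From characteristic functions to expectations\<close>

text \<open>Levy's continuity theorem on the line gives weak convergence. The continuous ramp
  \<open>g\<close>, squeezed between the indicators of \<open>|x| > i + 1\<close> and
  \<open>|x| > i\<close>, carries a tail bound of the limit over to all large
  \<open>N\<close>.\<close>

lemma char_imp_tail:
  fixes \<mu> :: "nat \<Rightarrow> real pmf" and Y :: "'a \<Rightarrow> real"
  assumes M: "prob_space M" and Y: "Y \<in> borel_measurable M"
    and char: "\<And>\<theta>. (\<lambda>N. measure_pmf.expectation (\<mu> N) (\<lambda>x. iexp (\<theta> * x))) \<longlonglongrightarrow> (\<integral>w. iexp (\<theta> * Y w) \<partial>M)"
    and \<epsilon>: "0 < \<epsilon>"
  obtains L where "0 < L" "measure M {w \<in> space M. L < \<bar>Y w\<bar>} < \<epsilon>"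
    "eventually (\<lambda>N. measure_pmf.prob (\<mu> N) {x. L < \<bar>x\<bar>} < \<epsilon>) sequentially"
proof -
  interpret M: prob_space M by fact
  define m where "m N = distr (measure_pmf (\<mu> N)) borel (\<lambda>x. x)" for N
  define m' where "m' = distr M borel Y"
  have rd: "real_distribution (m N)" for N
    unfolding m_def real_distribution_def real_distribution_axioms_def
    by (auto intro!: measure_pmf.prob_space_distr)
  have rd': "real_distribution m'"
    unfolding m'_def using Y by (rule M.real_distribution_distr)
  have wc: "weak_conv_m m m'"
  proof (rule levy_continuity[OF rd rd'])
    fix t
    show "(\<lambda>N. char (m N) t) \<longlonglongrightarrow> char m' t"
      using char[of t] Y by (simp add: char_def m_def m'_def integral_distr)
  qed
  have "(\<lambda>i. measure M {w \<in> space M. real i < \<bar>Y w\<bar>}) \<longlonglongrightarrow> measure M (\<Inter>i. {w \<in> space M. real i < \<bar>Y w\<bar>})"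
    using Y by (intro M.finite_Lim_measure_decseq) (auto simp: decseq_def)
  moreover have "(\<Inter>i. {w \<in> space M. real i < \<bar>Y w\<bar>}) = {}"
  proof -
    have "\<exists>i. \<not> real i < \<bar>Y w\<bar>" for w using reals_Archimedean2[of "\<bar>Y w\<bar>"] less_asym by blast
    then show ?thesis by blast
  qed
  ultimately have "(\<lambda>i. measure M {w \<in> space M. real i < \<bar>Y w\<bar>}) \<longlonglongrightarrow> 0" by simp
  then have "eventually (\<lambda>i. measure M {w \<in> space M. real i < \<bar>Y w\<bar>} < \<epsilon>) sequentially"
    using \<epsilon> by (rule order_tendstoD)
  then obtain i where i: "measure M {w \<in> space M. real i < \<bar>Y w\<bar>} < \<epsilon>"
    by (auto simp: eventually_sequentially)
  define g where "g x = max 0 (min 1 (\<bar>x\<bar> - real i))" for x :: real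
  have g: "continuous_on UNIV g" "\<And>x. norm (g x) \<le> 1" "\<And>x. 0 \<le> g x" unfolding g_def
    by (auto intro!: continuous_intros)
  have gm [measurable]: "g \<in> borel_measurable borel" using g(1) by (rule borel_measurable_continuous_onI)
  have "(\<lambda>N. integral\<^sup>L (m N) g) \<longlonglongrightarrow> integral\<^sup>L m' g"
    by (rule weak_conv_imp_integral_bdd_continuous_conv[OF rd rd' wc])
       (use g in \<open>auto simp: continuous_on_eq_continuous_at\<close>)
  then have lim: "(\<lambda>N. measure_pmf.expectation (\<mu> N) g) \<longlonglongrightarrow> (\<integral>w. g (Y w) \<partial>M)"
    using Y by (simp add: m_def m'_def integral_distr)
  have "(\<integral>w. g (Y w) \<partial>M) \<le> (\<integral>w. indicator {w \<in> space M. real i < \<bar>Y w\<bar>} w \<partial>M)"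
    using Y by (intro integral_mono M.integrable_const_bound[where B = 1])
               (auto simp: g(2) g_def indicator_def)
  also have "\<dots> = measure M {w \<in> space M. real i < \<bar>Y w\<bar>}" using Y by simp
  finally have "(\<integral>w. g (Y w) \<partial>M) < \<epsilon>" using i by simp
  with lim have ev: "eventually (\<lambda>N. measure_pmf.expectation (\<mu> N) g < \<epsilon>) sequentially"
    by (rule order_tendstoD)
  show ?thesis
  proof (rule that[of "real i + 1"])
    have "measure M {w \<in> space M. real i + 1 < \<bar>Y w\<bar>} \<le> measure M {w \<in> space M. real i < \<bar>Y w\<bar>}"
      using Y by (intro M.finite_measure_mono) auto
    then show "measure M {w \<in> space M. real i + 1 < \<bar>Y w\<bar>} < \<epsilon>" using i by simp
    show "eventually (\<lambda>N. measure_pmf.prob (\<mu> N) {x. real i + 1 < \<bar>x\<bar>} < \<epsilon>) sequentially"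
    proof (rule eventually_mono[OF ev])
      fix N assume N: "measure_pmf.expectation (\<mu> N) g < \<epsilon>"
      have "measure_pmf.prob (\<mu> N) {x. real i + 1 < \<bar>x\<bar>} = measure_pmf.expectation (\<mu> N) (indicator {x. real i + 1 < \<bar>x\<bar>})"
        by simp
      also have "\<dots> \<le> measure_pmf.expectation (\<mu> N) g"
        by (intro integral_mono measure_pmf.integrable_const_bound[where B = 1])
           (use g(2,3) in \<open>auto simp: indicator_def g_def\<close>)
      finally show "measure_pmf.prob (\<mu> N) {x. real i + 1 < \<bar>x\<bar>} < \<epsilon>" using N by simp
    qed
  qed simp
qed

text \<open>The tails of the single coordinates confine the mass to a box, on which \<open>G\<close>
  is close to a trigonometric polynomial whose expectations converge. Off the box only bounds
  matter, and the approximant is bounded by \<open>B + \<epsilon>\<close> everywhere.\<close>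

theorem char_imp_expectation_tendsto:
  fixes \<mu> :: "nat \<Rightarrow> (nat \<Rightarrow> real) pmf" and Y :: "'a \<Rightarrow> nat \<Rightarrow> real"
    and G :: "(nat \<Rightarrow> real) \<Rightarrow> real"
  assumes M: "prob_space M" and Y: "\<And>j. (\<lambda>w. Y w j) \<in> borel_measurable M"
    and char: "\<And>\<theta>. (\<lambda>N. measure_pmf.expectation (\<mu> N) (\<lambda>x. iexp (\<Sum>j<n. \<theta> j * x j)))
        \<longlonglongrightarrow> (\<integral>w. iexp (\<Sum>j<n. \<theta> j * Y w j) \<partial>M)"
    and cont: "continuous_on UNIV G" and bd: "\<And>x. \<bar>G x\<bar> \<le> B"
    and cong: "\<And>x y. (\<And>j. j < n \<Longrightarrow> x j = y j) \<Longrightarrow> G x = G y"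
  shows "(\<lambda>N. measure_pmf.expectation (\<mu> N) G) \<longlonglongrightarrow> (\<integral>w. G (Y w) \<partial>M)"
proof -
  interpret M: prob_space M by fact
  have B: "0 \<le> B" using bd[of undefined] by linarith
  have Ym: "Y \<in> borel_measurable M" by (rule measurable_coordinatewise_then_product[OF Y])
  have Gm: "(\<lambda>w. G (Y w)) \<in> borel_measurable M"
    using measurable_compose[OF Ym borel_measurable_continuous_onI[OF cont]] .
  have trig: "(\<lambda>N. measure_pmf.expectation (\<mu> N) f) \<longlonglongrightarrow> (\<integral>w. f (Y w) \<partial>M) \<and> integrable M (\<lambda>w. f (Y w))
     \<and> (\<forall>N. integrable (measure_pmf (\<mu> N)) f)"
    if "f \<in> trig_poly n" for f
    using that
  proof induction
    case (monomial c \<theta>)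
    have "integrable M (\<lambda>w. c * iexp (\<Sum>j<n. \<theta> j * Y w j))"
      using Y by (intro M.integrable_const_bound[where B = "cmod c"]) (auto simp: norm_mult)
    moreover have "integrable (measure_pmf (\<mu> N)) (\<lambda>x. c * iexp (\<Sum>j<n. \<theta> j * x j))" for N
      by (intro measure_pmf.integrable_const_bound[where B = "cmod c"]) (auto simp: norm_mult)
    ultimately show ?case using tendsto_mult[OF tendsto_const char[of \<theta>], of c] by simp
  next
    case (add f g)
    then show ?case by (auto intro!: tendsto_add)
  qed
  have rtrig: "(\<lambda>N. measure_pmf.expectation (\<mu> N) h) \<longlonglongrightarrow> (\<integral>w. h (Y w) \<partial>M)" if h: "h \<in> real_trig_poly n" for h
  proof -
    obtain f where f: "f \<in> trig_poly n" "h = (\<lambda>x. Re (f x))" using h by (auto simp: real_trig_poly_def)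
    show ?thesis using tendsto_Re[OF conjunct1[OF trig[OF f(1)]]] trig[OF f(1)] by (simp add: f(2))
  qed
  have tail: "\<exists>L>0. measure M {w \<in> space M. L < \<bar>Y w j\<bar>} < \<epsilon> \<and>
     eventually (\<lambda>N. measure_pmf.prob (\<mu> N) {x. L < \<bar>x j\<bar>} < \<epsilon>) sequentially" if j: "j < n" and "0 < \<epsilon>" for j \<epsilon>
  proof -
    have pick: "(\<Sum>i<n. (if i = j then \<theta> else 0) * x i) = \<theta> * x j" for x :: "nat \<Rightarrow> real" and \<theta>
      using j by (simp add: if_distrib[of "\<lambda>t. t * _"] cong: if_cong)
    have c: "(\<lambda>N. measure_pmf.expectation (map_pmf (\<lambda>x. x j) (\<mu> N)) (\<lambda>x. iexp (\<theta> * x)))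
        \<longlonglongrightarrow> (\<integral>w. iexp (\<theta> * Y w j) \<partial>M)" for \<theta>
      using char[of "\<lambda>i. if i = j then \<theta> else 0"] unfolding pick by simp
    obtain L where "0 < L" "measure M {w \<in> space M. L < \<bar>Y w j\<bar>} < \<epsilon>"
      "eventually (\<lambda>N. measure_pmf.prob (map_pmf (\<lambda>x. x j) (\<mu> N)) {x. L < \<bar>x\<bar>} < \<epsilon>) sequentially"
      using char_imp_tail[OF M Y c \<open>0 < \<epsilon>\<close>] by blast
    then show ?thesis by (intro exI[of _ L]) (simp add: vimage_def)
  qed
  show ?thesis
  proof (rule tendstoI)
    fix \<epsilon>' :: real assume \<epsilon>': "0 < \<epsilon>'"
    \<comment> \<open>Exchanging \<open>G\<close> for its approximant costs
      \<open>(2 * B + 3) * \<epsilon>\<close> on either side of the limit, and convergence costs one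
      more \<open>\<epsilon>\<close>.\<close>
    define \<epsilon> where "\<epsilon> = min 1 (\<epsilon>' / (4 * B + 7))"
    \<comment> \<open>Tail budget of one coordinate; the added 1 makes
      \<open>n * t < \<epsilon>\<close> strict and covers \<open>n = 0\<close>.\<close>
    define t where "t = \<epsilon> / (real n + 1)"
    have \<epsilon>: "0 < \<epsilon>" "\<epsilon> \<le> 1" using \<epsilon>' B by (auto simp: \<epsilon>_def)
    have \<epsilon>2: "(4 * B + 7) * \<epsilon> \<le> \<epsilon>'"
    proof -
      have "(4 * B + 7) * \<epsilon> \<le> (4 * B + 7) * (\<epsilon>' / (4 * B + 7))"
        using B by (intro mult_left_mono) (auto simp: \<epsilon>_def)
      then show ?thesis using B by simp
    qed
    have t: "0 < t" using \<epsilon> by (simp add: t_def)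
    have nt: "real n * t < \<epsilon>" using \<epsilon> by (simp add: t_def field_simps)
    have "\<exists>L. 0 < L \<and> measure M {w \<in> space M. L < \<bar>Y w j\<bar>} < t \<and>
       eventually (\<lambda>N. measure_pmf.prob (\<mu> N) {x. L < \<bar>x j\<bar>} < t) sequentially" if "j \<in> {..<n}" for j
      by (rule tail) (use that t in auto)
    then have "\<exists>l. \<forall>j\<in>{..<n}. 0 < l j \<and> measure M {w \<in> space M. l j < \<bar>Y w j\<bar>} < t \<and>
       eventually (\<lambda>N. measure_pmf.prob (\<mu> N) {x. l j < \<bar>x j\<bar>} < t) sequentially"
      by (intro bchoice ballI)
    then obtain l where l0: "\<forall>j\<in>{..<n}. 0 < l j \<and> measure M {w \<in> space M. l j < \<bar>Y w j\<bar>} < t \<and>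
       eventually (\<lambda>N. measure_pmf.prob (\<mu> N) {x. l j < \<bar>x j\<bar>} < t) sequentially" ..
    have l: "0 < l j \<and> measure M {w \<in> space M. l j < \<bar>Y w j\<bar>} < t \<and>
       eventually (\<lambda>N. measure_pmf.prob (\<mu> N) {x. l j < \<bar>x j\<bar>} < t) sequentially" if "j < n" for j
      by (rule bspec[OF l0]) (simp add: that)
    define L where "L = 1 + (\<Sum>j<n. l j)"
    have lL: "l j \<le> L" if "j < n" for j
      using member_le_sum[of j "{..<n}" l] l that by (force simp: L_def less_imp_le)
    have L: "0 < L" unfolding L_def using l by (intro add_pos_nonneg sum_nonneg) (auto simp: less_imp_le)
    obtain h where h: "h \<in> real_trig_poly n" "\<And>x. \<bar>h x\<bar> \<le> B + \<epsilon>"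
      "\<And>x. (\<And>j. j < n \<Longrightarrow> \<bar>x j\<bar> \<le> L) \<Longrightarrow> \<bar>h x - G x\<bar> \<le> 2 * \<epsilon>"
      using real_trig_poly_approx[OF cont bd cong L \<epsilon>(1)] by blast
    have hG: "\<bar>h x - G x\<bar> \<le> 2 * \<epsilon> + (2 * B + 1) * (\<Sum>j<n. indicator {x. l j < \<bar>x j\<bar>} x)" for x
    proof (cases "\<forall>j<n. \<bar>x j\<bar> \<le> l j")
      case True
      then have "\<bar>h x - G x\<bar> \<le> 2 * \<epsilon>" using lL by (intro h(3)) force
      moreover have "0 \<le> (2 * B + 1) * (\<Sum>j<n. indicator {x. l j < \<bar>x j\<bar>} x)"
        using B by (intro mult_nonneg_nonneg sum_nonneg) auto
      ultimately show ?thesis by linarith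
    next
      case False
      then obtain j where j: "j < n" "l j < \<bar>x j\<bar>" by force
      have "1 \<le> (\<Sum>j<n. indicator {x. l j < \<bar>x j\<bar>} x :: real)"
        using member_le_sum[of j "{..<n}" "\<lambda>j. indicator {x. l j < \<bar>x j\<bar>} x :: real"] j by simp
      then have "(2 * B + 1) * 1 \<le> (2 * B + 1) * (\<Sum>j<n. indicator {x. l j < \<bar>x j\<bar>} x)"
        using B by (intro mult_left_mono) auto
      moreover have "\<bar>h x - G x\<bar> \<le> 2 * B + \<epsilon>" using h(2)[of x] bd[of x] by linarith
      moreover have "2 * B + \<epsilon> \<le> 2 * \<epsilon> + (2 * B + 1) * 1" using \<epsilon> by simp
      ultimately show ?thesis by (meson add_left_mono order.trans)
    qed
    have hm: "(\<lambda>w. h (Y w)) \<in> borel_measurable M"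
      using measurable_compose[OF Ym borel_measurable_continuous_onI[OF real_trig_poly_continuous[OF h(1)]]] .
    have Yset: "{w \<in> space M. l j < \<bar>Y w j\<bar>} \<in> sets M" for j using Y by measurable
    have intM: "integrable M (\<lambda>w. h (Y w))" "integrable M (\<lambda>w. G (Y w))"
      by (rule M.integrable_const_bound[where B = "B + \<epsilon>"], use hm h(2) in simp_all)
         (rule M.integrable_const_bound[where B = B], use Gm bd in simp_all)
    have intP: "integrable (measure_pmf (\<mu> N)) h" "integrable (measure_pmf (\<mu> N)) G" for N
      by (rule measure_pmf.integrable_const_bound[where B = "B + \<epsilon>"], use h(2) in simp_all)
         (rule measure_pmf.integrable_const_bound[where B = B], use bd in simp_all)
    have "\<bar>(\<integral>w. h (Y w) \<partial>M) - (\<integral>w. G (Y w) \<partial>M)\<bar> \<le> (\<integral>w. \<bar>h (Y w) - G (Y w)\<bar> \<partial>M)"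
      using intM by (simp add: Bochner_Integration.integral_diff[symmetric] del: Bochner_Integration.integral_diff)
    also have "\<dots> \<le> (\<integral>w. 2 * \<epsilon> + (2 * B + 1) * (\<Sum>j<n. indicator {w \<in> space M. l j < \<bar>Y w j\<bar>} w) \<partial>M)"
    proof (rule integral_mono)
      show "\<bar>h (Y w) - G (Y w)\<bar> \<le> 2 * \<epsilon> + (2 * B + 1) * (\<Sum>j<n. indicator {w \<in> space M. l j < \<bar>Y w j\<bar>} w)"
        if "w \<in> space M" for w
        using hG[of "Y w"] that by (simp add: indicator_def)
    qed (use intM Yset in \<open>auto simp: M.emeasure_eq_measure intro!: integrable_real_indicator\<close>)
    also have "\<dots> = 2 * \<epsilon> + (2 * B + 1) * (\<Sum>j<n. measure M {w \<in> space M. l j < \<bar>Y w j\<bar>})"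
      using Yset by (simp add: M.prob_space M.emeasure_eq_measure integrable_real_indicator)
    also have "\<dots> \<le> 2 * \<epsilon> + (2 * B + 1) * (\<Sum>j<n. t)"
      using l B by (intro add_left_mono mult_left_mono sum_mono) (auto simp: less_imp_le)
    also have "\<dots> \<le> 2 * \<epsilon> + (2 * B + 1) * \<epsilon>"
      using nt B by (intro add_left_mono mult_left_mono) auto
    finally have eM: "\<bar>(\<integral>w. h (Y w) \<partial>M) - (\<integral>w. G (Y w) \<partial>M)\<bar> \<le> (2 * B + 3) * \<epsilon>" by (simp add: algebra_simps)
    have eP: "\<bar>measure_pmf.expectation (\<mu> N) h - measure_pmf.expectation (\<mu> N) G\<bar> \<le> (2 * B + 3) * \<epsilon>"
      if N: "\<forall>j\<in>{..<n}. measure_pmf.prob (\<mu> N) {x. l j < \<bar>x j\<bar>} < t" for N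
    proof -
      have "\<bar>measure_pmf.expectation (\<mu> N) h - measure_pmf.expectation (\<mu> N) G\<bar> \<le> measure_pmf.expectation (\<mu> N) (\<lambda>x. \<bar>h x - G x\<bar>)"
        using intP by (simp add: Bochner_Integration.integral_diff[symmetric] del: Bochner_Integration.integral_diff)
      also have "\<dots> \<le> measure_pmf.expectation (\<mu> N) (\<lambda>x. 2 * \<epsilon> + (2 * B + 1) * (\<Sum>j<n. indicator {x. l j < \<bar>x j\<bar>} x))"
        using hG intP by (intro integral_mono) (auto simp: measure_pmf.emeasure_eq_measure intro!: integrable_real_indicator)
      also have "\<dots> = 2 * \<epsilon> + (2 * B + 1) * (\<Sum>j<n. measure_pmf.prob (\<mu> N) {x. l j < \<bar>x j\<bar>})"
        by (simp add: measure_pmf.emeasure_eq_measure integrable_real_indicator)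
      also have "\<dots> \<le> 2 * \<epsilon> + (2 * B + 1) * (\<Sum>j<n. t)"
        using N B by (intro add_left_mono mult_left_mono sum_mono) (auto simp: less_imp_le)
      also have "\<dots> \<le> 2 * \<epsilon> + (2 * B + 1) * \<epsilon>"
        using nt B by (intro add_left_mono mult_left_mono) auto
      finally show ?thesis by (simp add: algebra_simps)
    qed
    have "eventually (\<lambda>N. \<forall>j\<in>{..<n}. measure_pmf.prob (\<mu> N) {x. l j < \<bar>x j\<bar>} < t) sequentially"
      using l by (intro eventually_ball_finite) auto
    moreover have "eventually (\<lambda>N. dist (measure_pmf.expectation (\<mu> N) h) (\<integral>w. h (Y w) \<partial>M) < \<epsilon>) sequentially"
      using rtrig[OF h(1)] \<epsilon>(1) by (rule tendstoD)
    ultimately show "eventually (\<lambda>N. dist (measure_pmf.expectation (\<mu> N) G) (\<integral>w. G (Y w) \<partial>M) < \<epsilon>') sequentially"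
    proof eventually_elim
      case (elim N)
      have "dist (measure_pmf.expectation (\<mu> N) G) (\<integral>w. G (Y w) \<partial>M) < (2 * B + 3) * \<epsilon> + \<epsilon> + (2 * B + 3) * \<epsilon>"
        using eP[OF elim(1)] elim(2) eM unfolding dist_real_def by linarith
      also have "\<dots> = (4 * B + 7) * \<epsilon>" by (simp add: algebra_simps)
      finally show ?case using \<epsilon>2 by simp
    qed
  qed
qed

section \<open>A metric for locally uniform convergence\<close>

text \<open>Capping the difference at time \<open>t\<close> by \<open>1 / (1 + t)\<close> encodes
  all horizons in one supremum: times beyond \<open>T\<close> contribute at most
  \<open>1 / (1 + T)\<close>. The cap also keeps the supremum finite for arbitrary functions.
  Negative times are not seen, in accordance with \<open>ucc_continuous\<close>.\<close>

definition ucc_dist :: "(real \<Rightarrow> real) \<Rightarrow> (real \<Rightarrow> real) \<Rightarrow> real" where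
  "ucc_dist x y = (SUP t\<in>{0..}. min \<bar>x t - y t\<bar> (1 / (1 + t)))"

lemma min_horizon_le_1: "0 \<le> t \<Longrightarrow> min a (1 / (1 + t)) \<le> (1 :: real)"
proof -
  assume "0 \<le> t"
  then have "1 / (1 + t) \<le> 1" by simp
  then show ?thesis by linarith
qed

lemma ucc_dist_bdd: "bdd_above ((\<lambda>t :: real. min \<bar>x t - y t\<bar> (1 / (1 + t))) ` {0..})"
  using min_horizon_le_1 by (intro bdd_aboveI2[of _ _ 1]) simp

lemma ucc_dist_ge:
  assumes "0 \<le> t"
  shows "min \<bar>x t - y t\<bar> (1 / (1 + t)) \<le> ucc_dist x y"
  unfolding ucc_dist_def using assms by (intro cSUP_upper ucc_dist_bdd) auto

lemma ucc_dist_le: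
  assumes "\<And>t. 0 \<le> t \<Longrightarrow> min \<bar>x t - y t\<bar> (1 / (1 + t)) \<le> c"
  shows "ucc_dist x y \<le> c"
  unfolding ucc_dist_def by (rule cSUP_least) (use assms in auto)

lemma ucc_dist_nonneg: "0 \<le> ucc_dist x y"
  using ucc_dist_ge[of 0 x y] by (simp add: min_def split: if_splits)

lemma ucc_dist_self [simp]: "ucc_dist x x = 0"
  by (rule antisym[OF ucc_dist_le ucc_dist_nonneg]) simp

lemma ucc_dist_commute: "ucc_dist x y = ucc_dist y x"
  by (simp add: ucc_dist_def abs_minus_commute)

lemma ucc_dist_triangle: "ucc_dist x z \<le> ucc_dist x y + ucc_dist y z"
proof (rule ucc_dist_le)
  fix t :: real assume t: "0 \<le> t"
  have "0 \<le> 1 / (1 + t)" using t by simp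
  then have "min \<bar>x t - z t\<bar> (1 / (1 + t)) \<le> min \<bar>x t - y t\<bar> (1 / (1 + t)) + min \<bar>y t - z t\<bar> (1 / (1 + t))"
    by linarith
  then show "min \<bar>x t - z t\<bar> (1 / (1 + t)) \<le> ucc_dist x y + ucc_dist y z"
    using ucc_dist_ge[OF t, of x y] ucc_dist_ge[OF t, of y z] by linarith
qed

lemma ucc_dist_le_horizon:
  assumes "0 \<le> T" "0 \<le> \<eta>" "\<And>t. 0 \<le> t \<Longrightarrow> t \<le> T \<Longrightarrow> \<bar>x t - y t\<bar> \<le> \<eta>"
  shows "ucc_dist x y \<le> \<eta> + 1 / (1 + T)"
proof (rule ucc_dist_le)
  fix t :: real assume t: "0 \<le> t"
  show "min \<bar>x t - y t\<bar> (1 / (1 + t)) \<le> \<eta> + 1 / (1 + T)"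
  proof (cases "t \<le> T")
    case True
    have "0 \<le> 1 / (1 + T)" using assms(1) by simp
    then show ?thesis using assms(3)[OF t True] by linarith
  next
    case False
    then have "1 / (1 + t) \<le> 1 / (1 + T)" using assms(1) by (intro divide_left_mono) auto
    then show ?thesis using assms(2) by linarith
  qed
qed

lemma ucc_dist_lessD:
  assumes "ucc_dist x y < \<eta>" "\<eta> \<le> 1 / (1 + T)" "0 \<le> t" "t \<le> T"
  shows "\<bar>x t - y t\<bar> < \<eta>"
proof -
  have "1 / (1 + T) \<le> 1 / (1 + t)" using assms by (intro divide_left_mono) auto
  then show ?thesis using ucc_dist_ge[OF assms(3), of x y] assms by linarith
qed

text \<open>The largest minorant of \<open>F\<close> that is \<open>r\<close>-Lipschitz for \<open>ucc_dist\<close>; as \<open>r\<close> grows it increases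
  to \<open>F\<close>, so that tightness is needed only for Lipschitz functionals.\<close>

definition lipschitz_minorant :: "((real \<Rightarrow> real) \<Rightarrow> real) \<Rightarrow> real \<Rightarrow> (real \<Rightarrow> real) \<Rightarrow> real" where
  "lipschitz_minorant F r x = (INF y. F y + r * ucc_dist x y)"

context
  fixes F :: "(real \<Rightarrow> real) \<Rightarrow> real" and B r :: real
  assumes F: "\<And>x. \<bar>F x\<bar> \<le> B" and r: "0 \<le> r"
begin

lemma lipschitz_minorant_bdd: "bdd_below (range (\<lambda>y. F y + r * ucc_dist x y))"
proof (rule bdd_belowI2[of _ "- B"])
  fix y
  have "0 \<le> r * ucc_dist x y" using r ucc_dist_nonneg by simp
  then show "- B \<le> F y + r * ucc_dist x y" using F[of y] by linarith
qed

lemma lipschitz_minorant_le: "lipschitz_minorant F r x \<le> F y + r * ucc_dist x y"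
  unfolding lipschitz_minorant_def by (rule cINF_lower[OF lipschitz_minorant_bdd]) simp

lemma lipschitz_minorant_ge: "(\<And>y. c \<le> F y + r * ucc_dist x y) \<Longrightarrow> c \<le> lipschitz_minorant F r x"
  unfolding lipschitz_minorant_def by (rule cINF_greatest) auto

lemma lipschitz_minorant_le_self: "lipschitz_minorant F r x \<le> F x"
  using lipschitz_minorant_le[of x x] by simp

lemma lipschitz_minorant_bounded: "\<bar>lipschitz_minorant F r x\<bar> \<le> B"
proof -
  have "- B \<le> lipschitz_minorant F r x"
  proof (rule lipschitz_minorant_ge)
    fix y
    have "0 \<le> r * ucc_dist x y" using r ucc_dist_nonneg by simp
    then show "- B \<le> F y + r * ucc_dist x y" using F[of y] by linarith
  qed
  moreover have "lipschitz_minorant F r x \<le> B" using lipschitz_minorant_le_self[of x] F[of x] by linarith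
  ultimately show ?thesis by simp
qed

lemma lipschitz_minorant_lipschitz:
  "\<bar>lipschitz_minorant F r x - lipschitz_minorant F r y\<bar> \<le> r * ucc_dist x y"
proof -
  have "lipschitz_minorant F r x - r * ucc_dist x y \<le> lipschitz_minorant F r y" for x y
  proof (rule lipschitz_minorant_ge)
    fix z
    have "r * ucc_dist x z \<le> r * (ucc_dist x y + ucc_dist y z)"
      by (intro mult_left_mono ucc_dist_triangle r)
    then show "lipschitz_minorant F r x - r * ucc_dist x y \<le> F z + r * ucc_dist y z"
      using lipschitz_minorant_le[of x z] by (simp add: distrib_left)
  qed
  from this[of x y] this[of y x] show ?thesis by (simp add: abs_le_iff ucc_dist_commute[of y x])
qed

end

lemma eventually_real_ge: "eventually (\<lambda>i. c \<le> real i) sequentially"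
  using filterlim_real_sequentially unfolding filterlim_at_top by blast

text \<open>A competitor \<open>y\<close> at distance at least \<open>\<eta>\<close> pays a penalty
  of at least \<open>2 * B\<close> and cannot beat \<open>F x\<close>; a closer one has
  \<open>F y\<close> near \<open>F x\<close> by continuity. Convergence is pointwise in
  \<open>x\<close>, which is enough for dominated convergence.\<close>

lemma lipschitz_minorant_tendsto:
  assumes F: "\<And>x. \<bar>F x\<bar> \<le> B" and cont: "ucc_continuous F"
  shows "(\<lambda>i. lipschitz_minorant F (real i) x) \<longlonglongrightarrow> F x"
proof (rule tendstoI)
  fix \<epsilon> :: real assume \<epsilon>: "0 < \<epsilon>"
  from cont \<epsilon> obtain T \<delta> where \<delta>: "0 < \<delta>"
    and T: "\<And>y. (\<forall>t\<in>{0..T}. \<bar>y t - x t\<bar> < \<delta>) \<Longrightarrow> \<bar>F y - F x\<bar> < \<epsilon> / 2"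
    unfolding ucc_continuous_def using half_gt_zero[OF \<epsilon>] by blast
  define T' where "T' = max 0 T"
  \<comment> \<open>Below \<open>1 / (1 + T')\<close> the cap is inactive up to time
    \<open>T'\<close>, so closeness in \<open>ucc_dist\<close> is uniform closeness there.\<close>
  define \<eta> where "\<eta> = min \<delta> (1 / (1 + T'))"
  have T': "0 \<le> T'" "T \<le> T'" by (auto simp: T'_def)
  have \<eta>: "0 < \<eta>" "\<eta> \<le> \<delta>" "\<eta> \<le> 1 / (1 + T')" using \<delta> T' by (auto simp: \<eta>_def)
  have "F x - \<epsilon> / 2 \<le> lipschitz_minorant F (real i) x" if i: "2 * B / \<eta> \<le> real i" for i
  proof (rule lipschitz_minorant_ge[OF F])
    fix y
    show "F x - \<epsilon> / 2 \<le> F y + real i * ucc_dist x y"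
    proof (cases "ucc_dist x y < \<eta>")
      case True
      have "\<forall>t\<in>{0..T}. \<bar>y t - x t\<bar> < \<delta>"
        using ucc_dist_lessD[OF True \<eta>(3)] T' \<eta> by (force simp: abs_minus_commute)
      from T[OF this] have "F x - \<epsilon> / 2 \<le> F y" by linarith
      moreover have "0 \<le> real i * ucc_dist x y" using ucc_dist_nonneg by simp
      ultimately show ?thesis by linarith
    next
      case False
      have "2 * B \<le> real i * \<eta>" using i \<eta> by (simp add: field_simps)
      also have "\<dots> \<le> real i * ucc_dist x y" using False by (intro mult_left_mono) auto
      finally show ?thesis using F[of x] F[of y] \<epsilon> by linarith
    qed
  qed simp
  note lower = this
  have upper: "lipschitz_minorant F (real i) x \<le> F x" for i
    by (rule lipschitz_minorant_le_self[OF F]) simp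
  have "dist (lipschitz_minorant F (real i) x) (F x) < \<epsilon>" if "2 * B / \<eta> \<le> real i" for i
    using lower[OF that] upper[of i] \<epsilon> unfolding dist_real_def by linarith
  then show "eventually (\<lambda>i. dist (lipschitz_minorant F (real i) x) (F x) < \<epsilon>) sequentially"
    by (rule eventually_mono[OF eventually_real_ge])
qed

section \<open>Approximation of paths by their grid increments\<close>

text \<open>The grid has mesh \<open>1 / m\<close> on \<open>[0, m]\<close>, hence the cap
  \<open>m * m\<close>. Mesh and horizon improve together, while a grid path remains a function of
  finitely many increments.\<close>

definition grid_index :: "nat \<Rightarrow> real \<Rightarrow> nat" where
  "grid_index m t = min (nat \<lfloor>t * real m\<rfloor>) (m * m)"

definition grid_increment :: "nat \<Rightarrow> (real \<Rightarrow> real) \<Rightarrow> nat \<Rightarrow> real" where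
  "grid_increment m x j = x (real (Suc j) / real m) - x (real j / real m)"

definition grid_path :: "nat \<Rightarrow> (nat \<Rightarrow> real) \<Rightarrow> real \<Rightarrow> real" where
  "grid_path m v t = (\<Sum>j<grid_index m t. v j)"

lemma grid_path_increment:
  assumes "x 0 = 0"
  shows "grid_path m (grid_increment m x) t = x (real (grid_index m t) / real m)"
  unfolding grid_path_def grid_increment_def using assms by (subst sum_lessThan_telescope) simp

lemma grid_index_eq: "0 \<le> t \<Longrightarrow> t \<le> real m \<Longrightarrow> grid_index m t = nat \<lfloor>t * real m\<rfloor>"
proof -
  assume "0 \<le> t" "t \<le> real m"
  then have "t * real m \<le> real m * real m" by (intro mult_right_mono) auto
  then have "nat \<lfloor>t * real m\<rfloor> \<le> m * m" by (simp add: nat_le_iff floor_le_iff)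
  then show ?thesis by (simp add: grid_index_def)
qed

lemma grid_point_close:
  assumes "0 \<le> t" "0 < m"
  shows "0 \<le> real (nat \<lfloor>t * real m\<rfloor>) / real m" "real (nat \<lfloor>t * real m\<rfloor>) / real m \<le> t"
    "t < real (nat \<lfloor>t * real m\<rfloor>) / real m + 1 / real m"
proof -
  have "0 \<le> \<lfloor>t * real m\<rfloor>" using assms by simp
  then have "real (nat \<lfloor>t * real m\<rfloor>) = of_int \<lfloor>t * real m\<rfloor>" by simp
  then have b: "real (nat \<lfloor>t * real m\<rfloor>) \<le> t * real m" "t * real m < real (nat \<lfloor>t * real m\<rfloor>) + 1"
    by linarith+
  show "real (nat \<lfloor>t * real m\<rfloor>) / real m \<le> t" using b assms by (simp add: field_simps)
  have "t < (real (nat \<lfloor>t * real m\<rfloor>) + 1) / real m" using b(2) assms by (simp add: field_simps)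
  then show "t < real (nat \<lfloor>t * real m\<rfloor>) / real m + 1 / real m" by (simp add: add_divide_distrib)
qed simp

lemma grid_path_tendsto:
  assumes cont: "continuous_on {0..} x" and x0: "x 0 = 0"
  shows "(\<lambda>m. ucc_dist x (grid_path m (grid_increment m x))) \<longlonglongrightarrow> 0"
proof (rule tendstoI)
  fix \<epsilon> :: real assume \<epsilon>: "0 < \<epsilon>"
  define T where "T = 2 / \<epsilon>"
  have T: "0 \<le> T" "1 / (1 + T) < \<epsilon> / 2" using \<epsilon> by (auto simp: T_def field_simps)
  have "uniformly_continuous_on {0..T} x"
    by (rule compact_uniformly_continuous[OF continuous_on_subset[OF cont]]) auto
  then obtain d where d: "0 < d"
    "\<And>t t'. t \<in> {0..T} \<Longrightarrow> t' \<in> {0..T} \<Longrightarrow> dist t' t < d \<Longrightarrow> dist (x t') (x t) < \<epsilon> / 2"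
    unfolding uniformly_continuous_on_def using half_gt_zero[OF \<epsilon>] by blast
  have "eventually (\<lambda>m. max 1 (max T (2 / d)) \<le> real m) sequentially"
    by (rule eventually_real_ge)
  then show "eventually (\<lambda>m. dist (ucc_dist x (grid_path m (grid_increment m x))) 0 < \<epsilon>) sequentially"
  proof (rule eventually_mono)
    fix m assume "max 1 (max T (2 / d)) \<le> real m"
    then have m: "0 < m" "T \<le> real m" "2 / d \<le> real m" by auto
    have "1 / real m < d"
    proof -
      have "2 \<le> real m * d" using m d by (simp add: field_simps)
      then show ?thesis using m by (simp add: field_simps)
    qed
    have "ucc_dist x (grid_path m (grid_increment m x)) \<le> \<epsilon> / 2 + 1 / (1 + T)"
    proof (rule ucc_dist_le_horizon)
      fix t assume t: "0 \<le> t" "t \<le> T"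
      let ?u = "real (nat \<lfloor>t * real m\<rfloor>) / real m"
      note g = grid_point_close[OF t(1) m(1)]
      have "dist (x ?u) (x t) < \<epsilon> / 2"
        using g t \<open>1 / real m < d\<close> by (intro d(2)) (auto simp: dist_real_def)
      moreover have "grid_path m (grid_increment m x) t = x ?u"
        using grid_path_increment[where x = x, OF x0] grid_index_eq[of t m] t m by simp
      ultimately show "\<bar>x t - grid_path m (grid_increment m x) t\<bar> \<le> \<epsilon> / 2"
        by (simp add: dist_real_def abs_minus_commute)
    qed (use T \<epsilon> in auto)
    then show "dist (ucc_dist x (grid_path m (grid_increment m x))) 0 < \<epsilon>"
      using T ucc_dist_nonneg[of x "grid_path m (grid_increment m x)"] by simp
  qed
qed

lemma grid_path_lipschitz:
  "ucc_dist (grid_path m v) (grid_path m v') \<le> (\<Sum>j<m * m. \<bar>v j - v' j\<bar>)"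
proof (rule ucc_dist_le)
  fix t :: real
  have "\<bar>grid_path m v t - grid_path m v' t\<bar> \<le> (\<Sum>j<grid_index m t. \<bar>v j - v' j\<bar>)"
    unfolding grid_path_def sum_subtractf[symmetric] by (rule sum_abs)
  also have "\<dots> \<le> (\<Sum>j<m * m. \<bar>v j - v' j\<bar>)"
    by (intro sum_mono2) (auto simp: grid_index_def)
  finally show "min \<bar>grid_path m v t - grid_path m v' t\<bar> (1 / (1 + t)) \<le> (\<Sum>j<m * m. \<bar>v j - v' j\<bar>)"
    by linarith
qed

text \<open>The distance of two grid paths is at most a sum of differences of finitely many
  coordinates, which is continuous in the product topology.\<close>

lemma grid_functional_continuous:
  fixes \<Phi> :: "(real \<Rightarrow> real) \<Rightarrow> real"
  assumes "\<And>x y. \<bar>\<Phi> x - \<Phi> y\<bar> \<le> r * ucc_dist x y" "0 \<le> r"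
  shows "continuous_on UNIV (\<lambda>v. \<Phi> (grid_path m v))"
  unfolding continuous_on_def
proof
  fix v :: "nat \<Rightarrow> real"
  have coord: "((\<lambda>w. w j) \<longlongrightarrow> v j) (at v)" for j
    using continuous_on_product_coordinates[of j] unfolding continuous_on_def by blast
  have "((\<lambda>w. r * (\<Sum>j<m * m. \<bar>w j - v j\<bar>)) \<longlongrightarrow> r * (\<Sum>j<m * m. \<bar>v j - v j\<bar>)) (at v)"
    by (intro tendsto_intros coord)
  then have lim: "((\<lambda>w. r * (\<Sum>j<m * m. \<bar>w j - v j\<bar>)) \<longlongrightarrow> 0) (at v)" by simp
  have "norm (\<Phi> (grid_path m w) - \<Phi> (grid_path m v)) \<le> r * (\<Sum>j<m * m. \<bar>w j - v j\<bar>)" for w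
  proof -
    have "\<bar>\<Phi> (grid_path m w) - \<Phi> (grid_path m v)\<bar> \<le> r * ucc_dist (grid_path m w) (grid_path m v)"
      by (rule assms)
    also have "\<dots> \<le> r * (\<Sum>j<m * m. \<bar>w j - v j\<bar>)"
      by (intro mult_left_mono grid_path_lipschitz assms)
    finally show ?thesis by simp
  qed
  then have "((\<lambda>w. \<Phi> (grid_path m w) - \<Phi> (grid_path m v)) \<longlongrightarrow> 0) (at v)"
    by (intro Lim_null_comparison[OF _ lim] always_eventually) auto
  then show "((\<lambda>w. \<Phi> (grid_path m w)) \<longlongrightarrow> \<Phi> (grid_path m v)) (at v within UNIV)"
    by (simp add: LIM_zero_iff)
qed

text \<open>A criterion for convergence in law that mentions no topology on the path space:
  characteristic functions of the increments on every grid, and an oscillation bound between grid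
  points. In \<open>osc\<close> the grid is chosen first, and how large \<open>N\<close> must be may
  depend on it.\<close>

locale grid_convergence = prob_space M for M :: "'a measure" +
  fixes P :: "nat \<Rightarrow> (real \<Rightarrow> real) pmf" and W :: "'a \<Rightarrow> real \<Rightarrow> real"
  assumes W_meas: "\<And>t. (\<lambda>w. W w t) \<in> borel_measurable M"
    and W_cont: "\<And>w. w \<in> space M \<Longrightarrow> continuous_on {0..} (W w)"
    and W_0: "\<And>w. w \<in> space M \<Longrightarrow> W w 0 = 0"
    and P_0: "\<And>N x. x \<in> set_pmf (P N) \<Longrightarrow> x 0 = 0"
    and grid_char: "\<And>m \<theta>. 0 < m \<Longrightarrow>
      (\<lambda>N. measure_pmf.expectation (P N) (\<lambda>x. iexp (\<Sum>j<m * m. \<theta> j * grid_increment m x j)))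
        \<longlonglongrightarrow> (\<integral>w. iexp (\<Sum>j<m * m. \<theta> j * grid_increment m (W w) j) \<partial>M)"
    and osc: "\<And>(T::nat) \<eta> \<epsilon>. 0 < \<eta> \<Longrightarrow> 0 < \<epsilon> \<Longrightarrow> \<exists>m0. \<forall>m\<ge>m0. eventually (\<lambda>N.
      measure_pmf.prob (P N) {x. \<exists>t. 0 \<le> t \<and> t \<le> real T \<and> \<eta> < \<bar>x t - x (real (nat \<lfloor>t * real m\<rfloor>) / real m)\<bar>} \<le> \<epsilon>)
      sequentially"
begin

context
  fixes \<Phi> :: "(real \<Rightarrow> real) \<Rightarrow> real" and r B :: real
  assumes lip: "\<And>x y. \<bar>\<Phi> x - \<Phi> y\<bar> \<le> r * ucc_dist x y" and r: "0 \<le> r"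
    and bd: "\<And>x. \<bar>\<Phi> x\<bar> \<le> B"
begin

lemma grid_functional_measurable: "(\<lambda>w. \<Phi> (grid_path m (grid_increment m (W w)))) \<in> borel_measurable M"
proof -
  have "(\<lambda>w. grid_increment m (W w)) \<in> borel_measurable M"
    by (rule measurable_coordinatewise_then_product)
       (use W_meas in \<open>auto simp: grid_increment_def\<close>)
  from measurable_compose[OF this borel_measurable_continuous_onI[OF grid_functional_continuous[of \<Phi> r m, OF lip r]]]
  show ?thesis .
qed

lemma grid_functional_tendsto:
  assumes "w \<in> space M"
  shows "(\<lambda>m. \<Phi> (grid_path m (grid_increment m (W w)))) \<longlonglongrightarrow> \<Phi> (W w)"
proof -
  have "(\<lambda>m. r * ucc_dist (W w) (grid_path m (grid_increment m (W w)))) \<longlonglongrightarrow> r * 0"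
    by (intro tendsto_intros grid_path_tendsto W_cont W_0 assms)
  then have lim: "(\<lambda>m. r * ucc_dist (W w) (grid_path m (grid_increment m (W w)))) \<longlonglongrightarrow> 0" by simp
  have "norm (\<Phi> (grid_path m (grid_increment m (W w))) - \<Phi> (W w))
      \<le> r * ucc_dist (W w) (grid_path m (grid_increment m (W w)))" for m
    using lip[of "grid_path m (grid_increment m (W w))" "W w"] by (simp add: ucc_dist_commute)
  then have "(\<lambda>m. \<Phi> (grid_path m (grid_increment m (W w))) - \<Phi> (W w)) \<longlonglongrightarrow> 0"
    by (intro Lim_null_comparison[OF _ lim] always_eventually) auto
  then show ?thesis by (rule LIM_zero_cancel)
qed

text \<open>Continuity of the paths of \<open>W\<close> makes a Lipschitz functional a pointwise
  limit of continuous functions of finitely many increments.\<close>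

lemma lipschitz_functional_measurable: "(\<lambda>w. \<Phi> (W w)) \<in> borel_measurable M"
  by (rule borel_measurable_LIMSEQ_real[OF grid_functional_tendsto grid_functional_measurable])

lemma grid_expectation_tendsto:
  "(\<lambda>m. \<integral>w. \<Phi> (grid_path m (grid_increment m (W w))) \<partial>M) \<longlonglongrightarrow> (\<integral>w. \<Phi> (W w) \<partial>M)"
  by (rule integral_dominated_convergence[where w = "\<lambda>_. B"])
     (auto intro!: AE_I2 grid_functional_tendsto grid_functional_measurable lipschitz_functional_measurable bd)

lemma grid_fixed_tendsto:
  assumes m: "0 < m"
  shows "(\<lambda>N. measure_pmf.expectation (P N) (\<lambda>x. \<Phi> (grid_path m (grid_increment m x))))
    \<longlonglongrightarrow> (\<integral>w. \<Phi> (grid_path m (grid_increment m (W w))) \<partial>M)"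
proof -
  have "(\<lambda>N. measure_pmf.expectation (map_pmf (grid_increment m) (P N)) (\<lambda>v. \<Phi> (grid_path m v)))
    \<longlonglongrightarrow> (\<integral>w. \<Phi> (grid_path m (grid_increment m (W w))) \<partial>M)"
  proof (rule char_imp_expectation_tendsto[where n = "m * m"])
    show "prob_space M" by (rule prob_space_axioms)
    show "(\<lambda>w. grid_increment m (W w) j) \<in> borel_measurable M" for j
      using W_meas by (simp add: grid_increment_def)
    show "continuous_on UNIV (\<lambda>v. \<Phi> (grid_path m v))"
      by (rule grid_functional_continuous[OF lip r])
    show "\<bar>\<Phi> (grid_path m v)\<bar> \<le> B" for v by (rule bd)
    show "\<Phi> (grid_path m v) = \<Phi> (grid_path m v')" if "\<And>j. j < m * m \<Longrightarrow> v j = v' j" for v v'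
    proof -
      have "(\<Sum>j<grid_index m t. v j) = (\<Sum>j<grid_index m t. v' j)" for t
        by (intro sum.cong that) (auto simp: grid_index_def)
      then show ?thesis unfolding grid_path_def by simp
    qed
    show "(\<lambda>N. measure_pmf.expectation (map_pmf (grid_increment m) (P N)) (\<lambda>x. iexp (\<Sum>j<m * m. \<theta> j * x j)))
        \<longlonglongrightarrow> (\<integral>w. iexp (\<Sum>j<m * m. \<theta> j * grid_increment m (W w) j) \<partial>M)" for \<theta>
      using grid_char[OF m, of \<theta>] by simp
  qed
  then show ?thesis by simp
qed

lemma grid_approx:
  assumes osc: "measure_pmf.prob (P N) {x. \<exists>t. 0 \<le> t \<and> t \<le> real T \<and> \<eta> < \<bar>x t - x (real (nat \<lfloor>t * real m\<rfloor>) / real m)\<bar>} \<le> \<epsilon>"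
    and m: "T \<le> m" and \<eta>: "0 \<le> \<eta>"
  shows "\<bar>measure_pmf.expectation (P N) \<Phi> - measure_pmf.expectation (P N) (\<lambda>x. \<Phi> (grid_path m (grid_increment m x)))\<bar>
    \<le> r * (\<eta> + 1 / (1 + real T)) + 2 * B * \<epsilon>"
proof -
  let ?E = "{x :: real \<Rightarrow> real. \<exists>t. 0 \<le> t \<and> t \<le> real T \<and> \<eta> < \<bar>x t - x (real (nat \<lfloor>t * real m\<rfloor>) / real m)\<bar>}"
  have B: "0 \<le> B" using bd[of undefined] by linarith
  have int: "integrable (measure_pmf (P N)) f" if "\<And>x. \<bar>f x\<bar> \<le> B" for f :: "(real \<Rightarrow> real) \<Rightarrow> real"
    using that by (intro measure_pmf.integrable_const_bound[where B = B]) auto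
  have "\<bar>measure_pmf.expectation (P N) \<Phi> - measure_pmf.expectation (P N) (\<lambda>x. \<Phi> (grid_path m (grid_increment m x)))\<bar>
      \<le> measure_pmf.expectation (P N) (\<lambda>x. \<bar>\<Phi> x - \<Phi> (grid_path m (grid_increment m x))\<bar>)"
    unfolding Bochner_Integration.integral_diff[OF int[OF bd] int[OF bd], symmetric]
    by (rule integral_abs_bound)
  also have "\<dots> \<le> measure_pmf.expectation (P N) (\<lambda>x. r * (\<eta> + 1 / (1 + real T)) + 2 * B * indicator ?E x)"
  proof (intro integral_mono_AE)
    show "AE x in measure_pmf (P N). \<bar>\<Phi> x - \<Phi> (grid_path m (grid_increment m x))\<bar>
        \<le> r * (\<eta> + 1 / (1 + real T)) + 2 * B * indicator ?E x"
    proof (unfold AE_measure_pmf_iff, rule ballI)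
      fix x assume x: "x \<in> set_pmf (P N)"
      have nn: "0 \<le> r * (\<eta> + 1 / (1 + real T))" using r \<eta> by (intro mult_nonneg_nonneg) auto
      show "\<bar>\<Phi> x - \<Phi> (grid_path m (grid_increment m x))\<bar>
        \<le> r * (\<eta> + 1 / (1 + real T)) + 2 * B * indicator ?E x"
      proof (cases "x \<in> ?E")
        case True
        then have "2 * B * indicator ?E x = 2 * B" by simp
        then show ?thesis using nn bd[of x] bd[of "grid_path m (grid_increment m x)"] by linarith
      next
        case False
        have "ucc_dist x (grid_path m (grid_increment m x)) \<le> \<eta> + 1 / (1 + real T)"
        proof (rule ucc_dist_le_horizon)
          fix t assume t: "0 \<le> t" "t \<le> real T"
          have "grid_path m (grid_increment m x) t = x (real (nat \<lfloor>t * real m\<rfloor>) / real m)"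
            using grid_path_increment[where x = x, OF P_0[OF x]] grid_index_eq[of t m] t m by simp
          then show "\<bar>x t - grid_path m (grid_increment m x) t\<bar> \<le> \<eta>" using False t by force
        qed (use \<eta> in auto)
        then have "r * ucc_dist x (grid_path m (grid_increment m x)) \<le> r * (\<eta> + 1 / (1 + real T))"
          using r by (rule mult_left_mono)
        then show ?thesis using False lip[of x "grid_path m (grid_increment m x)"] by simp
      qed
    qed
    show "integrable (measure_pmf (P N)) (\<lambda>x. \<bar>\<Phi> x - \<Phi> (grid_path m (grid_increment m x))\<bar>)"
      by (intro integrable_abs Bochner_Integration.integrable_diff int bd)
  qed (simp add: measure_pmf.emeasure_eq_measure)
  also have "\<dots> = r * (\<eta> + 1 / (1 + real T)) + 2 * B * measure_pmf.prob (P N) ?E"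
    by (simp add: measure_pmf.emeasure_eq_measure)
  also have "\<dots> \<le> r * (\<eta> + 1 / (1 + real T)) + 2 * B * \<epsilon>"
    using osc B by (intro add_left_mono mult_left_mono) auto
  finally show ?thesis .
qed

lemma lipschitz_functional_tendsto:
  "(\<lambda>N. measure_pmf.expectation (P N) \<Phi>) \<longlonglongrightarrow> (\<integral>w. \<Phi> (W w) \<partial>M)"
proof (rule tendstoI)
  fix \<epsilon> :: real assume \<epsilon>: "0 < \<epsilon>"
  have B: "0 \<le> B" using bd[of undefined] by linarith
  \<comment> \<open>Oscillation, horizon and exceptional event contribute at most
    \<open>\<epsilon>/8\<close>, \<open>\<epsilon>/8\<close> and \<open>\<epsilon>/4\<close>, which
    leaves \<open>\<epsilon>/4\<close> for each of the limits in \<open>N\<close> and in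
    \<open>m\<close>.\<close>
  define T where "T = nat \<lceil>8 * (r + 1) / \<epsilon>\<rceil>"
  define \<eta> where "\<eta> = \<epsilon> / (8 * (r + 1))"
  define \<delta> where "\<delta> = \<epsilon> / (8 * (B + 1))"
  have \<eta>: "0 < \<eta>" and \<delta>: "0 < \<delta>" using \<epsilon> r B by (auto simp: \<eta>_def \<delta>_def)
  have b1: "r * \<eta> \<le> \<epsilon> / 8"
  proof -
    have "r * \<eta> \<le> (r + 1) * \<eta>" using \<eta> by (intro mult_right_mono) auto
    also have "\<dots> = \<epsilon> / 8" using r by (simp add: \<eta>_def field_simps)
    finally show ?thesis .
  qed
  have b2: "r * (1 / (1 + real T)) \<le> \<epsilon> / 8"
  proof -
    have "8 * (r + 1) / \<epsilon> \<le> real T" unfolding T_def by (rule real_nat_ceiling_ge)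
    then have "8 * (r + 1) \<le> real T * \<epsilon>" using \<epsilon> by (simp add: field_simps)
    then have "8 * r \<le> (1 + real T) * \<epsilon>" using \<epsilon> by (simp add: algebra_simps)
    then show ?thesis by (simp add: field_simps)
  qed
  have b3: "2 * B * \<delta> \<le> \<epsilon> / 4"
  proof -
    have "2 * B * \<delta> \<le> 2 * (B + 1) * \<delta>" using \<delta> by (intro mult_right_mono) auto
    also have "\<dots> = \<epsilon> / 4" using B by (simp add: \<delta>_def field_simps)
    finally show ?thesis .
  qed
  obtain m0 where m0: "\<And>m. m0 \<le> m \<Longrightarrow> eventually (\<lambda>N.
      measure_pmf.prob (P N) {x. \<exists>t. 0 \<le> t \<and> t \<le> real T \<and> \<eta> < \<bar>x t - x (real (nat \<lfloor>t * real m\<rfloor>) / real m)\<bar>} \<le> \<delta>)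
      sequentially"
    using osc[OF \<eta> \<delta>, of T] by blast
  have "eventually (\<lambda>m. dist (\<integral>w. \<Phi> (grid_path m (grid_increment m (W w))) \<partial>M) (\<integral>w. \<Phi> (W w) \<partial>M) < \<epsilon> / 4) sequentially"
    using grid_expectation_tendsto \<epsilon> by (intro tendstoD) auto
  moreover have "eventually (\<lambda>m. max 1 (max m0 T) \<le> m) sequentially" by (rule eventually_ge_at_top)
  ultimately have "eventually (\<lambda>m. dist (\<integral>w. \<Phi> (grid_path m (grid_increment m (W w))) \<partial>M) (\<integral>w. \<Phi> (W w) \<partial>M) < \<epsilon> / 4
      \<and> max 1 (max m0 T) \<le> m) sequentially" by (rule eventually_conj)
  then obtain m where m: "dist (\<integral>w. \<Phi> (grid_path m (grid_increment m (W w))) \<partial>M) (\<integral>w. \<Phi> (W w) \<partial>M) < \<epsilon> / 4"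
      "max 1 (max m0 T) \<le> m"
    using eventually_happens'[OF sequentially_bot] by blast
  then have m': "0 < m" "m0 \<le> m" "T \<le> m" by auto
  have "eventually (\<lambda>N. dist (measure_pmf.expectation (P N) (\<lambda>x. \<Phi> (grid_path m (grid_increment m x))))
      (\<integral>w. \<Phi> (grid_path m (grid_increment m (W w))) \<partial>M) < \<epsilon> / 4) sequentially"
    using grid_fixed_tendsto[OF m'(1)] \<epsilon> by (intro tendstoD) auto
  then show "eventually (\<lambda>N. dist (measure_pmf.expectation (P N) \<Phi>) (\<integral>w. \<Phi> (W w) \<partial>M) < \<epsilon>) sequentially"
    using m0[OF m'(2)]
  proof eventually_elim
    case (elim N)
    have "r * (\<eta> + 1 / (1 + real T)) = r * \<eta> + r * (1 / (1 + real T))" by (rule distrib_left)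
    then have "\<bar>measure_pmf.expectation (P N) \<Phi> - measure_pmf.expectation (P N) (\<lambda>x. \<Phi> (grid_path m (grid_increment m x)))\<bar> \<le> \<epsilon> / 2"
      using grid_approx[OF elim(2) m'(3)] \<eta> b1 b2 b3 by linarith
    then show ?case using elim(1) m(1) unfolding dist_real_def by linarith
  qed
qed

end

text \<open>The constant of the minorant is fixed before \<open>N\<close> grows, so no uniformity in
  it is required. The bound is one-sided; \<open>functional_tendsto\<close> obtains the other side
  from \<open>- F\<close>.\<close>

lemma liminf_functional:
  fixes F :: "(real \<Rightarrow> real) \<Rightarrow> real"
  assumes F: "\<And>x. \<bar>F x\<bar> \<le> B" and cont: "ucc_continuous F"
    and meas: "(\<lambda>w. F (W w)) \<in> borel_measurable M" and \<epsilon>: "0 < \<epsilon>"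
  shows "eventually (\<lambda>N. (\<integral>w. F (W w) \<partial>M) - \<epsilon> < measure_pmf.expectation (P N) F) sequentially"
proof -
  have bd: "\<bar>lipschitz_minorant F (real i) x\<bar> \<le> B" for i x
    by (rule lipschitz_minorant_bounded[OF F]) simp
  have lip: "\<bar>lipschitz_minorant F (real i) x - lipschitz_minorant F (real i) y\<bar> \<le> real i * ucc_dist x y" for i x y
    by (rule lipschitz_minorant_lipschitz[OF F]) simp
  have "(\<lambda>i. \<integral>w. lipschitz_minorant F (real i) (W w) \<partial>M) \<longlonglongrightarrow> (\<integral>w. F (W w) \<partial>M)"
  proof (rule integral_dominated_convergence[where w = "\<lambda>_. B"])
    show "(\<lambda>w. lipschitz_minorant F (real i) (W w)) \<in> borel_measurable M" for i
      by (rule lipschitz_functional_measurable[OF lip]) (use bd in auto)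
  qed (auto intro!: AE_I2 lipschitz_minorant_tendsto[OF F cont] bd meas)
  from order_tendstoD(1)[OF this, of "(\<integral>w. F (W w) \<partial>M) - \<epsilon>"] \<epsilon>
  have "eventually (\<lambda>i. (\<integral>w. F (W w) \<partial>M) - \<epsilon> < (\<integral>w. lipschitz_minorant F (real i) (W w) \<partial>M)) sequentially" by simp
  then obtain i where i: "(\<integral>w. F (W w) \<partial>M) - \<epsilon> < (\<integral>w. lipschitz_minorant F (real i) (W w) \<partial>M)"
    using eventually_happens'[OF sequentially_bot] by blast
  have "(\<lambda>N. measure_pmf.expectation (P N) (lipschitz_minorant F (real i))) \<longlonglongrightarrow> (\<integral>w. lipschitz_minorant F (real i) (W w) \<partial>M)"
    by (rule lipschitz_functional_tendsto[OF lip _ bd]) simp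
  from order_tendstoD(1)[OF this i] show ?thesis
  proof eventually_elim
    case (elim N)
    have "measure_pmf.expectation (P N) (lipschitz_minorant F (real i)) \<le> measure_pmf.expectation (P N) F"
      using lipschitz_minorant_le_self[OF F, of "real i"] F bd
      by (intro integral_mono measure_pmf.integrable_const_bound[where B = B]) auto
    with elim show ?case by simp
  qed
qed

theorem functional_tendsto:
  fixes F :: "(real \<Rightarrow> real) \<Rightarrow> real"
  assumes F: "bounded (range F)" and cont: "ucc_continuous F"
    and meas: "(\<lambda>w. F (W w)) \<in> borel_measurable M"
  shows "(\<lambda>N. measure_pmf.expectation (P N) F) \<longlonglongrightarrow> (\<integral>w. F (W w) \<partial>M)"
proof -
  obtain B where B: "\<And>x. \<bar>F x\<bar> \<le> B" using F by (auto simp: bounded_iff)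
  have cont': "ucc_continuous (\<lambda>x. - F x)"
    using cont unfolding ucc_continuous_def by (simp add: abs_minus_commute)
  show ?thesis
  proof (rule tendstoI)
    fix \<epsilon> :: real assume \<epsilon>: "0 < \<epsilon>"
    have B': "\<And>x. \<bar>- F x\<bar> \<le> B" and meas': "(\<lambda>w. - F (W w)) \<in> borel_measurable M"
      using B meas by auto
    from liminf_functional[OF B cont meas \<epsilon>] liminf_functional[OF B' cont' meas' \<epsilon>]
    show "eventually (\<lambda>N. dist (measure_pmf.expectation (P N) F) (\<integral>w. F (W w) \<partial>M) < \<epsilon>) sequentially"
      by eventually_elim (simp add: dist_real_def abs_less_iff)
  qed
qed

end

section \<open>Convergence of the walk\<close>

text \<open>\<open>(q+1) * i^q\<close> lies between the differences of consecutive powers of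
  exponent \<open>q+1\<close> just before and just after \<open>i\<close>, by \<open>up\<close> and
  \<open>low\<close>. The shift of index in the comparison from below accounts for the correction
  \<open>(q+1) * n^q\<close>.\<close>

lemma sum_power_bounds:
  "real (q + 1) * (\<Sum>i<n. real i ^ q) \<le> real n ^ (q + 1)"
  "real n ^ (q + 1) \<le> real (q + 1) * (\<Sum>i<n. real i ^ q) + real (q + 1) * real n ^ q"
proof -
  have low: "x ^ (q + 1) + real (q + 1) * x ^ q \<le> (x + 1) ^ (q + 1)" if "0 \<le> x" for x :: real
  proof (induction q)
    case (Suc q)
    have "x ^ (Suc q + 1) + real (Suc q + 1) * x ^ Suc q \<le> (x + 1) * (x ^ (q + 1) + real (q + 1) * x ^ q)"
      using that by (simp add: algebra_simps)
    also have "\<dots> \<le> (x + 1) * (x + 1) ^ (q + 1)"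
      using Suc that by (intro mult_left_mono) auto
    finally show ?case by simp
  qed simp
  have up: "(x + 1) ^ (q + 1) - real (q + 1) * (x + 1) ^ q \<le> x ^ (q + 1)" if "0 \<le> x" for x :: real
  proof (induction q)
    case (Suc q)
    have "(x + 1) ^ (Suc q + 1) - real (Suc q + 1) * (x + 1) ^ Suc q
        \<le> x * ((x + 1) ^ (q + 1) - real (q + 1) * (x + 1) ^ q)"
      using that by (simp add: algebra_simps)
    also have "\<dots> \<le> x * x ^ (q + 1)" using Suc that by (intro mult_left_mono) auto
    finally show ?case by simp
  qed simp
  show "real (q + 1) * (\<Sum>i<n. real i ^ q) \<le> real n ^ (q + 1)"
  proof (induction n)
    case (Suc n)
    then show ?case using low[of "real n"] by (simp add: algebra_simps)
  qed simp
  show "real n ^ (q + 1) \<le> real (q + 1) * (\<Sum>i<n. real i ^ q) + real (q + 1) * real n ^ q"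
  proof (induction n)
    case (Suc n)
    then show ?case using up[of "real n"] by (simp add: algebra_simps)
  qed simp
qed

lemma floor_ratio_tendsto:
  fixes x :: "nat \<Rightarrow> real"
  assumes x: "filterlim x at_top sequentially" and t: "0 \<le> t"
  shows "(\<lambda>N. real (nat \<lfloor>x N * t\<rfloor>) / x N) \<longlonglongrightarrow> t"
proof (rule real_tendsto_sandwich)
  have ev: "eventually (\<lambda>N. 0 < x N) sequentially"
    using x by (simp add: filterlim_at_top_dense)
  have "(\<lambda>N. t - inverse (x N)) \<longlonglongrightarrow> t - 0"
    by (intro tendsto_intros tendsto_inverse_0_at_top x)
  then show "(\<lambda>N. t - inverse (x N)) \<longlonglongrightarrow> t" by simp
  show "(\<lambda>N. t) \<longlonglongrightarrow> t" by simp
  show "eventually (\<lambda>N. t - inverse (x N) \<le> real (nat \<lfloor>x N * t\<rfloor>) / x N) sequentially"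
    using ev
  proof eventually_elim
    case (elim N)
    have "x N * t - 1 \<le> real (nat \<lfloor>x N * t\<rfloor>)" by linarith
    then have "(x N * t - 1) / x N \<le> real (nat \<lfloor>x N * t\<rfloor>) / x N"
      using elim by (intro divide_right_mono) auto
    then show ?case using elim by (simp add: diff_divide_distrib inverse_eq_divide)
  qed
  show "eventually (\<lambda>N. real (nat \<lfloor>x N * t\<rfloor>) / x N \<le> t) sequentially"
    using ev
  proof eventually_elim
    case (elim N)
    then have "real (nat \<lfloor>x N * t\<rfloor>) \<le> x N * t" using t by (simp add: of_nat_floor)
    then show ?case using elim by (simp add: field_simps)
  qed
qed

text \<open>Discrete form of the integral of \<open>u^q\<close> over \<open>[0,t]\<close>; with
  \<open>q = k - 2\<close> it produces the drift \<open>t^(k-1) / (k-1)\<close>.\<close>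

lemma riemann_sum_power:
  fixes x :: "nat \<Rightarrow> real"
  assumes x: "filterlim x at_top sequentially" and t: "0 \<le> t"
  shows "(\<lambda>N. (\<Sum>i<nat \<lfloor>x N * t\<rfloor>. (real i / x N) ^ q) / x N) \<longlonglongrightarrow> t ^ (q + 1) / real (q + 1)"
proof -
  define y where "y N = real (nat \<lfloor>x N * t\<rfloor>) / x N" for N
  have y: "y \<longlonglongrightarrow> t" unfolding y_def by (rule floor_ratio_tendsto[OF x t])
  have ev: "eventually (\<lambda>N. 0 < x N) sequentially"
    using x by (simp add: filterlim_at_top_dense)
  have inv: "(\<lambda>N. inverse (x N)) \<longlonglongrightarrow> 0" by (rule tendsto_inverse_0_at_top[OF x])
  show ?thesis
  proof (rule real_tendsto_sandwich)
    have "(\<lambda>N. (y N ^ (q + 1) - real (q + 1) * y N ^ q * inverse (x N)) / real (q + 1))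
      \<longlonglongrightarrow> (t ^ (q + 1) - real (q + 1) * t ^ q * 0) / real (q + 1)"
      by (intro tendsto_intros y inv) auto
    then show "(\<lambda>N. (y N ^ (q + 1) - real (q + 1) * y N ^ q * inverse (x N)) / real (q + 1))
      \<longlonglongrightarrow> t ^ (q + 1) / real (q + 1)" by simp
    show "(\<lambda>N. y N ^ (q + 1) / real (q + 1)) \<longlonglongrightarrow> t ^ (q + 1) / real (q + 1)"
      by (intro tendsto_intros y) auto
    have eq: "(\<Sum>i<n. (real i / X) ^ q) / X = (\<Sum>i<n. real i ^ q) / X ^ (q + 1)" for n and X :: real
      by (simp add: power_divide sum_divide_distrib[symmetric])
    show "eventually (\<lambda>N. (y N ^ (q + 1) - real (q + 1) * y N ^ q * inverse (x N)) / real (q + 1)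
       \<le> (\<Sum>i<nat \<lfloor>x N * t\<rfloor>. (real i / x N) ^ q) / x N) sequentially"
      using ev
    proof eventually_elim
      case (elim N)
      let ?n = "nat \<lfloor>x N * t\<rfloor>"
      have "(y N ^ (q + 1) - real (q + 1) * y N ^ q * inverse (x N)) / real (q + 1)
         = (real ?n ^ (q + 1) - real (q + 1) * real ?n ^ q) / real (q + 1) / x N ^ (q + 1)"
        using elim by (simp add: y_def power_divide field_simps)
      also have "\<dots> \<le> (\<Sum>i<?n. real i ^ q) / x N ^ (q + 1)"
        using sum_power_bounds(2)[of ?n q] elim
        by (intro divide_right_mono) (auto simp: divide_simps algebra_simps)
      finally show ?case unfolding eq .
    qed
    show "eventually (\<lambda>N. (\<Sum>i<nat \<lfloor>x N * t\<rfloor>. (real i / x N) ^ q) / x N \<le> y N ^ (q + 1) / real (q + 1)) sequentially"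
      using ev
    proof eventually_elim
      case (elim N)
      let ?n = "nat \<lfloor>x N * t\<rfloor>"
      have "(\<Sum>i<?n. real i ^ q) / x N ^ (q + 1) \<le> real ?n ^ (q + 1) / real (q + 1) / x N ^ (q + 1)"
        using sum_power_bounds(1)[of q ?n] elim
        by (intro divide_right_mono) (auto simp: divide_simps algebra_simps)
      also have "\<dots> = y N ^ (q + 1) / real (q + 1)" by (simp add: y_def power_divide field_simps)
      finally show ?case unfolding eq .
    qed
  qed
qed

section \<open>Steps grouped into blocks, and Gaussian increments\<close>

lemma sum_lessThan_blocks:
  fixes f :: "nat \<Rightarrow> 'a :: comm_monoid_add" and l :: "nat \<Rightarrow> nat"
  assumes "\<And>j. l j \<le> l (Suc j)" "l 0 = 0"
  shows "(\<Sum>i<l J. f i) = (\<Sum>j<J. \<Sum>i=l j..<l (Suc j). f i)"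
proof (induction J)
  case (Suc J)
  have "(\<Sum>i<l (Suc J). f i) = (\<Sum>i<l J. f i) + (\<Sum>i=l J..<l (Suc J). f i)"
    unfolding lessThan_atLeast0 using assms(1)[of J] by (simp add: sum.atLeastLessThan_concat)
  with Suc show ?case by simp
qed (simp add: assms)

text \<open>Lets a linear combination of block increments be read as one weighted sum over single
  steps, the form required by \<open>chain_char\<close>.\<close>

definition block_weight :: "(nat \<Rightarrow> nat) \<Rightarrow> nat \<Rightarrow> (nat \<Rightarrow> real) \<Rightarrow> nat \<Rightarrow> real" where
  "block_weight l J \<theta> i = (\<Sum>j<J. if l j \<le> i \<and> i < l (Suc j) then \<theta> j else 0)"

lemma block_weight_bound: "\<bar>block_weight l J \<theta> i\<bar> \<le> (\<Sum>j<J. \<bar>\<theta> j\<bar>)"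
  unfolding block_weight_def by (rule order.trans[OF sum_abs]) (auto intro!: sum_mono)

lemma block_weight_eq:
  assumes mono: "\<And>i j. i \<le> j \<Longrightarrow> l i \<le> l j" and "j < J" "l j \<le> i" "i < l (Suc j)"
  shows "block_weight l J \<theta> i = \<theta> j"
proof -
  have "(if l j' \<le> i \<and> i < l (Suc j') then \<theta> j' else 0) = (if j' = j then \<theta> j else 0)" for j'
  proof (cases "j' = j")
    case False
    then consider "Suc j' \<le> j" | "Suc j \<le> j'" by linarith
    then have "\<not> (l j' \<le> i \<and> i < l (Suc j'))"
    proof cases
      case 1
      from mono[OF 1] assms(3) show ?thesis by linarith
    next
      case 2
      from mono[OF 2] assms(4) show ?thesis by linarith
    qed
    then show ?thesis using False by auto
  qed (use assms in simp)
  then show ?thesis unfolding block_weight_def using assms by simp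
qed

lemma (in prob_space) normal_char:
  assumes X: "distributed M lborel X (normal_density 0 \<sigma>)" and \<sigma>: "0 < \<sigma>"
  shows "(\<integral>w. iexp (\<theta> * X w) \<partial>M) = exp (of_real (- ((\<theta> * \<sigma>) ^ 2) / 2))"
proof -
  define Y where "Y w = (X w - 0) / \<sigma>" for w
  have D: "distributed M lborel Y std_normal_density"
    using X unfolding normal_standard_normal_convert[OF \<sigma>] Y_def by simp
  have Ym: "Y \<in> borel_measurable M" using distributed_measurable[OF D] by simp
  have "distr M lborel Y = std_normal_distribution"
    using distributed_distr_eq_density[OF D] by simp
  then have eq: "distr M borel Y = std_normal_distribution"
    by (metis distr_cong sets_lborel)
  have "(\<integral>w. iexp (\<theta> * X w) \<partial>M) = (\<integral>w. iexp ((\<theta> * \<sigma>) * Y w) \<partial>M)"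
    using \<sigma> by (simp add: Y_def)
  also have "\<dots> = char (distr M borel Y) (\<theta> * \<sigma>)"
    unfolding char_def by (subst integral_distr) (use Ym in auto)
  also have "\<dots> = exp (of_real (- ((\<theta> * \<sigma>) ^ 2) / 2))"
    unfolding eq by (simp only: char_std_normal_distribution exp_of_real)
  finally show ?thesis .
qed

lemma BM_char:
  fixes t :: "nat \<Rightarrow> real"
  assumes BM: "standard_BM M B" and t: "0 \<le> t 0" "\<And>j. j < n \<Longrightarrow> t j < t (Suc j)"
  shows "(\<integral>w. iexp (\<Sum>j<n. \<theta> j * (B w (t (Suc j)) - B w (t j))) \<partial>M)
    = exp (of_real (- (\<Sum>j<n. (\<theta> j) ^ 2 * (t (Suc j) - t j)) / 2))"
proof -
  interpret prob_space M using BM by (simp add: standard_BM_def)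
  have tge: "0 \<le> t j" if "j \<le> n" for j
    using that
  proof (induction j)
    case (Suc j)
    then show ?case using t(2)[of j] by linarith
  qed (use t in simp)
  have "\<forall>n ts. 0 \<le> ts 0 \<and> (\<forall>i<n. ts i < ts (Suc i)) \<longrightarrow>
      indep_vars (\<lambda>_. borel) (\<lambda>i w. B w (ts (Suc i)) - B w (ts i)) {..<n}"
    using BM unfolding standard_BM_def by blast
  then have ind: "indep_vars (\<lambda>_. borel) (\<lambda>i w. B w (t (Suc i)) - B w (t i)) {..<n}"
    using t by blast
  have ind2: "indep_vars (\<lambda>_. borel) (\<lambda>j w. iexp (\<theta> j * (B w (t (Suc j)) - B w (t j)))) {..<n}"
    by (rule indep_vars_compose2[OF ind]) simp
  have Bm: "(\<lambda>w. B w u) \<in> borel_measurable M" for u using BM unfolding standard_BM_def by blast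
  have "(\<integral>w. iexp (\<Sum>j<n. \<theta> j * (B w (t (Suc j)) - B w (t j))) \<partial>M)
      = (\<integral>w. (\<Prod>j<n. iexp (\<theta> j * (B w (t (Suc j)) - B w (t j)))) \<partial>M)"
    by (simp add: exp_sum sum_distrib_left)
  also have "\<dots> = (\<Prod>j<n. \<integral>w. iexp (\<theta> j * (B w (t (Suc j)) - B w (t j))) \<partial>M)"
  proof (rule indep_vars_lebesgue_integral[OF _ ind2])
    show "integrable M (\<lambda>w. iexp (\<theta> j * (B w (t (Suc j)) - B w (t j))))" for j
      using Bm by (intro integrable_const_bound[where B = 1]) auto
  qed simp
  also have "\<dots> = (\<Prod>j<n. exp (of_real (- ((\<theta> j * sqrt (t (Suc j) - t j)) ^ 2) / 2)))"
  proof (intro prod.cong refl normal_char)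
    fix j assume "j \<in> {..<n}"
    then have j: "j < n" by simp
    have "\<forall>s t. 0 \<le> s \<and> s < t \<longrightarrow> distributed M lborel (\<lambda>w. B w t - B w s) (normal_density 0 (sqrt (t - s)))"
      using BM unfolding standard_BM_def by blast
    then show "distributed M lborel (\<lambda>w. B w (t (Suc j)) - B w (t j)) (normal_density 0 (sqrt (t (Suc j) - t j)))"
      using tge[of j] t(2)[OF j] j by simp
    show "0 < sqrt (t (Suc j) - t j)" using t(2)[OF j] by simp
  qed
  also have "\<dots> = (\<Prod>j<n. exp (of_real (- ((\<theta> j) ^ 2 * (t (Suc j) - t j)) / 2)))"
  proof (intro prod.cong refl)
    fix j assume "j \<in> {..<n}"
    then have "0 \<le> t (Suc j) - t j" using t(2)[of j] by simp
    then have "(\<theta> j * sqrt (t (Suc j) - t j)) ^ 2 = (\<theta> j) ^ 2 * (t (Suc j) - t j)"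
      by (simp only: power_mult_distrib real_sqrt_pow2)
    then show "exp (complex_of_real (- ((\<theta> j * sqrt (t (Suc j) - t j)) ^ 2) / 2))
        = exp (of_real (- ((\<theta> j) ^ 2 * (t (Suc j) - t j)) / 2))" by (simp only:)
  qed
  also have "\<dots> = exp (of_real (- (\<Sum>j<n. (\<theta> j) ^ 2 * (t (Suc j) - t j)) / 2))"
    by (simp add: exp_sum[symmetric] sum_negf[symmetric] sum_divide_distrib)
  finally show ?thesis .
qed

section \<open>The rescaled walk as a near-critical chain\<close>

lemma bfs_walk_real:
  assumes "j \<le> n" "n \<le> N"
  shows "real_of_int (bfs_walk H N j) = walk (bfs_history H N n) j"
  using bfs_walk_history[OF assms, of H] by (simp add: walk_def)

definition history_path :: "nat \<Rightarrow> real \<Rightarrow> nat list \<Rightarrow> real \<Rightarrow> real" where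
  "history_path N a cs t = real N powr (- a / 2) * walk cs (nat \<lfloor>real N powr a * t\<rfloor>)"

lemma rescaled_walk_history:
  assumes "nat \<lfloor>real N powr a * T\<rfloor> \<le> N" "t \<le> T"
  shows "rescaled_walk N a H t = history_path N a (bfs_history H N (nat \<lfloor>real N powr a * T\<rfloor>)) t"
proof -
  have "nat \<lfloor>real N powr a * t\<rfloor> \<le> nat \<lfloor>real N powr a * T\<rfloor>"
    using assms(2) by (intro nat_mono floor_mono mult_left_mono) auto
  from bfs_walk_real[OF this assms(1)] show ?thesis
    by (simp add: rescaled_walk_def history_path_def)
qed

text \<open>A functional that reads the path only up to time \<open>T\<close> sees only the first
  \<open>N^alpha * T\<close> steps, and while these number at most \<open>N\<close> their law is
  that of the chain.\<close>

lemma rescaled_walk_law_history: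
  assumes nonneg: "\<forall>j\<ge>2. 0 \<le> \<beta> j" and n: "nat \<lfloor>real N powr alpha k * T\<rfloor> \<le> N"
    and f: "\<And>x y. (\<And>t. 0 \<le> t \<Longrightarrow> t \<le> T \<Longrightarrow> x t = y t) \<Longrightarrow> f x = f y"
  shows "map_pmf f (rescaled_walk_law \<beta> k N) =
    map_pmf (\<lambda>cs. f (history_path N (alpha k) cs))
      (history_pmf (bfs_kernel \<beta> N) (nat \<lfloor>real N powr alpha k * T\<rfloor>))"
  unfolding bfs_history_law[OF nonneg n, symmetric] rescaled_walk_law_def pmf.map_comp
  by (intro map_pmf_cong refl) (auto intro!: f rescaled_walk_history[OF n])

lemma powr_nat_power: "0 < x \<Longrightarrow> (x powr b) ^ m = (x :: real) powr (b * real m)"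
  using powr_powr[of x b "real m"] by (simp add: powr_realpow)

text \<open>The third identity is the balance behind \<open>alpha\<close>: a drift
  \<open>(i/N)^(k-2)\<close> at times of order \<open>N^alpha\<close> has the size of the scaling
  factor \<open>N^(-alpha/2)\<close>.\<close>

lemma alpha_bounds:
  assumes "3 \<le> k"
  shows "0 < alpha k" "alpha k < 1" "(1 - alpha k) * real (k - 2) = alpha k / 2"
proof -
  have k: "3 \<le> real k" "real (k - 2) = real k - 2" using assms by auto
  then show "0 < alpha k" "alpha k < 1" "(1 - alpha k) * real (k - 2) = alpha k / 2"
    unfolding alpha_def by (auto simp: divide_simps) (auto simp: algebra_simps)
qed

lemma filterlim_powr_nat:
  assumes "0 < (a :: real)"
  shows "filterlim (\<lambda>N. real N powr a) at_top sequentially"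
  using filterlim_compose[OF real_powr_at_top[OF assms] filterlim_real_sequentially] by simp

lemma powr_nat_tendsto_0:
  assumes "(a :: real) < 0"
  shows "(\<lambda>N. real N powr a) \<longlonglongrightarrow> 0"
  by (rule tendsto_neg_powr[OF assms filterlim_real_sequentially])

text \<open>The error of \<open>bfs_prob_expansion\<close> divided by the scaling factor
  \<open>N^(-alpha/2)\<close>, with \<open>i\<close> replaced by its largest value
  \<open>N^alpha * T\<close>.\<close>

definition drift_error :: "real \<Rightarrow> nat \<Rightarrow> real \<Rightarrow> nat \<Rightarrow> real" where
  "drift_error C k T N = C * (real N powr (alpha k / 2 - 1) + T ^ (k - 1) * real N powr (alpha k - 1))"

lemma drift_error_tendsto:
  assumes "3 \<le> k"
  shows "drift_error C k T \<longlonglongrightarrow> 0"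
proof -
  have "(\<lambda>N. C * (real N powr (alpha k / 2 - 1) + T ^ (k - 1) * real N powr (alpha k - 1)))
     \<longlonglongrightarrow> C * (0 + T ^ (k - 1) * 0)"
    using alpha_bounds[OF assms] by (intro tendsto_intros powr_nat_tendsto_0) auto
  then show ?thesis unfolding drift_error_def by simp
qed

text \<open>The mean for an empty queue is given by \<open>bfs_prob_expansion\<close>, and a queue
  of length \<open>q\<close> lowers it by at most \<open>q * C / N\<close>. One \<open>C\<close>
  serves all horizons; only how large \<open>N\<close> must be depends on \<open>T\<close>.\<close>

lemma bfs_near_critical:
  fixes \<beta> :: "nat \<Rightarrow> real"
  assumes nonneg: "\<forall>j\<ge>2. 0 \<le> \<beta> j"
    and deriv_finite: "summable (\<lambda>j. real j * \<beta> j)"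
    and k3: "3 \<le> k"
    and crit: "\<forall>j. 2 \<le> j \<and> j \<le> k - 1 \<longrightarrow> \<beta> j = 1 / (real j * (real j - 1))"
  obtains C where "0 < C"
    "\<And>T. 0 \<le> T \<Longrightarrow> eventually (\<lambda>N. nat \<lfloor>real N powr alpha k * T\<rfloor> \<le> N \<and>
      near_critical_chain (bfs_kernel \<beta> N) (\<lambda>cs. N - Suc (length cs) - queue cs) (bfs_prob \<beta> N)
        (\<lambda>i. mu \<beta> k * (real i / real N powr alpha k) ^ (k - 2)) (nat \<lfloor>real N powr alpha k * T\<rfloor>)
        (real N powr (- alpha k / 2)) (C / real N) (drift_error C k T N) (\<bar>mu \<beta> k\<bar> * T ^ (k - 2)) T) sequentially"
proof -
  obtain C where C: "0 < C"
    and drift: "\<And>N i. 2 * k + 2 \<le> N \<Longrightarrow> 2 * i + 2 \<le> N \<Longrightarrow>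
      \<bar>(real N - 1 - real i) * bfs_prob \<beta> N i - 1 - mu \<beta> k * (real i / real N) ^ (k - 2)\<bar>
        \<le> C * (1 / real N + (real i / real N) ^ (k - 1))"
    and prob: "\<And>N i. 2 * k + 2 \<le> N \<Longrightarrow> 2 * i + 2 \<le> N \<Longrightarrow> bfs_prob \<beta> N i \<le> C / real N"
    using bfs_prob_expansion[OF assms] by blast
  define a where "a = alpha k"
  have a: "0 < a" "a < 1" "(1 - a) * real (k - 2) = a / 2" unfolding a_def by (rule alpha_bounds[OF k3])+
  show ?thesis
  proof (rule that[OF C])
    fix T :: real assume T: "0 \<le> T"
    have "(\<lambda>N. real N powr (a - 1) * T) \<longlonglongrightarrow> 0 * T"
      using a by (intro tendsto_intros powr_nat_tendsto_0) auto
    then have "(\<lambda>N. real N powr (a - 1) * T) \<longlonglongrightarrow> 0" by simp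
    \<comment> \<open>The value \<open>1/4\<close> yields \<open>4 * n \<le> N\<close>, so that
      every step satisfies \<open>2 * i + 2 \<le> N\<close>, the range of the expansion.\<close>
    then have e1: "eventually (\<lambda>N. real N powr (a - 1) * T < 1 / 4) sequentially"
      by (rule order_tendstoD) simp
    have e2: "eventually (\<lambda>N. drift_error C k T N < 1) sequentially"
      using drift_error_tendsto[OF k3] by (rule order_tendstoD) simp
    have e3: "eventually (\<lambda>N. max 4 (2 * k + 2) \<le> N) sequentially" by (rule eventually_ge_at_top)
    from e1 e2 e3 show "eventually (\<lambda>N. nat \<lfloor>real N powr alpha k * T\<rfloor> \<le> N \<and>
      near_critical_chain (bfs_kernel \<beta> N) (\<lambda>cs. N - Suc (length cs) - queue cs) (bfs_prob \<beta> N)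
        (\<lambda>i. mu \<beta> k * (real i / real N powr alpha k) ^ (k - 2)) (nat \<lfloor>real N powr alpha k * T\<rfloor>)
        (real N powr (- alpha k / 2)) (C / real N) (drift_error C k T N) (\<bar>mu \<beta> k\<bar> * T ^ (k - 2)) T) sequentially"
      unfolding a_def[symmetric]
    proof eventually_elim
      case (elim N)
      define X where "X = real N"
      define s where "s = X powr (- a / 2)"
      define n where "n = nat \<lfloor>X powr a * T\<rfloor>"
      define e where "e = drift_error C k T N"
      define m where "m = mu \<beta> k"
      define D where "D = \<bar>m\<bar> * T ^ (k - 2)"
      define d where "d i = m * (real i / X powr a) ^ (k - 2)" for i
      have N: "4 \<le> N" "2 * k + 2 \<le> N" and X: "4 \<le> X" "0 < X" using elim(3) by (auto simp: X_def)
      have s: "0 < s" "s \<le> 1"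
        using X a powr_mono[of "- a / 2" 0 X] by (auto simp: s_def)
      have s2: "s ^ 2 = X powr (- a)" using X by (simp add: s_def powr_nat_power)
      have n_le: "real n \<le> X powr a * T"
        using T by (simp add: n_def of_nat_floor)
      have "X powr a * T = X * (X powr (a - 1) * T)" using X by (simp add: powr_diff)
      also have "\<dots> \<le> X * (1 / 4)" using elim(1) X by (intro mult_left_mono) (auto simp: X_def)
      finally have nX: "real n \<le> X / 4" using n_le by simp
      then have nN: "4 * n \<le> N" by (simp add: X_def)
      have ratio: "0 \<le> real i / X powr a" "real i / X powr a \<le> T" if "i < n" for i
        using that n_le X by (auto simp: divide_simps mult.commute)
      have d: "\<bar>d i\<bar> \<le> D" if "i < n" for i
        unfolding d_def D_def abs_mult power_abs using ratio[OF that] by (intro mult_left_mono power_mono) auto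
      have D0: "0 \<le> D" using T by (simp add: D_def)
      have e0: "0 \<le> e" using C T by (simp add: e_def drift_error_def)
      have e1: "e \<le> 1" using elim(2) by (simp add: e_def)
      have split: "real i / X = (real i / X powr a) * X powr (a - 1)" for i
        using X by (simp add: powr_diff)
      \<comment> \<open>The balance identity makes this factor exactly \<open>s\<close>, so that
        \<open>s * d i\<close> equals the drift \<open>m * (i/X)^(k-2)\<close> without
        remainder.\<close>
      have pw: "(X powr (a - 1)) ^ (k - 2) = s"
      proof -
        have "(a - 1) * real (k - 2) = - a / 2" using a(3) by (simp add: algebra_simps)
        then show ?thesis using X by (simp only: powr_nat_power s_def)
      qed
      have main: "\<bar>(X - 1 - real i) * bfs_prob \<beta> N i - 1 - s * d i\<bar> \<le> e * s" if i: "i < n" for i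
      proof -
        have i2: "2 * i + 2 \<le> N" using i nN N by linarith
        have sd: "s * d i = m * (real i / X) ^ (k - 2)"
          unfolding split d_def power_mult_distrib pw by simp
        have k1: "k - 1 = Suc (k - 2)" using k3 by simp
        have "(real i / X) ^ (k - 1) \<le> (T * X powr (a - 1)) ^ (k - 1)"
          unfolding split using ratio[OF i] by (intro power_mono mult_right_mono) auto
        also have "\<dots> = T ^ (k - 1) * X powr (a - 1) * s"
        proof -
          have "(X powr (a - 1)) ^ (k - 1) = X powr (a - 1) * s"
            unfolding k1 power_Suc pw ..
          then show ?thesis by (simp only: power_mult_distrib mult.assoc)
        qed
        finally have q: "(real i / X) ^ (k - 1) \<le> T ^ (k - 1) * X powr (a - 1) * s" .
        have "X powr (a / 2 - 1) * s = X powr ((a / 2 - 1) + (- a / 2))"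
          unfolding s_def by (rule powr_add[symmetric])
        also have "(a / 2 - 1) + (- a / 2) = - 1" by simp
        also have "X powr (- 1) = 1 / X" using X by (simp add: powr_minus_divide)
        finally have "1 / X = X powr (a / 2 - 1) * s" by simp
        with q have "1 / X + (real i / X) ^ (k - 1) \<le> (X powr (a / 2 - 1) + T ^ (k - 1) * X powr (a - 1)) * s"
          by (simp only: distrib_right)
        then have "C * (1 / X + (real i / X) ^ (k - 1)) \<le> C * ((X powr (a / 2 - 1) + T ^ (k - 1) * X powr (a - 1)) * s)"
          using C by (intro mult_left_mono) auto
        then show ?thesis
          using drift[OF N(2) i2] unfolding sd by (simp add: X_def m_def e_def drift_error_def a_def mult_ac)
      qed
      define r where "r = C / X"
      have r0: "0 \<le> r" using C X by (simp add: r_def)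
      have p_le: "bfs_prob \<beta> N i \<le> r" if "i < n" for i
        using prob[OF N(2), of i] that nN N by (simp add: X_def r_def)
      note p = bfs_prob_bounds[OF nonneg]
      \<comment> \<open>Truncated subtraction can only raise the number of available vertices above
        \<open>X - 1 - i - q\<close>, so the lower bound survives; for the upper bound,
        \<open>i < n\<close> keeps \<open>X - 1 - i\<close> nonnegative.\<close>
      have mean: "real (N - Suc i - q) * bfs_prob \<beta> N i \<le> (X - 1 - real i) * bfs_prob \<beta> N i"
        "(X - 1 - real i) * bfs_prob \<beta> N i - r * real q \<le> real (N - Suc i - q) * bfs_prob \<beta> N i"
        if i: "i < n" for i q
      proof -
        have "real (N - Suc i - q) \<le> X - 1 - real i" using i nN by (auto simp: X_def)
        then show "real (N - Suc i - q) * bfs_prob \<beta> N i \<le> (X - 1 - real i) * bfs_prob \<beta> N i"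
          using p by (intro mult_right_mono) auto
        have "X - 1 - real i - real q \<le> real (N - Suc i - q)" by (auto simp: X_def)
        then have "(X - 1 - real i - real q) * bfs_prob \<beta> N i \<le> real (N - Suc i - q) * bfs_prob \<beta> N i"
          using p by (intro mult_right_mono) auto
        moreover have "bfs_prob \<beta> N i * real q \<le> r * real q"
          using p_le[OF i] by (intro mult_right_mono) auto
        moreover have "L - c \<le> R" if "(Y - Q) * b \<le> R" "b * Q \<le> c" "Y * b = L" for L c R Y Q b :: real
          using that by (simp add: algebra_simps)
        ultimately show "(X - 1 - real i) * bfs_prob \<beta> N i - r * real q \<le> real (N - Suc i - q) * bfs_prob \<beta> N i"
          by blast
      qed
      have "near_critical_chain (bfs_kernel \<beta> N) (\<lambda>cs. N - Suc (length cs) - queue cs) (bfs_prob \<beta> N) d n s (r) e D T"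
      proof
        show "bfs_kernel \<beta> N cs = binomial_pmf (N - Suc (length cs) - queue cs) (bfs_prob \<beta> N (length cs))" for cs
          by (rule bfs_kernel_def)
        show "\<bar>real (N - Suc (length cs) - queue cs) * bfs_prob \<beta> N (length cs) - 1 - s * d (length cs)\<bar>
            \<le> e * s + r * real (queue cs)" if l: "length cs < n" for cs
        proof -
          have "0 \<le> r * real (queue cs)" using r0 by simp
          then show ?thesis using main[OF l] mean[OF l, of "queue cs"] by linarith
        qed
        show "real (N - Suc (length cs) - queue cs) * bfs_prob \<beta> N (length cs) \<le> 1 + (D + 1) * s"
          if l: "length cs < n" for cs
        proof -
          have "s * d (length cs) \<le> s * D" using d[OF l] s by (intro mult_left_mono) auto
          moreover have "e * s \<le> 1 * s" using e1 s by (intro mult_right_mono) auto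
          moreover have "(D + 1) * s = s * D + 1 * s" by (simp add: algebra_simps)
          ultimately show ?thesis using main[OF l] mean(1)[OF l, of "queue cs"] by linarith
        qed
        have "real n * s ^ 2 \<le> (X powr a * T) * X powr (- a)"
          unfolding s2 using n_le by (intro mult_right_mono) auto
        also have "\<dots> = T" using X by (simp add: powr_minus field_simps)
        finally show "real n * s ^ 2 \<le> T" .
      qed (use p p_le s r0 e0 e1 D0 d in auto)
      moreover have "n \<le> N" using nN by simp
      ultimately show ?case
        unfolding n_def s_def e_def D_def d_def m_def r_def X_def by (simp only:)
    qed
  qed
qed

lemma grid_floor_mono:
  fixes x :: real
  assumes "0 \<le> x" "i \<le> j"
  shows "nat \<lfloor>x * (real i / real m)\<rfloor> \<le> nat \<lfloor>x * (real j / real m)\<rfloor>"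
  using assms by (intro nat_mono floor_mono mult_left_mono divide_right_mono) auto

lemma sum_block_weight:
  fixes f :: "real \<Rightarrow> nat \<Rightarrow> 'b :: comm_monoid_add"
  assumes mono: "\<And>i j. i \<le> j \<Longrightarrow> l i \<le> l j" and "l 0 = 0"
  shows "(\<Sum>i<l J. f (block_weight l J \<theta> i) i) = (\<Sum>j<J. \<Sum>i=l j..<l (Suc j). f (\<theta> j) i)"
proof -
  have "(\<Sum>i<l J. f (block_weight l J \<theta> i) i) = (\<Sum>j<J. \<Sum>i=l j..<l (Suc j). f (block_weight l J \<theta> i) i)"
    by (rule sum_lessThan_blocks) (use assms in auto)
  also have "\<dots> = (\<Sum>j<J. \<Sum>i=l j..<l (Suc j). f (\<theta> j) i)"
    by (intro sum.cong refl arg_cong2[where f = f] block_weight_eq mono) auto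
  finally show ?thesis .
qed

lemma sum_atLeastLessThan_diff:
  fixes f :: "nat \<Rightarrow> real"
  assumes "a \<le> b"
  shows "(\<Sum>i=a..<b. f i) = (\<Sum>i<b. f i) - (\<Sum>i<a. f i)"
  using sum_diff_nat_ivl[of 0 a b f] assms by (simp add: lessThan_atLeast0)

section \<open>Limits on the grid and oscillation of the rescaled walk\<close>

locale critical_hypergraph =
  fixes \<beta> :: "nat \<Rightarrow> real" and k :: nat and C :: real
  assumes nonneg: "\<forall>j\<ge>2. 0 \<le> \<beta> j"
    and k3: "3 \<le> k"
    and near_critical: "\<And>T. 0 \<le> T \<Longrightarrow> eventually (\<lambda>N. nat \<lfloor>real N powr alpha k * T\<rfloor> \<le> N \<and>
      near_critical_chain (bfs_kernel \<beta> N) (\<lambda>cs. N - Suc (length cs) - queue cs) (bfs_prob \<beta> N)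
        (\<lambda>i. mu \<beta> k * (real i / real N powr alpha k) ^ (k - 2)) (nat \<lfloor>real N powr alpha k * T\<rfloor>)
        (real N powr (- alpha k / 2)) (C / real N) (drift_error C k T N) (\<bar>mu \<beta> k\<bar> * T ^ (k - 2)) T) sequentially"
begin

abbreviation "a \<equiv> alpha k"
abbreviation "\<mu> \<equiv> mu \<beta> k"
abbreviation sc :: "nat \<Rightarrow> real" where "sc N \<equiv> real N powr (- a / 2)"
abbreviation law :: "nat \<Rightarrow> (real \<Rightarrow> real) pmf" where "law N \<equiv> rescaled_walk_law \<beta> k N"

definition drift :: "real \<Rightarrow> real" where
  "drift t = \<mu> / (real k - 1) * t ^ (k - 1)"

lemmas a = alpha_bounds[OF k3]

lemma scale_tendsto: "sc \<longlonglongrightarrow> 0"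
  using a by (intro powr_nat_tendsto_0) auto

lemma scale_square: "0 < N \<Longrightarrow> (sc N) ^ 2 = real N powr (- a)"
  by (simp add: powr_nat_power)

text \<open>This is \<open>r / s^2\<close>, the factor with which the queue enters
  \<open>chain_char\<close> and \<open>excursion\<close>; it equals \<open>C * N^(alpha-1)\<close>,
  and \<open>alpha < 1\<close>.\<close>

lemma ratio_tendsto: "(\<lambda>N. C / real N / (sc N) ^ 2) \<longlonglongrightarrow> 0"
proof -
  have "(\<lambda>N. C * real N powr (a - 1)) \<longlonglongrightarrow> C * 0"
    using a by (intro tendsto_intros powr_nat_tendsto_0) auto
  then have lim: "(\<lambda>N. C * real N powr (a - 1)) \<longlonglongrightarrow> 0" by simp
  have "eventually (\<lambda>N. C * real N powr (a - 1) = C / real N / (sc N) ^ 2) sequentially"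
    using eventually_gt_at_top[of 0]
  proof eventually_elim
    case (elim N)
    then have "0 < real N" by simp
    then have e: "real N powr (a - 1) = real N powr a / real N" "real N powr (- a) = 1 / real N powr a"
      by (simp_all only: powr_diff powr_minus_divide) simp
    show ?case unfolding scale_square[OF elim] e by simp
  qed
  with lim show ?thesis by (rule Lim_transform_eventually)
qed

text \<open>Grid times are rounded to integer steps \<open>l N j\<close>, and the increments become
  one weighted sum over steps. The product of the Gaussian factors is then exactly
  \<open>target N\<close>, whose exponent consists of rounded block lengths and Riemann sums, and
  these converge.\<close>

lemma grid_law_char:
  fixes \<theta> :: "nat \<Rightarrow> real"
  assumes m: "0 < m"
  shows "(\<lambda>N. measure_pmf.expectation (law N) (\<lambda>x. iexp (\<Sum>j<m * m. \<theta> j * grid_increment m x j)))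
    \<longlonglongrightarrow> exp (of_real (- (\<Sum>j<m * m. (\<theta> j) ^ 2 * (real (Suc j) / real m - real j / real m)) / 2)
          + \<i> * of_real (\<Sum>j<m * m. \<theta> j * (drift (real (Suc j) / real m) - drift (real j / real m))))"
proof -
  define J where "J = m * m"
  define T where "T = real m"
  define x where "x N = real N powr a" for N
  define l where "l N j = nat \<lfloor>x N * (real j / real m)\<rfloor>" for N j
  define w where "w N = block_weight (l N) J \<theta>" for N
  define \<Theta> where "\<Theta> = 1 + (\<Sum>j<J. \<bar>\<theta> j\<bar>)"
  define D where "D = \<bar>\<mu>\<bar> * T ^ (k - 2)"
  \<comment> \<open>The constant \<open>G\<close> of the chain depends on \<open>D\<close> and
    \<open>T\<close> only, hence not on \<open>N\<close>.\<close>
  define Gc where "Gc = near_critical_chain.G D T"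
  define S where "S N j = (\<Sum>i<l N j. (real i / x N) ^ (k - 2)) / x N" for N j
  define target where "target N = exp (of_real (- (\<Sum>j<J. (\<theta> j) ^ 2 * (real (l N (Suc j)) / x N - real (l N j) / x N)) / 2)
     + \<i> * of_real (\<Sum>j<J. \<theta> j * (\<mu> * (S N (Suc j) - S N j))))" for N
  define bound where "bound N = \<Theta> ^ 3 * T * ((2 * D + 3) * (drift_error C k T N + sc N + C / real N) + 2 * Gc * (C / real N / (sc N) ^ 2))" for N
  have T: "0 \<le> T" and Jm: "real J / real m = T" using m by (simp_all add: T_def J_def)
  have \<Theta>: "1 \<le> \<Theta>" by (simp add: \<Theta>_def sum_nonneg)
  have l_mono: "l N i \<le> l N j" if "i \<le> j" for N i j
    unfolding l_def x_def by (rule grid_floor_mono[OF _ that]) simp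
  have l0: "l N 0 = 0" for N by (simp add: l_def)
  have lJ: "l N J = nat \<lfloor>real N powr a * T\<rfloor>" for N by (simp add: l_def Jm x_def)
  let ?f = "\<lambda>y :: real \<Rightarrow> real. iexp (\<Sum>j<J. \<theta> j * grid_increment m y j)"
  have close: "eventually (\<lambda>N. cmod (measure_pmf.expectation (law N) ?f - target N) \<le> bound N) sequentially"
    using near_critical[OF T] eventually_gt_at_top[of 0]
  proof eventually_elim
    case (elim N)
    then have nN: "nat \<lfloor>real N powr a * T\<rfloor> \<le> N" and N: "0 < N" by simp_all
    interpret near_critical_chain "bfs_kernel \<beta> N" "\<lambda>cs. N - Suc (length cs) - queue cs" "bfs_prob \<beta> N"
        "\<lambda>i. \<mu> * (real i / real N powr a) ^ (k - 2)" "nat \<lfloor>real N powr a * T\<rfloor>"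
        "sc N" "C / real N" "drift_error C k T N" "\<bar>\<mu>\<bar> * T ^ (k - 2)" T
      using elim by blast
    have xN: "0 < x N" using N by (simp add: x_def)
    have s2: "(sc N) ^ 2 = inverse (x N)" unfolding scale_square[OF N] x_def by (rule powr_minus)
    have "?f y = ?f z" if "\<And>t. 0 \<le> t \<Longrightarrow> t \<le> T \<Longrightarrow> y t = z t" for y z
    proof -
      have "grid_increment m y j = grid_increment m z j" if "j < J" for j
      proof -
        have "real (Suc j) / real m \<le> real J / real m" "real j / real m \<le> real J / real m"
          using that by (auto intro!: divide_right_mono)
        then show ?thesis unfolding grid_increment_def Jm
          by (intro arg_cong2[where f = "(-)"] \<open>\<And>t. 0 \<le> t \<Longrightarrow> t \<le> T \<Longrightarrow> y t = z t\<close>) auto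
      qed
      then show ?thesis by simp
    qed
    from rescaled_walk_law_history[OF nonneg nN this]
    have "measure_pmf.expectation (map_pmf ?f (law N)) (\<lambda>z. z) =
       measure_pmf.expectation (map_pmf (\<lambda>cs. ?f (history_path N a cs)) (history_pmf (bfs_kernel \<beta> N) (l N J))) (\<lambda>z. z)"
      unfolding lJ by (rule arg_cong)
    then have "measure_pmf.expectation (law N) ?f = expect (l N J) (\<lambda>cs. ?f (history_path N a cs))" by simp
    also have "(\<lambda>cs. ?f (history_path N a cs)) = (\<lambda>cs. iexp (\<Sum>i<l N J. w N i * sc N * (real (cs ! i) - 1)))"
    proof
      fix cs :: "nat list"
      have "(\<Sum>i<l N J. w N i * sc N * (real (cs ! i) - 1))
          = (\<Sum>j<J. \<Sum>i=l N j..<l N (Suc j). \<theta> j * sc N * (real (cs ! i) - 1))"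
        unfolding w_def by (rule sum_block_weight[where l = "l N" and f = "\<lambda>t i. t * sc N * (real (cs ! i) - 1)", OF l_mono l0])
      also have "\<dots> = (\<Sum>j<J. \<theta> j * grid_increment m (history_path N a cs) j)"
      proof (rule sum.cong[OF refl])
        fix j
        have "(\<Sum>i=l N j..<l N (Suc j). \<theta> j * sc N * (real (cs ! i) - 1))
           = \<theta> j * sc N * (walk cs (l N (Suc j)) - walk cs (l N j))"
          unfolding sum_distrib_left[symmetric] walk_def using l_mono[of j "Suc j" N]
          by (subst sum_atLeastLessThan_diff) auto
        also have "\<dots> = \<theta> j * grid_increment m (history_path N a cs) j"
          by (simp add: grid_increment_def history_path_def l_def x_def right_diff_distrib)
        finally show "(\<Sum>i=l N j..<l N (Suc j). \<theta> j * sc N * (real (cs ! i) - 1))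
           = \<theta> j * grid_increment m (history_path N a cs) j" .
      qed
      finally show "?f (history_path N a cs) = iexp (\<Sum>i<l N J. w N i * sc N * (real (cs ! i) - 1))" by simp
    qed
    finally have E: "measure_pmf.expectation (law N) ?f
        = expect (l N J) (\<lambda>cs. iexp (\<Sum>i<l N J. w N i * sc N * (real (cs ! i) - 1)))" .
    have "(\<Prod>i<l N J. psi (w N i) i) = target N"
    proof -
      have "(\<Sum>i<l N J. (w N i * sc N) ^ 2) = (\<Sum>j<J. \<Sum>i=l N j..<l N (Suc j). (\<theta> j * sc N) ^ 2)"
        unfolding w_def by (rule sum_block_weight[where l = "l N" and f = "\<lambda>t i. (t * sc N) ^ 2", OF l_mono l0])
      also have "\<dots> = (\<Sum>j<J. (\<theta> j) ^ 2 * (real (l N (Suc j)) / x N - real (l N j) / x N))"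
      proof (rule sum.cong[OF refl])
        fix j
        have "(\<Sum>i=l N j..<l N (Suc j). (\<theta> j * sc N) ^ 2) = (real (l N (Suc j)) - real (l N j)) * ((\<theta> j) ^ 2 * inverse (x N))"
          unfolding power_mult_distrib s2 using l_mono[of j "Suc j" N] by (simp add: of_nat_diff)
        then show "(\<Sum>i=l N j..<l N (Suc j). (\<theta> j * sc N) ^ 2)
            = (\<theta> j) ^ 2 * (real (l N (Suc j)) / x N - real (l N j) / x N)"
          by (simp only: divide_inverse algebra_simps)
      qed
      finally have e1: "(\<Sum>i<l N J. (w N i * sc N) ^ 2)
          = (\<Sum>j<J. (\<theta> j) ^ 2 * (real (l N (Suc j)) / x N - real (l N j) / x N))" .
      have "(\<Sum>i<l N J. w N i * sc N * (sc N * (\<mu> * (real i / real N powr a) ^ (k - 2))))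
          = (\<Sum>j<J. \<Sum>i=l N j..<l N (Suc j). \<theta> j * sc N * (sc N * (\<mu> * (real i / real N powr a) ^ (k - 2))))"
        unfolding w_def by (rule sum_block_weight[where l = "l N" and f = "\<lambda>t i. t * sc N * (sc N * (\<mu> * (real i / real N powr a) ^ (k - 2)))", OF l_mono l0])
      also have "\<dots> = (\<Sum>j<J. \<theta> j * (\<mu> * (S N (Suc j) - S N j)))"
      proof (rule sum.cong[OF refl])
        fix j
        have "(\<Sum>i=l N j..<l N (Suc j). \<theta> j * sc N * (sc N * (\<mu> * (real i / real N powr a) ^ (k - 2))))
            = (\<theta> j * \<mu> * (sc N) ^ 2) * (\<Sum>i=l N j..<l N (Suc j). (real i / x N) ^ (k - 2))"
          unfolding sum_distrib_left by (intro sum.cong refl) (simp add: x_def power2_eq_square)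
        also have "\<dots> = \<theta> j * (\<mu> * (S N (Suc j) - S N j))"
          using l_mono[of j "Suc j" N] unfolding S_def s2
          by (subst sum_atLeastLessThan_diff) (simp_all add: divide_inverse algebra_simps)
        finally show "(\<Sum>i=l N j..<l N (Suc j). \<theta> j * sc N * (sc N * (\<mu> * (real i / real N powr a) ^ (k - 2))))
            = \<theta> j * (\<mu> * (S N (Suc j) - S N j))" .
      qed
      finally have e2: "(\<Sum>i<l N J. w N i * sc N * (sc N * (\<mu> * (real i / real N powr a) ^ (k - 2))))
          = (\<Sum>j<J. \<theta> j * (\<mu> * (S N (Suc j) - S N j)))" .
      have "(\<Prod>i<l N J. psi (w N i) i) = exp (\<Sum>i<l N J. of_real (- ((w N i * sc N) ^ 2) / 2)
          + \<i> * of_real (w N i * sc N * (sc N * (\<mu> * (real i / real N powr a) ^ (k - 2)))))"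
        unfolding psi_def by (simp only: exp_sum finite_lessThan)
      also have "\<dots> = exp (of_real (- (\<Sum>i<l N J. (w N i * sc N) ^ 2) / 2)
          + \<i> * of_real (\<Sum>i<l N J. w N i * sc N * (sc N * (\<mu> * (real i / real N powr a) ^ (k - 2)))))"
      proof -
        have "(\<Sum>i<n. of_real (- u i / 2) + \<i> * of_real (v i))
            = complex_of_real (- (\<Sum>i<n. u i) / 2) + \<i> * of_real (\<Sum>i<n. v i)" for n and u v :: "nat \<Rightarrow> real"
          by (simp add: sum.distrib sum_subtractf sum_negf sum_divide_distrib sum_distrib_left)
        then show ?thesis by (simp only:)
      qed
      finally show ?thesis unfolding target_def e1 e2 .
    qed
    moreover have "cmod (expect (l N J) (\<lambda>cs. iexp (\<Sum>i<l N J. w N i * sc N * (real (cs ! i) - 1))) - (\<Prod>i<l N J. psi (w N i) i))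
       \<le> bound N"
    proof -
      have "\<bar>w N i\<bar> \<le> \<Theta>" for i
        using block_weight_bound[of "l N" J \<theta> i] by (simp add: w_def \<Theta>_def)
      from chain_char[of "w N", OF this \<Theta>] show ?thesis
        unfolding lJ bound_def Gc_def D_def by (simp add: mult.assoc)
    qed
    ultimately show ?case using E by simp
  qed
  have "(\<lambda>N. C / real N) \<longlonglongrightarrow> 0"
    by (rule tendsto_divide_0[OF tendsto_const filterlim_at_top_imp_at_infinity[OF filterlim_real_sequentially]])
  then have "bound \<longlonglongrightarrow> \<Theta> ^ 3 * T * ((2 * D + 3) * (0 + 0 + 0) + 2 * Gc * 0)"
    unfolding bound_def by (intro tendsto_intros drift_error_tendsto[OF k3] scale_tendsto ratio_tendsto)
  then have bound0: "bound \<longlonglongrightarrow> 0" by simp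
  have diff: "(\<lambda>N. measure_pmf.expectation (law N) ?f - target N) \<longlonglongrightarrow> 0"
    by (rule Lim_null_comparison[OF close bound0])
  have x: "filterlim x at_top sequentially"
    unfolding x_def using a by (intro filterlim_powr_nat) auto
  have tl: "(\<lambda>N. real (l N j) / x N) \<longlonglongrightarrow> real j / real m" for j
    unfolding l_def by (rule floor_ratio_tendsto[OF x]) simp
  have tS: "(\<lambda>N. S N j) \<longlonglongrightarrow> (real j / real m) ^ (k - 2 + 1) / real (k - 2 + 1)" for j
    unfolding S_def l_def by (rule riemann_sum_power[OF x]) simp
  have "target \<longlonglongrightarrow> exp (of_real (- (\<Sum>j<J. (\<theta> j) ^ 2 * (real (Suc j) / real m - real j / real m)) / 2)
     + \<i> * of_real (\<Sum>j<J. \<theta> j * (\<mu> * ((real (Suc j) / real m) ^ (k - 2 + 1) / real (k - 2 + 1)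
          - (real j / real m) ^ (k - 2 + 1) / real (k - 2 + 1)))))"
    unfolding target_def by (intro tendsto_intros tl tS) simp
  also have "(\<Sum>j<J. \<theta> j * (\<mu> * ((real (Suc j) / real m) ^ (k - 2 + 1) / real (k - 2 + 1)
          - (real j / real m) ^ (k - 2 + 1) / real (k - 2 + 1))))
      = (\<Sum>j<J. \<theta> j * (drift (real (Suc j) / real m) - drift (real j / real m)))"
  proof -
    have "k - 2 + 1 = k - 1" "real (k - 1) = real k - 1" using k3 by auto
    then show ?thesis unfolding drift_def by (simp add: algebra_simps)
  qed
  finally have "target \<longlonglongrightarrow> exp (of_real (- (\<Sum>j<J. (\<theta> j) ^ 2 * (real (Suc j) / real m - real j / real m)) / 2)
     + \<i> * of_real (\<Sum>j<J. \<theta> j * (drift (real (Suc j) / real m) - drift (real j / real m))))" .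
  from tendsto_add[OF diff this] show ?thesis unfolding J_def by simp
qed

text \<open>A deviation from the last grid point is an excursion of the walk inside one of
  \<open>T * m\<close> blocks. The union bound splits into \<open>main m\<close>, free of
  \<open>N\<close> and small for large \<open>m\<close>, and \<open>rest m N\<close>, the queue
  contribution, which vanishes as \<open>N\<close> grows with \<open>m\<close> fixed.\<close>

lemma oscillation:
  fixes T :: nat
  assumes \<eta>: "0 < \<eta>" and \<epsilon>: "0 < \<epsilon>"
  shows "\<exists>m0. \<forall>m\<ge>m0. eventually (\<lambda>N.
      measure_pmf.prob (law N) {y. \<exists>t. 0 \<le> t \<and> t \<le> real T \<and> \<eta> < \<bar>y t - y (real (nat \<lfloor>t * real m\<rfloor>) / real m)\<bar>} \<le> \<epsilon>)
      sequentially"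
proof -
  define D where "D = \<bar>\<mu>\<bar> * real T ^ (k - 2)"
  define Gc where "Gc = near_critical_chain.G D (real T)"
  \<comment> \<open>The threshold in \<open>excursion\<close> is twice its parameter, which will be
    \<open>c\<close>.\<close>
  define c where "c = \<eta> / 2"
  \<comment> \<open>In the exponent \<open>2 * D + 3\<close> bounds \<open>\<kappa> / m\<close>, and
    one more unit covers the extra step that rounding may add to a block.\<close>
  define main where "main m = real (T * m) * (2 * exp (2 * D + 4 - c * sqrt (real m)))" for m
  define rest where "rest m N = real (T * m) * (real T * Gc * (C / real N) / (c * (sc N) ^ 2))" for m N
  have c: "0 < c" using \<eta> by (simp add: c_def)
  have "main \<longlonglongrightarrow> 0"
  proof -
    have "filterlim (\<lambda>m. c * sqrt (real m)) at_top sequentially"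
      by (intro filterlim_tendsto_pos_mult_at_top[OF tendsto_const c] filterlim_compose[OF sqrt_at_top filterlim_real_sequentially])
    from filterlim_compose[OF tendsto_power_div_exp_0[of 2] this]
    have "(\<lambda>m. (2 * real T * exp (2 * D + 4) / c ^ 2) * ((c * sqrt (real m)) ^ 2 / exp (c * sqrt (real m))))
        \<longlonglongrightarrow> (2 * real T * exp (2 * D + 4) / c ^ 2) * 0" by (intro tendsto_mult tendsto_const)
    moreover have "(2 * real T * exp (2 * D + 4) / c ^ 2) * ((c * sqrt (real m)) ^ 2 / exp (c * sqrt (real m))) = main m" for m
      using c by (simp add: main_def exp_diff power_mult_distrib)
    ultimately show ?thesis by simp
  qed
  from order_tendstoD(2)[OF this, of "\<epsilon> / 2"] \<epsilon>
  have "eventually (\<lambda>m. main m < \<epsilon> / 2) sequentially" by simp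
  then obtain m1 where m1: "\<And>m. m1 \<le> m \<Longrightarrow> main m < \<epsilon> / 2" by (auto simp: eventually_sequentially)
  show ?thesis
  proof (intro exI allI impI)
    fix m assume "max 1 m1 \<le> m"
    then have m: "0 < m" "main m < \<epsilon> / 2" using m1 by auto
    \<comment> \<open>With this parameter the variance term \<open>u ^ 2 / m\<close> stays bounded while \<open>exp (- c * u)\<close> beats the \<open>T * m\<close> blocks.\<close>
    define u where "u = sqrt (real m)"
    define \<kappa> where "\<kappa> = u * (D + 1) + (D + 2) * u ^ 2"
    have u: "0 < u" "1 \<le> u" "u ^ 2 = real m" using m by (simp_all add: u_def)
    have D: "0 \<le> D" by (simp add: D_def)
    have \<kappa>: "0 \<le> \<kappa>" "\<kappa> \<le> (2 * D + 3) * real m"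
    proof -
      have "u * 1 \<le> u * u" using u by (intro mult_left_mono) auto
      also have "u * u = real m" using u(3) by (simp only: power2_eq_square)
      finally have "u * (D + 1) \<le> real m * (D + 1)" using D by (intro mult_right_mono) auto
      then show "\<kappa> \<le> (2 * D + 3) * real m" unfolding \<kappa>_def u by (simp add: algebra_simps)
    qed (use u D in \<open>simp add: \<kappa>_def\<close>)
    have "(\<lambda>N. sc N * u) \<longlonglongrightarrow> 0 * u" by (intro tendsto_intros scale_tendsto)
    then have e1: "eventually (\<lambda>N. u * sc N < 1) sequentially"
      using order_tendstoD(2)[of "\<lambda>N. sc N * u" 0 sequentially 1] by (simp add: mult.commute)
    have "(\<lambda>N. (sc N) ^ 2 * \<kappa>) \<longlonglongrightarrow> 0 ^ 2 * \<kappa>" by (intro tendsto_intros scale_tendsto)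
    then have e2: "eventually (\<lambda>N. (sc N) ^ 2 * \<kappa> < 1) sequentially"
      using order_tendstoD(2)[of "\<lambda>N. (sc N) ^ 2 * \<kappa>" 0 sequentially 1] by simp
    have e3: "eventually (\<lambda>N. rest m N < \<epsilon> / 2) sequentially"
    proof -
      have "(\<lambda>N. (real (T * m) * (real T * Gc / c)) * (C / real N / (sc N) ^ 2)) \<longlonglongrightarrow> (real (T * m) * (real T * Gc / c)) * 0"
        by (intro tendsto_intros ratio_tendsto)
      moreover have "(real (T * m) * (real T * Gc / c)) * (C / real N / (sc N) ^ 2) = rest m N" for N
        by (simp add: rest_def mult_ac)
      ultimately have "rest m \<longlonglongrightarrow> 0" by simp
      then show ?thesis using \<epsilon> by (intro order_tendstoD(2)) auto
    qed
    have T0: "0 \<le> real T" by simp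
    show "eventually (\<lambda>N.
      measure_pmf.prob (law N) {y. \<exists>t. 0 \<le> t \<and> t \<le> real T \<and> \<eta> < \<bar>y t - y (real (nat \<lfloor>t * real m\<rfloor>) / real m)\<bar>} \<le> \<epsilon>)
      sequentially"
      using near_critical[OF T0] eventually_gt_at_top[of 0] e1 e2 e3
    proof eventually_elim
      case (elim N)
      then have nN: "nat \<lfloor>real N powr a * real T\<rfloor> \<le> N" and N: "0 < N" by simp_all
      interpret near_critical_chain "bfs_kernel \<beta> N" "\<lambda>cs. N - Suc (length cs) - queue cs" "bfs_prob \<beta> N"
        "\<lambda>i. \<mu> * (real i / real N powr a) ^ (k - 2)" "nat \<lfloor>real N powr a * real T\<rfloor>"
        "sc N" "C / real N" "drift_error C k (real T) N" "\<bar>\<mu>\<bar> * real T ^ (k - 2)" "real T"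
        using elim by blast
      define x where "x = real N powr a"
      define n where "n = nat \<lfloor>x * real T\<rfloor>"
      define l where "l j = nat \<lfloor>x * (real j / real m)\<rfloor>" for j
      have x: "0 < x" using N by (simp add: x_def)
      have s2: "(sc N) ^ 2 = inverse x" unfolding scale_square[OF N] x_def by (rule powr_minus)
      define A where "A j = {cs. \<exists>i\<in>{l j..l (Suc j)}. 2 * c \<le> sc N * \<bar>walk cs i - walk cs (l j)\<bar>}" for j
      define E where "E = {y :: real \<Rightarrow> real. \<exists>t. 0 \<le> t \<and> t \<le> real T \<and> \<eta> < \<bar>y t - y (real (nat \<lfloor>t * real m\<rfloor>) / real m)\<bar>}"
      have l_le: "l j \<le> n" if "j \<le> T * m" for j
      proof -
        have "real j \<le> real T * real m" using that by (metis of_nat_le_iff of_nat_mult)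
        then have "real j / real m \<le> real T" using m by (simp add: field_simps)
        then show ?thesis unfolding l_def n_def using x by (intro nat_mono floor_mono mult_left_mono) auto
      qed
      have E_path: "history_path N a cs \<in> E \<Longrightarrow> \<exists>j<T * m. cs \<in> A j" for cs
      proof -
        assume "history_path N a cs \<in> E"
        then obtain t where t: "0 \<le> t" "t \<le> real T"
          and h: "\<eta> < \<bar>history_path N a cs t - history_path N a cs (real (nat \<lfloor>t * real m\<rfloor>) / real m)\<bar>"
          unfolding E_def by blast
        define j where "j = nat \<lfloor>t * real m\<rfloor>"
        note g = grid_point_close[OF t(1) m(1), folded j_def]
        \<comment> \<open>Otherwise \<open>t\<close> would be the grid point \<open>T\<close>
          itself, where the deviation is 0.\<close>
        have "j < T * m"
        proof (rule ccontr)
          assume "\<not> j < T * m"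
          then have "real (T * m) \<le> real j" unfolding of_nat_le_iff by simp
          then have "real T \<le> real j / real m" using m by (simp add: field_simps)
          then have "t = real j / real m" using g t by simp
          then show False using h \<eta> unfolding j_def[symmetric] by simp
        qed
        moreover have "nat \<lfloor>x * t\<rfloor> \<in> {l j..l (Suc j)}"
        proof -
          have "t \<le> real (Suc j) / real m" using g(3) m by (simp add: add_divide_distrib)
          then have "x * t \<le> x * (real (Suc j) / real m)" using less_imp_le[OF x] by (rule mult_left_mono)
          moreover have "x * (real j / real m) \<le> x * t" using g(2) less_imp_le[OF x] by (rule mult_left_mono)
          ultimately show ?thesis unfolding l_def atLeastAtMost_iff by (intro conjI nat_mono floor_mono)
        qed
        moreover have "2 * c \<le> sc N * \<bar>walk cs (nat \<lfloor>x * t\<rfloor>) - walk cs (l j)\<bar>"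
        proof -
          have "history_path N a cs t - history_path N a cs (real j / real m)
              = sc N * (walk cs (nat \<lfloor>x * t\<rfloor>) - walk cs (l j))"
            by (simp add: history_path_def l_def x_def right_diff_distrib)
          then show ?thesis using h unfolding j_def[symmetric] by (simp add: abs_mult c_def)
        qed
        ultimately show ?thesis unfolding A_def by blast
      qed
      have A_bound: "prob n (A j) \<le> 2 * exp (2 * D + 4 - c * u) + real T * Gc * (C / real N) / (c * (sc N) ^ 2)"
        if j: "j < T * m" for j
      proof -
        have lj: "l j \<le> l (Suc j)" "l (Suc j) \<le> n"
          using grid_floor_mono[of x j "Suc j" m] x l_le[of "Suc j"] j by (simp_all add: l_def)
        \<comment> \<open>The event reads only the first \<open>l (Suc j)\<close> steps, so the
          chain may be cut there.\<close>
        have "prob n (A j) = measure_pmf.prob (map_pmf (take (l (Suc j))) (history_pmf (bfs_kernel \<beta> N) n)) (A j)"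
          unfolding measure_map_pmf A_def
          by (intro arg_cong[where f = "measure_pmf.prob _"]) (use lj in \<open>auto simp: walk_take\<close>)
        also have "\<dots> = prob (l (Suc j)) (A j)" by (simp only: take_history_pmf[OF lj(2)])
        also have "\<dots> \<le> 2 * exp (- u * c + real (l (Suc j) - l j) * (sc N) ^ 2 * \<kappa>) + real T * Gc * (C / real N) / (c * (sc N) ^ 2)"
          using excursion[OF lj(1) lj(2)[unfolded n_def x_def] u(1) _ c] elim
          unfolding A_def \<kappa>_def Gc_def D_def by simp
        also have "\<dots> \<le> 2 * exp (2 * D + 4 - c * u) + real T * Gc * (C / real N) / (c * (sc N) ^ 2)"
        proof -
          have "real (l (Suc j) - l j) \<le> x / real m + 1"
          proof -
            have "real (l (Suc j)) \<le> x * (real (Suc j) / real m)" unfolding l_def using x by (simp add: of_nat_floor)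
            moreover have "x * (real j / real m) - 1 \<le> real (l j)" unfolding l_def by linarith
            moreover have "x * (real (Suc j) / real m) = x * (real j / real m) + x / real m"
              by (simp add: add_divide_distrib distrib_left)
            ultimately show ?thesis using lj(1) by (simp add: of_nat_diff)
          qed
          then have "real (l (Suc j) - l j) * ((sc N) ^ 2 * \<kappa>) \<le> (x / real m + 1) * ((sc N) ^ 2 * \<kappa>)"
            using \<kappa> by (intro mult_right_mono) auto
          also have "\<dots> = \<kappa> / real m + (sc N) ^ 2 * \<kappa>"
            unfolding s2 using x by (simp add: field_simps)
          also have "\<dots> \<le> (2 * D + 3) + 1"
            using \<kappa> elim(4) m by (intro add_mono) (auto simp: field_simps)
          finally show ?thesis by (simp add: mult.assoc mult.commute[of u c])
        qed
        finally show ?thesis .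
      qed
      have ind: "(indicator E y :: real) = indicator E z" if "\<And>t. 0 \<le> t \<Longrightarrow> t \<le> real T \<Longrightarrow> y t = z t" for y z
      proof -
        have "y (real (nat \<lfloor>t * real m\<rfloor>) / real m) = z (real (nat \<lfloor>t * real m\<rfloor>) / real m)" if "0 \<le> t" "t \<le> real T" for t
          using grid_point_close[OF that(1) m(1)] that by (intro \<open>\<And>t. 0 \<le> t \<Longrightarrow> t \<le> real T \<Longrightarrow> y t = z t\<close>) auto
        with that have "y \<in> E \<longleftrightarrow> z \<in> E" unfolding E_def mem_Collect_eq by (intro ex_cong1) auto
        then show ?thesis by (simp add: indicator_def)
      qed
      have "measure_pmf.prob (law N) E = measure_pmf.expectation (map_pmf (indicator E) (law N)) (\<lambda>z. z :: real)" by simp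
      also have "\<dots> = measure_pmf.expectation (history_pmf (bfs_kernel \<beta> N) n) (\<lambda>cs. indicator E (history_path N a cs))"
        using rescaled_walk_law_history[OF nonneg nN ind] unfolding n_def x_def by simp
      also have "\<dots> \<le> expect n (\<lambda>cs. \<Sum>j<T * m. indicator (A j) cs)"
      proof (rule expect_mono)
        fix cs :: "nat list"
        show "(indicator E (history_path N a cs) :: real) \<le> (\<Sum>j<T * m. indicator (A j) cs)"
        proof (cases "history_path N a cs \<in> E")
          case True
          then obtain j where j: "j < T * m" "cs \<in> A j" using E_path by blast
          then have "(indicator (A j) cs :: real) \<le> (\<Sum>j<T * m. indicator (A j) cs)"
            by (intro member_le_sum) auto
          then show ?thesis using True j by simp
        qed (simp add: sum_nonneg)
      qed
      also have "\<dots> = (\<Sum>j<T * m. prob n (A j))"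
        by (simp add: Bochner_Integration.integral_sum[OF integrable_hist])
      also have "\<dots> \<le> (\<Sum>j<T * m. 2 * exp (2 * D + 4 - c * u) + real T * Gc * (C / real N) / (c * (sc N) ^ 2))"
        by (intro sum_mono A_bound) simp
      also have "\<dots> = main m + rest m N"
        by (simp add: main_def rest_def u_def distrib_left)
      also have "\<dots> \<le> \<epsilon>" using m(2) elim(5) by simp
      finally show ?case unfolding E_def .
    qed
  qed
qed

end

theorem theorem3p1:
  fixes \<beta> :: "nat \<Rightarrow> real" and k :: nat
    and M :: "'a measure" and B :: "'a \<Rightarrow> real \<Rightarrow> real"
    and F :: "(real \<Rightarrow> real) \<Rightarrow> real"
  assumes nonneg: "\<forall>j\<ge>2. 0 \<le> \<beta> j"
    and deriv_finite: "summable (\<lambda>j. real j * \<beta> j)"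
    and k3: "3 \<le> k"
    and crit: "\<forall>j. 2 \<le> j \<and> j \<le> k - 1 \<longrightarrow> \<beta> j = 1 / (real j * (real j - 1))"
    and BM: "standard_BM M B"
    and F_bounded: "bounded (range F)"
    and F_cont: "ucc_continuous F"
    and F_meas: "(\<lambda>w. F (\<lambda>t. B w t + mu \<beta> k / (real k - 1) * t ^ (k - 1))) \<in> borel_measurable M"
  shows "(\<lambda>N. measure_pmf.expectation (rescaled_walk_law \<beta> k N) F)
           \<longlonglongrightarrow> prob_space.expectation M
                 (\<lambda>w. F (\<lambda>t. B w t + mu \<beta> k / (real k - 1) * t ^ (k - 1)))"
proof (rule bfs_near_critical[OF nonneg deriv_finite k3 crit])
  fix C :: real
  assume C: "\<And>T. 0 \<le> T \<Longrightarrow> eventually (\<lambda>N. nat \<lfloor>real N powr alpha k * T\<rfloor> \<le> N \<and>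
      near_critical_chain (bfs_kernel \<beta> N) (\<lambda>cs. N - Suc (length cs) - queue cs) (bfs_prob \<beta> N)
        (\<lambda>i. mu \<beta> k * (real i / real N powr alpha k) ^ (k - 2)) (nat \<lfloor>real N powr alpha k * T\<rfloor>)
        (real N powr (- alpha k / 2)) (C / real N) (drift_error C k T N) (\<bar>mu \<beta> k\<bar> * T ^ (k - 2)) T) sequentially"
  interpret critical_hypergraph \<beta> k C
    by (rule critical_hypergraph.intro[OF nonneg k3 C])
  interpret prob_space M using BM by (simp add: standard_BM_def)
  define W where "W w t = B w t + drift t" for w t
  have B_meas: "(\<lambda>w. B w t) \<in> borel_measurable M" for t using BM unfolding standard_BM_def by blast
  have B_path: "B w 0 = 0" "continuous_on {0..} (B w)" if "w \<in> space M" for w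
    using BM that unfolding standard_BM_def by blast+
  interpret grid_convergence M "rescaled_walk_law \<beta> k" W
  proof
    show "(\<lambda>w. W w t) \<in> borel_measurable M" for t using B_meas by (simp add: W_def)
    show "continuous_on {0..} (W w)" if "w \<in> space M" for w
      using B_path(2)[OF that] unfolding W_def drift_def by (intro continuous_intros)
    show "W w 0 = 0" if "w \<in> space M" for w
      using B_path(1)[OF that] k3 by (simp add: W_def drift_def)
    show "x 0 = 0" if "x \<in> set_pmf (rescaled_walk_law \<beta> k N)" for N x
      using that by (auto simp: rescaled_walk_law_def rescaled_walk_def bfs_walk_def)
    show "\<exists>m0. \<forall>m\<ge>m0. eventually (\<lambda>N.
      measure_pmf.prob (rescaled_walk_law \<beta> k N) {x. \<exists>t. 0 \<le> t \<and> t \<le> real T \<and> \<eta> < \<bar>x t - x (real (nat \<lfloor>t * real m\<rfloor>) / real m)\<bar>} \<le> \<epsilon>)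
      sequentially" if "0 < \<eta>" "0 < \<epsilon>" for T :: nat and \<eta> \<epsilon> by (rule oscillation[OF that])
    fix m :: nat and \<theta> :: "nat \<Rightarrow> real" assume m: "0 < m"
    let ?d = "\<Sum>j<m * m. \<theta> j * (drift (real (Suc j) / real m) - drift (real j / real m))"
    let ?t = "\<lambda>j. real j / real m"
    \<comment> \<open>The drift is deterministic and contributes only the phase
      \<open>iexp ?d\<close>; the remaining integral is that of the Brownian increments.\<close>
    have "(\<integral>w. iexp (\<Sum>j<m * m. \<theta> j * grid_increment m (W w) j) \<partial>M)
       = (\<integral>w. iexp ?d * iexp (\<Sum>j<m * m. \<theta> j * (B w (?t (Suc j)) - B w (?t j))) \<partial>M)"
    proof (rule Bochner_Integration.integral_cong[OF refl])
      fix w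
      have "(\<Sum>j<m * m. \<theta> j * grid_increment m (W w) j) = ?d + (\<Sum>j<m * m. \<theta> j * (B w (?t (Suc j)) - B w (?t j)))"
        unfolding sum.distrib[symmetric] by (intro sum.cong refl) (simp add: grid_increment_def W_def algebra_simps)
      then show "iexp (\<Sum>j<m * m. \<theta> j * grid_increment m (W w) j)
          = iexp ?d * iexp (\<Sum>j<m * m. \<theta> j * (B w (?t (Suc j)) - B w (?t j)))"
        by (simp only: of_real_add distrib_left exp_add)
    qed
    also have "\<dots> = iexp ?d * exp (of_real (- (\<Sum>j<m * m. (\<theta> j) ^ 2 * (?t (Suc j) - ?t j)) / 2))"
    proof -
      have "(\<integral>w. iexp (\<Sum>j<m * m. \<theta> j * (B w (?t (Suc j)) - B w (?t j))) \<partial>M)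
          = exp (of_real (- (\<Sum>j<m * m. (\<theta> j) ^ 2 * (?t (Suc j) - ?t j)) / 2))"
        by (rule BM_char[OF BM]) (use m in \<open>auto intro!: divide_strict_right_mono\<close>)
      then show ?thesis by (simp only: integral_mult_right_zero)
    qed
    also have "\<dots> = exp (of_real (- (\<Sum>j<m * m. (\<theta> j) ^ 2 * (?t (Suc j) - ?t j)) / 2) + \<i> * of_real ?d)"
      by (simp only: exp_add mult.commute)
    finally show "(\<lambda>N. measure_pmf.expectation (rescaled_walk_law \<beta> k N) (\<lambda>x. iexp (\<Sum>j<m * m. \<theta> j * grid_increment m x j)))
        \<longlonglongrightarrow> (\<integral>w. iexp (\<Sum>j<m * m. \<theta> j * grid_increment m (W w) j) \<partial>M)"
      using grid_law_char[OF m, of \<theta>] by (simp only:)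
  qed
  show ?thesis
    using functional_tendsto[OF F_bounded F_cont] F_meas unfolding W_def drift_def by simp
qed

end
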